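(* Let $\mathcal{K}$ be a field of characteristic $p>0$, $n\ge3$, $q\in\mathcal{K}$, and let $k,k',m\in\{1,\dots,n\}$ be pairwise distinct. Put $h=E_{kk}-E_{k'k'}$, $e=E_{km}$ in $\mathfrak{sl}_n(\mathcal{K})$. Then there is a (Jordanian) quantization of $\mathbf{u}(\mathfrak{sl}_n)$, i.e. a Hopf algebra structure over $\mathcal{K}[t]_p^{(q)}$ on $\mathbf{u}_{t,q}(\mathfrak{sl}_n)$ with undeformed product, given for $1\le i\ne j\le n$ by $$\Delta(E_{ii}-E_{jj})=(E_{ii}-E_{jj})\otimes1+1\otimes(E_{ii}-E_{jj})+(\delta_{ik}-\delta_{jk}-\delta_{im}+\delta_{jm})\,h\otimes(1-et)^{-1}et,$$ $$\Delta(E_{ji})=E_{ji}\otimes(1-et)^{\delta_{jk}-\delta_{ik}-\delta_{jk'}+\delta_{ik'}}+1\otimes E_{ji}-h\otimes(1-et)^{-1}(\delta_{jm}E_{ki}-\delta_{ik}E_{jm})t-\delta_{jm}\delta_{ik}\,h^{\langle2\rangle}\otimes(1-et)^{-2}et^2,$$ $$S(E_{ii}-E_{jj})=-(E_{ii}-E_{jj})+(\delta_{ik}-\delta_{jk}-\delta_{im}+\delta_{jm})\,e\,h_1t,$$ $$S(E_{ji})=-(1-et)^{-(\delta_{jk}-\delta_{ik}-\delta_{jk'}+\delta_{ik'})}\Bigl(E_{ji}+(\delta_{jm}E_{ki}-\delta_{ik}E_{jm})h_1t-\delta_{jm}\delta_{ik}\,e\,h_1^{\langle2\rangle}t^2\Bigr),$$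 $$\varepsilon(E_{ii}-E_{jj})=\varepsilon(E_{ji})=0.$$
   Context: $E_{ij}$ are the matrix units; $\mathbf{u}(\mathfrak{sl}_n)$ is the restricted universal enveloping algebra of $\mathfrak{sl}_n$ over $\mathcal{K}$ (with $p$-map the $p$-th power of matrices, so $E_{ij}^p=0$ for $i\neq j$ and $(E_{ii}-E_{jj})^p=E_{ii}-E_{jj}$ in $\mathbf u(\mathfrak{sl}_n)$); $\mathcal{K}[t]_p^{(q)}=\mathcal{K}[t]/(t^p-qt)$; $\mathbf{u}_{t,q}(\mathfrak{sl}_n)=\mathbf{u}(\mathfrak{sl}_n)\otimes_{\mathcal{K}}\mathcal{K}[t]_p^{(q)}$. Since $e^p=0$, $1-et$ is invertible. $h_1=h+1$, $h^{\langle2\rangle}=h(h+1)$, $h_1^{\langle2\rangle}=(h+1)(h+2)$. In the expression $\delta_{jm}E_{ki}-\delta_{ik}E_{jm}$ the case $j=m,i=k$ gives $E_{kk}-E_{mm}$. *)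

theory Defs
  imports
    "HOL-Analysis.Analysis"
    "HOL-Computational_Algebra.Polynomial"
    "HOL-Algebra.QuotRing"
    "HOL-Algebra.Module"
begin

text \<open>The locale \<open>algebra\<close> of HOL-Algebra is restricted to commutative algebras; this is the
  same notion for a possibly noncommutative, unital algebra over a commutative ring.\<close>

locale assoc_algebra = Module.module R A + Ring.ring A for R (structure) and A (structure) +
  assumes smult_mult_left:
      "\<lbrakk>a \<in> carrier R; x \<in> carrier A; y \<in> carrier A\<rbrakk> \<Longrightarrow>
        (a \<odot>\<^bsub>A\<^esub> x) \<otimes>\<^bsub>A\<^esub> y = a \<odot>\<^bsub>A\<^esub> (x \<otimes>\<^bsub>A\<^esub> y)"
    and smult_mult_right:
      "\<lbrakk>a \<in> carrier R; x \<in> carrier A; y \<in> carrier A\<rbrakk> \<Longrightarrow>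
        x \<otimes>\<^bsub>A\<^esub> (a \<odot>\<^bsub>A\<^esub> y) = a \<odot>\<^bsub>A\<^esub> (x \<otimes>\<^bsub>A\<^esub> y)"

definition alg_quot :: "('r, 'a, 'm) module_scheme \<Rightarrow> 'a set \<Rightarrow> ('r, 'a set) module" where
  "alg_quot A I =
    \<lparr>carrier = carrier (A Quot I), mult = mult (A Quot I), one = one (A Quot I),
     zero = zero (A Quot I), add = add (A Quot I),
     smult = (\<lambda>r X. \<Union>x\<in>X. I +>\<^bsub>A\<^esub> (r \<odot>\<^bsub>A\<^esub> x))\<rparr>"

definition monoid_algebra ::
  "('r, 'x) ring_scheme \<Rightarrow> ('g, 'y) monoid_scheme \<Rightarrow> ('r, 'g \<Rightarrow> 'r) module" where
  "monoid_algebra R G =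
    \<lparr>carrier = {f. range f \<subseteq> carrier R \<and> finite {g. f g \<noteq> \<zero>\<^bsub>R\<^esub>} \<and>
                  {g. f g \<noteq> \<zero>\<^bsub>R\<^esub>} \<subseteq> carrier G},
     mult = (\<lambda>f f' z. \<Oplus>\<^bsub>R\<^esub>w \<in> {(x, y). f x \<noteq> \<zero>\<^bsub>R\<^esub> \<and> f' y \<noteq> \<zero>\<^bsub>R\<^esub> \<and> x \<otimes>\<^bsub>G\<^esub> y = z}.
               f (fst w) \<otimes>\<^bsub>R\<^esub> f' (snd w)),
     one = (\<lambda>g. if g = \<one>\<^bsub>G\<^esub> then \<one>\<^bsub>R\<^esub> else \<zero>\<^bsub>R\<^esub>),
     zero = (\<lambda>g. \<zero>\<^bsub>R\<^esub>),
     add = (\<lambda>f f' g. f g \<oplus>\<^bsub>R\<^esub> f' g),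
     smult = (\<lambda>r f g. r \<otimes>\<^bsub>R\<^esub> f g)\<rparr>"

definition single :: "('r, 'x) ring_scheme \<Rightarrow> 'g \<Rightarrow> 'g \<Rightarrow> 'r" where
  "single R g = (\<lambda>g'. if g' = g then \<one>\<^bsub>R\<^esub> else \<zero>\<^bsub>R\<^esub>)"

text \<open>The free \<open>R\<close>-module on the set \<open>A \<times> B\<close> is the monoid algebra of the product of the
  multiplicative monoids of \<open>A\<close> and \<open>B\<close>, with product \<open>(a, b) (a', b') = (a a', b b')\<close>. The
  submodule spanned by the bilinearity relations below is stable under left and right
  multiplication by the basis elements \<open>(c, d)\<close>, so it is the two-sided ideal generated by
  them, and the quotient is the usual tensor product over \<open>R\<close> with its algebra structure.\<close>

definition tensor_rels ::
  "('r, 'x) ring_scheme \<Rightarrow> ('r, 'a, 'm) module_scheme \<Rightarrow> ('r, 'b, 'n) module_scheme \<Rightarrow>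
    ('a \<times> 'b \<Rightarrow> 'r) set" where
  "tensor_rels R A B =
    (let F = monoid_algebra R (A \<times>\<times> B); s = (\<lambda>a b. single R (a, b)) in
      {s (a \<oplus>\<^bsub>A\<^esub> a') b \<ominus>\<^bsub>F\<^esub> (s a b \<oplus>\<^bsub>F\<^esub> s a' b) | a a' b.
        a \<in> carrier A \<and> a' \<in> carrier A \<and> b \<in> carrier B} \<union>
      {s a (b \<oplus>\<^bsub>B\<^esub> b') \<ominus>\<^bsub>F\<^esub> (s a b \<oplus>\<^bsub>F\<^esub> s a b') | a b b'.
        a \<in> carrier A \<and> b \<in> carrier B \<and> b' \<in> carrier B} \<union>
      {s (r \<odot>\<^bsub>A\<^esub> a) b \<ominus>\<^bsub>F\<^esub> r \<odot>\<^bsub>F\<^esub> s a b | r a b.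
        r \<in> carrier R \<and> a \<in> carrier A \<and> b \<in> carrier B} \<union>
      {s a (r \<odot>\<^bsub>B\<^esub> b) \<ominus>\<^bsub>F\<^esub> r \<odot>\<^bsub>F\<^esub> s a b | r a b.
        r \<in> carrier R \<and> a \<in> carrier A \<and> b \<in> carrier B})"

definition tensor_ideal ::
  "('r, 'x) ring_scheme \<Rightarrow> ('r, 'a, 'm) module_scheme \<Rightarrow> ('r, 'b, 'n) module_scheme \<Rightarrow>
    ('a \<times> 'b \<Rightarrow> 'r) set" where
  "tensor_ideal R A B = Idl\<^bsub>monoid_algebra R (A \<times>\<times> B)\<^esub> (tensor_rels R A B)"

definition tensor ::
  "('r, 'x) ring_scheme \<Rightarrow> ('r, 'a, 'm) module_scheme \<Rightarrow> ('r, 'b, 'n) module_scheme \<Rightarrow>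
    ('r, ('a \<times> 'b \<Rightarrow> 'r) set) module" where
  "tensor R A B = alg_quot (monoid_algebra R (A \<times>\<times> B)) (tensor_ideal R A B)"

definition pure_tensor ::
  "('r, 'x) ring_scheme \<Rightarrow> ('r, 'a, 'm) module_scheme \<Rightarrow> ('r, 'b, 'n) module_scheme \<Rightarrow>
    'a \<Rightarrow> 'b \<Rightarrow> ('a \<times> 'b \<Rightarrow> 'r) set" where
  "pure_tensor R A B a b =
    tensor_ideal R A B +>\<^bsub>monoid_algebra R (A \<times>\<times> B)\<^esub> single R (a, b)"

text \<open>The linear map out of a tensor product into the \<open>R\<close>-module \<open>M\<close> induced by a map \<open>\<beta>\<close> on
  pairs. If \<open>\<beta>\<close> is \<open>R\<close>-bilinear, the value does not depend on the representative \<open>f\<close>.\<close>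

definition tensor_lift ::
  "('r, 'x) ring_scheme \<Rightarrow> ('r, 'c, 'm) module_scheme \<Rightarrow> ('a \<Rightarrow> 'b \<Rightarrow> 'c) \<Rightarrow>
    ('a \<times> 'b \<Rightarrow> 'r) set \<Rightarrow> 'c" where
  "tensor_lift R M \<beta> X =
    (let f = (SOME f. f \<in> X) in
      \<Oplus>\<^bsub>M\<^esub>z \<in> {z. f z \<noteq> \<zero>\<^bsub>R\<^esub>}. f z \<odot>\<^bsub>M\<^esub> \<beta> (fst z) (snd z))"

definition tensor_map ::
  "('r, 'x) ring_scheme \<Rightarrow> ('r, 'c, 'm) module_scheme \<Rightarrow> ('r, 'd, 'n) module_scheme \<Rightarrow>
    ('a \<Rightarrow> 'c) \<Rightarrow> ('b \<Rightarrow> 'd) \<Rightarrow> ('a \<times> 'b \<Rightarrow> 'r) set \<Rightarrow> ('c \<times> 'd \<Rightarrow> 'r) set" where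
  "tensor_map R C D \<phi> \<psi> =
    tensor_lift R (tensor R C D) (\<lambda>a b. pure_tensor R C D (\<phi> a) (\<psi> b))"

definition tensor_assoc ::
  "('r, 'x) ring_scheme \<Rightarrow> ('r, 'a, 'l) module_scheme \<Rightarrow> ('r, 'b, 'm) module_scheme \<Rightarrow>
    ('r, 'c, 'n) module_scheme \<Rightarrow>
    (('a \<times> 'b \<Rightarrow> 'r) set \<times> 'c \<Rightarrow> 'r) set \<Rightarrow> ('a \<times> ('b \<times> 'c \<Rightarrow> 'r) set \<Rightarrow> 'r) set" where
  "tensor_assoc R A B C =
    (let BC = tensor R B C; T = tensor R A BC in
      tensor_lift R T
        (\<lambda>X c. tensor_lift R T (\<lambda>a b. pure_tensor R A BC a (pure_tensor R B C b c)) X))"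

locale hopf_algebra = assoc_algebra R A for R (structure) and A (structure) +
  fixes comult :: "'b \<Rightarrow> ('b \<times> 'b \<Rightarrow> 'a) set"
    and counit :: "'b \<Rightarrow> 'a"
    and antipode :: "'b \<Rightarrow> 'b"
  assumes comult_hom: "comult \<in> ring_hom A (tensor R A A)"
    and comult_smult: "\<lbrakk>r \<in> carrier R; x \<in> carrier A\<rbrakk> \<Longrightarrow>
      comult (r \<odot>\<^bsub>A\<^esub> x) = r \<odot>\<^bsub>tensor R A A\<^esub> comult x"
    and counit_hom: "counit \<in> ring_hom A R"
    and counit_smult: "\<lbrakk>r \<in> carrier R; x \<in> carrier A\<rbrakk> \<Longrightarrow>
      counit (r \<odot>\<^bsub>A\<^esub> x) = r \<otimes>\<^bsub>R\<^esub> counit x"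
    and coassoc: "x \<in> carrier A \<Longrightarrow>
      tensor_assoc R A A A (tensor_map R (tensor R A A) A comult (\<lambda>a. a) (comult x)) =
      tensor_map R A (tensor R A A) (\<lambda>a. a) comult (comult x)"
    and counit_left: "x \<in> carrier A \<Longrightarrow>
      tensor_lift R A (\<lambda>a b. counit a \<odot>\<^bsub>A\<^esub> b) (comult x) = x"
    and counit_right: "x \<in> carrier A \<Longrightarrow>
      tensor_lift R A (\<lambda>a b. counit b \<odot>\<^bsub>A\<^esub> a) (comult x) = x"
    and antipode_closed: "x \<in> carrier A \<Longrightarrow> antipode x \<in> carrier A"
    and antipode_add: "\<lbrakk>x \<in> carrier A; y \<in> carrier A\<rbrakk> \<Longrightarrow>
      antipode (x \<oplus>\<^bsub>A\<^esub> y) = antipode x \<oplus>\<^bsub>A\<^esub> antipode y"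
    and antipode_smult: "\<lbrakk>r \<in> carrier R; x \<in> carrier A\<rbrakk> \<Longrightarrow>
      antipode (r \<odot>\<^bsub>A\<^esub> x) = r \<odot>\<^bsub>A\<^esub> antipode x"
    and antipode_left: "x \<in> carrier A \<Longrightarrow>
      tensor_lift R A (\<lambda>a b. antipode a \<otimes>\<^bsub>A\<^esub> b) (comult x) = counit x \<odot>\<^bsub>A\<^esub> \<one>\<^bsub>A\<^esub>"
    and antipode_right: "x \<in> carrier A \<Longrightarrow>
      tensor_lift R A (\<lambda>a b. a \<otimes>\<^bsub>A\<^esub> antipode b) (comult x) = counit x \<odot>\<^bsub>A\<^esub> \<one>\<^bsub>A\<^esub>"

definition ring_of_class :: "'k::comm_ring_1 ring" where
  "ring_of_class = \<lparr>carrier = UNIV, mult = (*), one = 1, zero = 0, add = (+)\<rparr>"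

definition poly_algebra :: "('k::comm_ring_1, 'k poly) module" where
  "poly_algebra = \<lparr>carrier = UNIV, mult = (*), one = 1, zero = 0, add = (+),
     smult = Polynomial.smult\<rparr>"

definition tpoly_ideal :: "nat \<Rightarrow> 'k::field \<Rightarrow> 'k poly set" where
  "tpoly_ideal p q = Idl\<^bsub>poly_algebra\<^esub> {monom 1 p - Polynomial.smult q (monom 1 1)}"

definition tpoly :: "nat \<Rightarrow> 'k::field \<Rightarrow> ('k, 'k poly set) module" where
  "tpoly p q = alg_quot poly_algebra (tpoly_ideal p q)"

definition tvar :: "nat \<Rightarrow> 'k::field \<Rightarrow> 'k poly set" where
  "tvar p q = tpoly_ideal p q +>\<^bsub>poly_algebra\<^esub> monom 1 1"

text \<open>Note that \<open>*\<close> and \<open>^\<close> are componentwise on the type of vectors; the matrix product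
  is \<open>**\<close>. Rows and columns are indexed by the finite type \<open>'n\<close>.\<close>

definition matrix_power :: "'k::semiring_1^'n^'n \<Rightarrow> nat \<Rightarrow> 'k^'n^'n" where
  "matrix_power X r = ((\<lambda>Y. X ** Y) ^^ r) (mat 1)"

definition matrix_unit :: "'n \<Rightarrow> 'n \<Rightarrow> 'k::zero_neq_one^'n^'n" where
  "matrix_unit i j = (\<chi> a b. if a = i \<and> b = j then 1 else 0)"

definition sl :: "('k::field^'n^'n) set" where
  "sl = {X. trace X = 0}"

text \<open>The free associative algebra on the set \<open>sl\<close> (the monoid algebra of the words in
  \<open>sl\<close>) modulo the relations saying that the inclusion of \<open>sl\<close> is linear, turns the matrix
  commutator into the commutator, and turns the matrix \<open>p\<close>-th power into the \<open>p\<close>-th power.\<close>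

definition free_algebra_sl :: "('k::field, ('k^'n^'n) list \<Rightarrow> 'k) module" where
  "free_algebra_sl =
    monoid_algebra ring_of_class \<lparr>carrier = lists sl, mult = (@), one = []\<rparr>"

definition u_sl_rels :: "nat \<Rightarrow> (('k::field^'n^'n) list \<Rightarrow> 'k) set" where
  "u_sl_rels p =
    (let F = free_algebra_sl; g = (\<lambda>X. single ring_of_class [X]) in
      {g (X + Y) \<ominus>\<^bsub>F\<^esub> (g X \<oplus>\<^bsub>F\<^esub> g Y) | X Y. X \<in> sl \<and> Y \<in> sl} \<union>
      {g (map_matrix (\<lambda>x. c * x) X) \<ominus>\<^bsub>F\<^esub> c \<odot>\<^bsub>F\<^esub> g X | c X. X \<in> sl} \<union>
      {g (X ** Y - Y ** X) \<ominus>\<^bsub>F\<^esub> (g X \<otimes>\<^bsub>F\<^esub> g Y \<ominus>\<^bsub>F\<^esub> g Y \<otimes>\<^bsub>F\<^esub> g X) | X Y. X \<in> sl \<and> Y \<in> sl} \<union>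
      {g (matrix_power X p) \<ominus>\<^bsub>F\<^esub> g X [^]\<^bsub>F\<^esub> p | X. X \<in> sl})"

definition u_sl_ideal :: "nat \<Rightarrow> (('k::field^'n^'n) list \<Rightarrow> 'k) set" where
  "u_sl_ideal p = Idl\<^bsub>free_algebra_sl\<^esub> (u_sl_rels p)"

definition u_sl :: "nat \<Rightarrow> ('k::field, (('k^'n^'n) list \<Rightarrow> 'k) set) module" where
  "u_sl p = alg_quot free_algebra_sl (u_sl_ideal p)"

definition u_sl_gen :: "nat \<Rightarrow> 'k::field^'n^'n \<Rightarrow> (('k^'n^'n) list \<Rightarrow> 'k) set" where
  "u_sl_gen p X = u_sl_ideal p +>\<^bsub>free_algebra_sl\<^esub> single ring_of_class [X]"

text \<open>The \<open>K\<close>-algebra \<open>u(sl\<^sub>n) \<otimes>\<^sub>K K[t] / (t^p - q t)\<close>, regarded as an algebra over its second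
  factor, which acts by \<open>r \<odot> x = (1 \<otimes> r) x\<close>.\<close>

type_synonym ('k, 'n) utq_elem = "((('k^'n^'n) list \<Rightarrow> 'k) set \<times> 'k poly set \<Rightarrow> 'k) set"

definition utq_sl :: "nat \<Rightarrow> 'k::field \<Rightarrow> ('k poly set, ('k, 'n::finite) utq_elem) module" where
  "utq_sl p q =
    (let U = u_sl p; R = tpoly p q; T = tensor ring_of_class U R in
      \<lparr>carrier = carrier T, mult = mult T, one = one T, zero = zero T, add = add T,
       smult = (\<lambda>r x. pure_tensor ring_of_class U R \<one>\<^bsub>U\<^esub> r \<otimes>\<^bsub>T\<^esub> x)\<rparr>)"

definition utq_gen :: "nat \<Rightarrow> 'k::field \<Rightarrow> 'k^'n::finite^'n \<Rightarrow> ('k, 'n) utq_elem" where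
  "utq_gen p q X =
    pure_tensor ring_of_class (u_sl p) (tpoly p q) (u_sl_gen p X) \<one>\<^bsub>tpoly p q\<^esub>"

definition kdelta :: "'i \<Rightarrow> 'i \<Rightarrow> int" where
  "kdelta i j = (if i = j then 1 else 0)"

end

theory Submission
  imports Defs
begin

text \<open>
  Put \<open>n = e t\<close> and \<open>w = 1 - n\<close>. Since \<open>h\<^sup>p = h\<close>, the unit decomposes into idempotents
  \<open>P\<^sub>c = 1 - (h - c)\<^sup>p\<^sup>-\<^sup>1\<close> (\<open>c\<close> modulo \<open>p\<close>) with \<open>h P\<^sub>c = c P\<^sub>c\<close>, and since \<open>w\<^sup>p = 1\<close> the Jordanian twist
  \<open>F = (1 \<otimes> w)\<^bsup>h \<otimes> 1\<^esup>\<close> makes sense as \<open>\<Sum>\<^sub>c P\<^sub>c \<otimes> w\<^sup>c\<close>. The coproduct is the standard one conjugated by \<open>F\<close>,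
  and the antipode is the standard one conjugated by \<open>V = \<Sum>\<^sub>c w\<^bsup>-c-1\<^esup> P\<^sub>c\<close>. Hence they are automatically
  a homomorphism and an antihomomorphism of algebras, so the Hopf axioms need only be checked on
  the generators. The values there follow from \<open>[h, X] = b X\<close> and the fact that \<open>ad n\<close> has cube zero
  on the generators \<open>X\<close>, by comparing both sides after multiplication with each \<open>P\<^sub>c\<close>.
\<close>

section \<open>Monoid algebras\<close>

text \<open>In characteristic zero the same twist is exp(h \<otimes> log(1 - et)); the eigenvalue
  decomposition of \<open>h\<close> avoids its denominators. Choosing k' different from m gives
  [h, e] = e, where k' = m would give 2 e, so nothing degenerates for p = 2. For the same reason an
  element X travels with a pair (x, z) in which z is recorded on its own: the relation [n, x] = -2 z
  does not determine z when p = 2.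

  All algebras in the statement are quotients of monoid algebras by ideals, and maps out of a tensor
  product are evaluated at a representative picked by \<open>SOME\<close>. Hence every map has to
  come from a universal property, including independence of the representative.

  The antipode axiom resists the reduction to generators more than the others do: multiplying the
  two legs after applying the antipode to one of them is not an algebra homomorphism. It is
  therefore studied together with a parameter inserted between the legs, for which there is a rule
  for products.\<close>

definition lin_ext ::
  "('r, 'x) ring_scheme \<Rightarrow> ('r, 'c, 'm) module_scheme \<Rightarrow> ('g \<Rightarrow> 'c) \<Rightarrow> ('g \<Rightarrow> 'r) \<Rightarrow> 'c" where
  "lin_ext R M \<phi> f = (\<Oplus>\<^bsub>M\<^esub>g \<in> {g. f g \<noteq> \<zero>\<^bsub>R\<^esub>}. f g \<odot>\<^bsub>M\<^esub> \<phi> g)"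

locale monoid_alg = R?: cring R + G?: Group.monoid G for R (structure) and G (structure)
begin

abbreviation MA where "MA \<equiv> monoid_algebra R G"
abbreviation supp where "supp f \<equiv> {g. f g \<noteq> \<zero>\<^bsub>R\<^esub>}"

lemma MA_sel:
  "mult MA = (\<lambda>f f' z. \<Oplus>\<^bsub>R\<^esub>w \<in> {(x, y). f x \<noteq> \<zero>\<^bsub>R\<^esub> \<and> f' y \<noteq> \<zero>\<^bsub>R\<^esub> \<and> x \<otimes>\<^bsub>G\<^esub> y = z}.
               f (fst w) \<otimes>\<^bsub>R\<^esub> f' (snd w))"
  "one MA = single R \<one>\<^bsub>G\<^esub>"
  "zero MA = (\<lambda>g. \<zero>\<^bsub>R\<^esub>)"
  "add MA = (\<lambda>f f' g. f g \<oplus>\<^bsub>R\<^esub> f' g)"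
  "smult MA = (\<lambda>r f g. r \<otimes>\<^bsub>R\<^esub> f g)"
  by (simp_all add: monoid_algebra_def single_def)

lemma MA_carrier:
  "f \<in> carrier MA \<longleftrightarrow> (\<forall>g. f g \<in> carrier R) \<and> finite (supp f) \<and> supp f \<subseteq> carrier G"
  by (auto simp: monoid_algebra_def)

lemma MA_val [simp]: "f \<in> carrier MA \<Longrightarrow> f g \<in> carrier R"
  by (simp add: MA_carrier)

lemma MA_supp_finite: "f \<in> carrier MA \<Longrightarrow> finite (supp f)"
  by (simp add: MA_carrier)

lemma MA_supp_sub: "f \<in> carrier MA \<Longrightarrow> supp f \<subseteq> carrier G"
  by (simp add: MA_carrier)

lemma single_closed [simp]: "g \<in> carrier G \<Longrightarrow> single R g \<in> carrier MA"
  by (auto simp: MA_carrier single_def intro: finite_subset[of _ "{g}"])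

lemma MA_zero_closed: "\<zero>\<^bsub>MA\<^esub> \<in> carrier MA"
  by (simp add: MA_carrier MA_sel)

lemma MA_add_closed:
  assumes "f \<in> carrier MA" "f' \<in> carrier MA"
  shows "f \<oplus>\<^bsub>MA\<^esub> f' \<in> carrier MA"
proof -
  have sub: "supp (f \<oplus>\<^bsub>MA\<^esub> f') \<subseteq> supp f \<union> supp f'" by (auto simp: MA_sel)
  have "finite (supp f \<union> supp f')" "supp f \<union> supp f' \<subseteq> carrier G"
    using assms[unfolded MA_carrier] by auto
  then have "finite (supp (f \<oplus>\<^bsub>MA\<^esub> f'))" "supp (f \<oplus>\<^bsub>MA\<^esub> f') \<subseteq> carrier G"
    using sub by (auto intro: finite_subset)
  moreover have "(f \<oplus>\<^bsub>MA\<^esub> f') g \<in> carrier R" for g using assms by (simp add: MA_sel)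
  ultimately show ?thesis by (simp add: MA_carrier)
qed

lemma MA_smult_closed: "r \<in> carrier R \<Longrightarrow> f \<in> carrier MA \<Longrightarrow> r \<odot>\<^bsub>MA\<^esub> f \<in> carrier MA"
  by (auto simp: MA_carrier MA_sel intro: finite_subset[of _ "supp f"])

lemma MA_abelian_group: "abelian_group MA"
proof (rule abelian_groupI)
  fix f assume f: "f \<in> carrier MA"
  show "\<exists>f'\<in>carrier MA. f' \<oplus>\<^bsub>MA\<^esub> f = \<zero>\<^bsub>MA\<^esub>"
    using f by (intro bexI[of _ "(\<ominus>\<^bsub>R\<^esub> \<one>\<^bsub>R\<^esub>) \<odot>\<^bsub>MA\<^esub> f"] MA_smult_closed)
      (simp_all add: MA_sel R.l_minus R.l_neg)
next
  fix f f' k assume "f \<in> carrier MA" "f' \<in> carrier MA" "k \<in> carrier MA"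
  then show "f \<oplus>\<^bsub>MA\<^esub> f' \<oplus>\<^bsub>MA\<^esub> k = f \<oplus>\<^bsub>MA\<^esub> (f' \<oplus>\<^bsub>MA\<^esub> k)"
    unfolding MA_sel by (intro ext R.a_assoc MA_val)
next
  fix f f' assume "f \<in> carrier MA" "f' \<in> carrier MA"
  then show "f \<oplus>\<^bsub>MA\<^esub> f' = f' \<oplus>\<^bsub>MA\<^esub> f"
    unfolding MA_sel by (intro ext R.a_comm MA_val)
qed (simp_all add: MA_add_closed MA_zero_closed, simp_all add: MA_sel)

lemma MA_module: "Module.module R MA"
  by (rule Module.moduleI[OF R.is_cring MA_abelian_group])
    (simp_all add: MA_smult_closed, simp_all add: MA_sel R.l_distr R.r_distr R.m_assoc)

sublocale MA: Module.module R MA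
  by (rule MA_module)

text \<open>Induction on the size of the support, detaching one basis element at a time. Identities
  that are linear in an element are reduced to basis elements in this way.\<close>

lemma MA_induct [consumes 1, case_names zero add single]:
  assumes f: "f \<in> carrier MA"
    and zero: "P \<zero>\<^bsub>MA\<^esub>"
    and add: "\<And>f f'. f \<in> carrier MA \<Longrightarrow> f' \<in> carrier MA \<Longrightarrow> P f \<Longrightarrow> P f' \<Longrightarrow> P (f \<oplus>\<^bsub>MA\<^esub> f')"
    and single: "\<And>r g. r \<in> carrier R \<Longrightarrow> g \<in> carrier G \<Longrightarrow> P (r \<odot>\<^bsub>MA\<^esub> single R g)"
  shows "P f"
proof -
  have "finite (supp f)" using f by (rule MA_supp_finite)
  then show ?thesis using f
  proof (induction "supp f" arbitrary: f rule: finite_induct)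
    case empty
    then have "f = \<zero>\<^bsub>MA\<^esub>" by (auto simp: MA_sel)
    then show ?case using zero by simp
  next
    case (insert g S)
    define f' where "f' = f(g := \<zero>\<^bsub>R\<^esub>)"
    have S: "S = supp f'" using insert(2,4) by (auto simp: f'_def)
    have f': "f' \<in> carrier MA" using insert(5)
      by (auto simp: MA_carrier f'_def intro: finite_subset[of _ "supp f"])
    have g: "g \<in> carrier G" using insert(4,5) MA_supp_sub by blast
    have "f = f g \<odot>\<^bsub>MA\<^esub> single R g \<oplus>\<^bsub>MA\<^esub> f'"
      using insert(5) by (auto simp: MA_sel single_def f'_def)
    moreover have "P (f g \<odot>\<^bsub>MA\<^esub> single R g)" "f g \<odot>\<^bsub>MA\<^esub> single R g \<in> carrier MA"
      using single insert(5) g by simp_all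
    ultimately show ?case using add f' insert(3)[OF S f'] by metis
  qed
qed

text \<open>The product is defined by a sum whose index set depends on both factors and on
  \<open>z\<close>. Over a fixed rectangle that contains the supports, the summands of different
  products can be compared one by one, as distributivity and homogeneity require.\<close>

lemma MA_mult_over:
  assumes "f \<in> carrier MA" "f' \<in> carrier MA" "finite S" "supp f \<subseteq> S" "finite S'" "supp f' \<subseteq> S'"
  shows "(f \<otimes>\<^bsub>MA\<^esub> f') z =
    (\<Oplus>\<^bsub>R\<^esub>w \<in> S \<times> S'. if fst w \<otimes>\<^bsub>G\<^esub> snd w = z then f (fst w) \<otimes>\<^bsub>R\<^esub> f' (snd w) else \<zero>\<^bsub>R\<^esub>)"
proof -
  let ?A = "{(x, y). f x \<noteq> \<zero>\<^bsub>R\<^esub> \<and> f' y \<noteq> \<zero>\<^bsub>R\<^esub> \<and> x \<otimes>\<^bsub>G\<^esub> y = z}"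
  have "(f \<otimes>\<^bsub>MA\<^esub> f') z = (\<Oplus>\<^bsub>R\<^esub>w \<in> ?A. if fst w \<otimes>\<^bsub>G\<^esub> snd w = z then f (fst w) \<otimes>\<^bsub>R\<^esub> f' (snd w) else \<zero>\<^bsub>R\<^esub>)"
    unfolding MA_sel using assms by (intro R.finsum_cong') auto
  also have "\<dots> = (\<Oplus>\<^bsub>R\<^esub>w \<in> S \<times> S'. if fst w \<otimes>\<^bsub>G\<^esub> snd w = z then f (fst w) \<otimes>\<^bsub>R\<^esub> f' (snd w) else \<zero>\<^bsub>R\<^esub>)"
    using assms by (intro R.add.finprod_mono_neutral_cong_left) auto
  finally show ?thesis .
qed

lemma MA_mult_closed:
  assumes "f \<in> carrier MA" "f' \<in> carrier MA"
  shows "f \<otimes>\<^bsub>MA\<^esub> f' \<in> carrier MA"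
proof -
  let ?A = "\<lambda>z. {(x, y). f x \<noteq> \<zero>\<^bsub>R\<^esub> \<and> f' y \<noteq> \<zero>\<^bsub>R\<^esub> \<and> x \<otimes>\<^bsub>G\<^esub> y = z}"
  have 1: "(f \<otimes>\<^bsub>MA\<^esub> f') z \<in> carrier R" for z
    unfolding MA_sel using assms by (intro R.finsum_closed) auto
  have 2: "supp (f \<otimes>\<^bsub>MA\<^esub> f') \<subseteq> (\<lambda>(x, y). x \<otimes>\<^bsub>G\<^esub> y) ` (supp f \<times> supp f')" (is "_ \<subseteq> ?B")
  proof
    fix z assume z: "z \<in> supp (f \<otimes>\<^bsub>MA\<^esub> f')"
    then have "?A z \<noteq> {}" unfolding MA_sel by (auto simp del: Collect_empty_eq)
    then show "z \<in> ?B" by (auto simp: image_iff)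
  qed
  have 3: "finite ?B" using assms MA_supp_finite by blast
  have 4: "?B \<subseteq> carrier G" using MA_supp_sub[OF assms(1)] MA_supp_sub[OF assms(2)] by auto
  show ?thesis unfolding MA_carrier using 1 2 3 4 finite_subset by blast
qed

lemma MA_mult_distr:
  assumes "f \<in> carrier MA" "f' \<in> carrier MA" "k \<in> carrier MA" 
  shows "(f \<oplus>\<^bsub>MA\<^esub> f') \<otimes>\<^bsub>MA\<^esub> k = f \<otimes>\<^bsub>MA\<^esub> k \<oplus>\<^bsub>MA\<^esub> f' \<otimes>\<^bsub>MA\<^esub> k" (is ?l)
    and "k \<otimes>\<^bsub>MA\<^esub> (f \<oplus>\<^bsub>MA\<^esub> f') = k \<otimes>\<^bsub>MA\<^esub> f \<oplus>\<^bsub>MA\<^esub> k \<otimes>\<^bsub>MA\<^esub> f'" (is ?r)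
proof -
  let ?S = "supp f \<union> supp f' \<union> supp k"
  have S: "finite ?S" using assms MA_supp_finite by blast
  have sub: "supp f \<subseteq> ?S" "supp f' \<subseteq> ?S" "supp k \<subseteq> ?S" "supp (f \<oplus>\<^bsub>MA\<^esub> f') \<subseteq> ?S"
    using assms by (auto simp: MA_sel)
  have a: "f \<oplus>\<^bsub>MA\<^esub> f' \<in> carrier MA" using assms by simp
  note o = MA_mult_over[OF _ _ S _ S]
  show ?l
  proof
    fix z
    let ?A = "\<lambda>f w. if fst w \<otimes>\<^bsub>G\<^esub> snd w = z then f (fst w) \<otimes>\<^bsub>R\<^esub> k (snd w) else \<zero>\<^bsub>R\<^esub>"
    have "((f \<oplus>\<^bsub>MA\<^esub> f') \<otimes>\<^bsub>MA\<^esub> k) z = (\<Oplus>\<^bsub>R\<^esub>w \<in> ?S \<times> ?S. ?A f w \<oplus>\<^bsub>R\<^esub> ?A f' w)"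
      unfolding o[OF a assms(3) sub(4,3)] using assms
      by (intro R.finsum_cong') (simp_all add: MA_sel(4) R.l_distr)
    also have "\<dots> = (f \<otimes>\<^bsub>MA\<^esub> k) z \<oplus>\<^bsub>R\<^esub> (f' \<otimes>\<^bsub>MA\<^esub> k) z"
      unfolding o[OF assms(1,3) sub(1,3)] o[OF assms(2,3) sub(2,3)] using assms
      by (intro R.finsum_addf) auto
    finally have "((f \<oplus>\<^bsub>MA\<^esub> f') \<otimes>\<^bsub>MA\<^esub> k) z = (f \<otimes>\<^bsub>MA\<^esub> k) z \<oplus>\<^bsub>R\<^esub> (f' \<otimes>\<^bsub>MA\<^esub> k) z" .
    then show "((f \<oplus>\<^bsub>MA\<^esub> f') \<otimes>\<^bsub>MA\<^esub> k) z = (f \<otimes>\<^bsub>MA\<^esub> k \<oplus>\<^bsub>MA\<^esub> f' \<otimes>\<^bsub>MA\<^esub> k) z"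
      by (simp add: MA_sel(4))
  qed
  show ?r
  proof
    fix z
    let ?A = "\<lambda>f w. if fst w \<otimes>\<^bsub>G\<^esub> snd w = z then k (fst w) \<otimes>\<^bsub>R\<^esub> f (snd w) else \<zero>\<^bsub>R\<^esub>"
    have "(k \<otimes>\<^bsub>MA\<^esub> (f \<oplus>\<^bsub>MA\<^esub> f')) z = (\<Oplus>\<^bsub>R\<^esub>w \<in> ?S \<times> ?S. ?A f w \<oplus>\<^bsub>R\<^esub> ?A f' w)"
      unfolding o[OF assms(3) a sub(3,4)] using assms
      by (intro R.finsum_cong') (simp_all add: MA_sel(4) R.r_distr)
    also have "\<dots> = (k \<otimes>\<^bsub>MA\<^esub> f) z \<oplus>\<^bsub>R\<^esub> (k \<otimes>\<^bsub>MA\<^esub> f') z"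
      unfolding o[OF assms(3,1) sub(3,1)] o[OF assms(3,2) sub(3,2)] using assms
      by (intro R.finsum_addf) auto
    finally have "(k \<otimes>\<^bsub>MA\<^esub> (f \<oplus>\<^bsub>MA\<^esub> f')) z = (k \<otimes>\<^bsub>MA\<^esub> f) z \<oplus>\<^bsub>R\<^esub> (k \<otimes>\<^bsub>MA\<^esub> f') z" .
    then show "(k \<otimes>\<^bsub>MA\<^esub> (f \<oplus>\<^bsub>MA\<^esub> f')) z = (k \<otimes>\<^bsub>MA\<^esub> f \<oplus>\<^bsub>MA\<^esub> k \<otimes>\<^bsub>MA\<^esub> f') z"
      by (simp add: MA_sel(4))
  qed
qed

lemma MA_mult_smult:
  assumes "r \<in> carrier R" "f \<in> carrier MA" "k \<in> carrier MA" 
  shows "(r \<odot>\<^bsub>MA\<^esub> f) \<otimes>\<^bsub>MA\<^esub> k = r \<odot>\<^bsub>MA\<^esub> (f \<otimes>\<^bsub>MA\<^esub> k)" (is ?l)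
    and "k \<otimes>\<^bsub>MA\<^esub> (r \<odot>\<^bsub>MA\<^esub> f) = r \<odot>\<^bsub>MA\<^esub> (k \<otimes>\<^bsub>MA\<^esub> f)" (is ?r)
proof -
  let ?S = "supp f \<union> supp k"
  have S: "finite ?S" using assms MA_supp_finite by blast
  have sub: "supp f \<subseteq> ?S" "supp k \<subseteq> ?S" "supp (r \<odot>\<^bsub>MA\<^esub> f) \<subseteq> ?S"
    using assms by (auto simp: MA_sel)
  have a: "r \<odot>\<^bsub>MA\<^esub> f \<in> carrier MA" using assms by simp
  have fin: "finite (?S \<times> ?S)" using S by blast
  note o = MA_mult_over[OF _ _ S _ S]
  show ?l
  proof
    fix z
    have "((r \<odot>\<^bsub>MA\<^esub> f) \<otimes>\<^bsub>MA\<^esub> k) z = r \<otimes>\<^bsub>R\<^esub> (f \<otimes>\<^bsub>MA\<^esub> k) z"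
      unfolding o[OF a assms(3) sub(3,2)] o[OF assms(2,3) sub(1,2)]
      using assms by (subst R.finsum_rdistr[OF fin])
        (auto intro!: R.finsum_cong' simp: MA_sel(5) R.m_assoc)
    then show "((r \<odot>\<^bsub>MA\<^esub> f) \<otimes>\<^bsub>MA\<^esub> k) z = (r \<odot>\<^bsub>MA\<^esub> (f \<otimes>\<^bsub>MA\<^esub> k)) z"
      by (simp add: MA_sel(5))
  qed
  show ?r
  proof
    fix z
    have "(k \<otimes>\<^bsub>MA\<^esub> (r \<odot>\<^bsub>MA\<^esub> f)) z = r \<otimes>\<^bsub>R\<^esub> (k \<otimes>\<^bsub>MA\<^esub> f) z"
      unfolding o[OF assms(3) a sub(2,3)] o[OF assms(3,2) sub(2,1)]
      using assms by (subst R.finsum_rdistr[OF fin])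
        (auto intro!: R.finsum_cong' simp: MA_sel(5) R.m_lcomm)
    then show "(k \<otimes>\<^bsub>MA\<^esub> (r \<odot>\<^bsub>MA\<^esub> f)) z = (r \<odot>\<^bsub>MA\<^esub> (k \<otimes>\<^bsub>MA\<^esub> f)) z"
      by (simp add: MA_sel(5))
  qed
qed

lemma single_mult:
  assumes "x \<in> carrier G" "y \<in> carrier G"
  shows "single R x \<otimes>\<^bsub>MA\<^esub> single R y = single R (x \<otimes>\<^bsub>G\<^esub> y)"
proof
  fix z
  have s: "supp (single R x) \<subseteq> {x}" "supp (single R y) \<subseteq> {y}" by (auto simp: single_def)
  have p: "{x} \<times> {y} = {(x, y)}" by auto
  have "(single R x \<otimes>\<^bsub>MA\<^esub> single R y) z =
    (\<Oplus>\<^bsub>R\<^esub>w \<in> {(x, y)}. if x \<otimes>\<^bsub>G\<^esub> y = z then \<one>\<^bsub>R\<^esub> else \<zero>\<^bsub>R\<^esub>)"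
    unfolding MA_mult_over[OF single_closed[OF assms(1)] single_closed[OF assms(2)] _ s(1) _ s(2), simplified] p
    by (rule R.finsum_cong') (auto simp: single_def)
  also have "\<dots> = single R (x \<otimes>\<^bsub>G\<^esub> y) z"
    by (auto simp: single_def)
  finally show "(single R x \<otimes>\<^bsub>MA\<^esub> single R y) z = single R (x \<otimes>\<^bsub>G\<^esub> y) z" .
qed

lemma MA_null:
  assumes "f \<in> carrier MA"
  shows "\<zero>\<^bsub>MA\<^esub> \<otimes>\<^bsub>MA\<^esub> f = \<zero>\<^bsub>MA\<^esub>" "f \<otimes>\<^bsub>MA\<^esub> \<zero>\<^bsub>MA\<^esub> = \<zero>\<^bsub>MA\<^esub>"
  using MA_mult_smult[of "\<zero>\<^bsub>R\<^esub>" "\<zero>\<^bsub>MA\<^esub>" f] assms by (simp_all add: MA_mult_closed)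

lemma MA_assoc:
  assumes "f \<in> carrier MA" "f' \<in> carrier MA" "k \<in> carrier MA"
  shows "f \<otimes>\<^bsub>MA\<^esub> f' \<otimes>\<^bsub>MA\<^esub> k = f \<otimes>\<^bsub>MA\<^esub> (f' \<otimes>\<^bsub>MA\<^esub> k)"
proof -
  note D = MA_mult_closed MA_mult_distr MA_mult_smult MA_null
  have 1: "single R x \<otimes>\<^bsub>MA\<^esub> single R y \<otimes>\<^bsub>MA\<^esub> k = single R x \<otimes>\<^bsub>MA\<^esub> (single R y \<otimes>\<^bsub>MA\<^esub> k)"
    if "x \<in> carrier G" "y \<in> carrier G" for x y
    using assms(3)
  proof (induction rule: MA_induct)
    case (single r g)
    then show ?case using that by (simp add: D single_mult G.m_assoc)
  qed (use that in \<open>simp_all add: D\<close>)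
  have 2: "single R x \<otimes>\<^bsub>MA\<^esub> f' \<otimes>\<^bsub>MA\<^esub> k = single R x \<otimes>\<^bsub>MA\<^esub> (f' \<otimes>\<^bsub>MA\<^esub> k)"
    if "x \<in> carrier G" for x
    using assms(2)
  proof (induction rule: MA_induct)
    case (single r g)
    then show ?case using that assms(3) by (simp add: D 1)
  qed (use that assms(3) in \<open>simp_all add: D\<close>)
  show ?thesis
    using assms(1)
  proof (induction rule: MA_induct)
    case (single r g)
    then show ?case using assms by (simp add: D 2)
  qed (use assms in \<open>simp_all add: D\<close>)
qed

lemma MA_one:
  assumes "f \<in> carrier MA"
  shows "\<one>\<^bsub>MA\<^esub> \<otimes>\<^bsub>MA\<^esub> f = f" "f \<otimes>\<^bsub>MA\<^esub> \<one>\<^bsub>MA\<^esub> = f"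
proof -
  note D = MA_mult_closed MA_mult_distr MA_mult_smult MA_null MA_sel(2) single_mult
  show "\<one>\<^bsub>MA\<^esub> \<otimes>\<^bsub>MA\<^esub> f = f" "f \<otimes>\<^bsub>MA\<^esub> \<one>\<^bsub>MA\<^esub> = f" using assms 
    by (induction rule: MA_induct) (simp_all add: D)
qed

lemma MA_ring: "Ring.ring MA"
  by (rule Ring.ringI[OF MA_abelian_group])
    (auto intro!: Group.monoidI simp: MA_mult_closed MA_mult_distr MA_assoc MA_one, simp add: MA_sel(2))

lemma MA_assoc_algebra: "assoc_algebra R MA"
  by (intro assoc_algebra.intro MA_module MA_ring assoc_algebra_axioms.intro) (simp_all add: MA_mult_smult)

sublocale MA: assoc_algebra R MA
  by (rule MA_assoc_algebra)

end

section \<open>Linear extension of a map from the basis of a monoid algebra\<close>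

locale lin_extension = monoid_alg R G + M: Module.module R M
  for R (structure) and G (structure) and M +
  fixes \<phi>
  assumes \<phi>_closed [simp]: "g \<in> carrier G \<Longrightarrow> \<phi> g \<in> carrier M"
begin

abbreviation lx where "lx \<equiv> lin_ext R M \<phi>"

lemma lx_over:
  assumes "f \<in> carrier MA" "finite S" "supp f \<subseteq> S" "S \<subseteq> carrier G"
  shows "lx f = (\<Oplus>\<^bsub>M\<^esub>g \<in> S. f g \<odot>\<^bsub>M\<^esub> \<phi> g)"
  unfolding lin_ext_def using assms
  by (intro M.add.finprod_mono_neutral_cong_left) auto

lemma lx_closed [simp]: "f \<in> carrier MA \<Longrightarrow> lx f \<in> carrier M"
  unfolding lin_ext_def by (intro M.finsum_closed) (use MA_supp_sub[of f] in \<open>auto simp: subset_iff\<close>)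

lemma lx_add [simp]:
  assumes "f \<in> carrier MA" "f' \<in> carrier MA"
  shows "lx (f \<oplus>\<^bsub>MA\<^esub> f') = lx f \<oplus>\<^bsub>M\<^esub> lx f'"
proof -
  let ?S = "supp f \<union> supp f'"
  have S: "finite ?S" "?S \<subseteq> carrier G" using assms MA_supp_finite MA_supp_sub by blast+
  have v: "f g \<odot>\<^bsub>M\<^esub> \<phi> g \<in> carrier M" "f' g \<odot>\<^bsub>M\<^esub> \<phi> g \<in> carrier M" if "g \<in> ?S" for g
    using that S assms by auto
  have sub: "supp f \<subseteq> ?S" "supp f' \<subseteq> ?S" "supp (f \<oplus>\<^bsub>MA\<^esub> f') \<subseteq> ?S" by (auto simp: MA_sel(4))
  have "lx (f \<oplus>\<^bsub>MA\<^esub> f') = (\<Oplus>\<^bsub>M\<^esub>g \<in> ?S. f g \<odot>\<^bsub>M\<^esub> \<phi> g \<oplus>\<^bsub>M\<^esub> f' g \<odot>\<^bsub>M\<^esub> \<phi> g)"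
    unfolding lx_over[OF MA.add.m_closed[OF assms] S(1) sub(3) S(2)] using v S(2) assms
    by (intro M.finsum_cong') (simp_all add: MA_sel(4) M.smult_l_distr subset_iff)
  also have "\<dots> = lx f \<oplus>\<^bsub>M\<^esub> lx f'"
    unfolding lx_over[OF assms(1) S(1) sub(1) S(2)] lx_over[OF assms(2) S(1) sub(2) S(2)] using v
    by (intro M.finsum_addf) auto
  finally show ?thesis .
qed

lemma lx_smult [simp]:
  assumes "r \<in> carrier R" "f \<in> carrier MA"
  shows "lx (r \<odot>\<^bsub>MA\<^esub> f) = r \<odot>\<^bsub>M\<^esub> lx f"
proof -
  have S: "finite (supp f)" "supp f \<subseteq> carrier G" using assms MA_supp_finite MA_supp_sub by blast+
  have v: "f g \<odot>\<^bsub>M\<^esub> \<phi> g \<in> carrier M" if "g \<in> supp f" for g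
    using that S assms by auto
  have sub: "supp (r \<odot>\<^bsub>MA\<^esub> f) \<subseteq> supp f" using assms by (auto simp: MA_sel(5))
  have "lx (r \<odot>\<^bsub>MA\<^esub> f) = (\<Oplus>\<^bsub>M\<^esub>g \<in> supp f. r \<odot>\<^bsub>M\<^esub> (f g \<odot>\<^bsub>M\<^esub> \<phi> g))"
    unfolding lx_over[OF MA.smult_closed[OF assms] S(1) sub S(2)] using v S(2) assms
    by (intro M.finsum_cong') (simp_all add: MA_sel(5) M.smult_assoc1 subset_iff)
  also have "\<dots> = r \<odot>\<^bsub>M\<^esub> lx f"
    using S assms v by (subst M.finsum_smult_ldistr[symmetric]) (auto simp: lin_ext_def)
  finally show ?thesis .
qed

lemma lx_single [simp]:
  assumes "g \<in> carrier G"
  shows "lx (single R g) = \<phi> g"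
proof -
  have s: "supp (single R g) \<subseteq> {g}" by (auto simp: single_def)
  show ?thesis unfolding lx_over[OF single_closed[OF assms] _ s, simplified, OF assms]
    using assms by (simp add: single_def)
qed

lemma lx_zero [simp]: "lx \<zero>\<^bsub>MA\<^esub> = \<zero>\<^bsub>M\<^esub>"
  using lx_smult[of "\<zero>\<^bsub>R\<^esub>" "\<zero>\<^bsub>MA\<^esub>"] by simp

lemma lx_minus [simp]: "f \<in> carrier MA \<Longrightarrow> lx (\<ominus>\<^bsub>MA\<^esub> f) = \<ominus>\<^bsub>M\<^esub> lx f"
  by (metis M.minus_equality MA.add.inv_closed lx_add lx_closed lx_zero MA.l_neg)

lemma lx_diff [simp]: "f \<in> carrier MA \<Longrightarrow> f' \<in> carrier MA \<Longrightarrow> lx (f \<ominus>\<^bsub>MA\<^esub> f') = lx f \<ominus>\<^bsub>M\<^esub> lx f'"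
  by (simp add: a_minus_def)

end

section \<open>Quotients and presentations\<close>

definition alg_hom ::
  "('r, 'x) ring_scheme \<Rightarrow> ('r, 'a, 'm) module_scheme \<Rightarrow> ('r, 'b, 'n) module_scheme \<Rightarrow> ('a \<Rightarrow> 'b) set" where
  "alg_hom R A B = {f \<in> ring_hom A B. \<forall>r \<in> carrier R. \<forall>x \<in> carrier A. f (r \<odot>\<^bsub>A\<^esub> x) = r \<odot>\<^bsub>B\<^esub> f x}"

lemma alg_homI:
  assumes "\<And>x. x \<in> carrier A \<Longrightarrow> f x \<in> carrier B"
    and "\<And>x y. x \<in> carrier A \<Longrightarrow> y \<in> carrier A \<Longrightarrow> f (x \<otimes>\<^bsub>A\<^esub> y) = f x \<otimes>\<^bsub>B\<^esub> f y"
    and "\<And>x y. x \<in> carrier A \<Longrightarrow> y \<in> carrier A \<Longrightarrow> f (x \<oplus>\<^bsub>A\<^esub> y) = f x \<oplus>\<^bsub>B\<^esub> f y"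
    and "f \<one>\<^bsub>A\<^esub> = \<one>\<^bsub>B\<^esub>"
    and "\<And>r x. r \<in> carrier R \<Longrightarrow> x \<in> carrier A \<Longrightarrow> f (r \<odot>\<^bsub>A\<^esub> x) = r \<odot>\<^bsub>B\<^esub> f x"
  shows "f \<in> alg_hom R A B"
  using assms by (auto simp: alg_hom_def ring_hom_def)

lemma alg_homD:
  assumes "f \<in> alg_hom R A B"
  shows "\<And>x. x \<in> carrier A \<Longrightarrow> f x \<in> carrier B"
    and "\<And>x y. x \<in> carrier A \<Longrightarrow> y \<in> carrier A \<Longrightarrow> f (x \<otimes>\<^bsub>A\<^esub> y) = f x \<otimes>\<^bsub>B\<^esub> f y"
    and "\<And>x y. x \<in> carrier A \<Longrightarrow> y \<in> carrier A \<Longrightarrow> f (x \<oplus>\<^bsub>A\<^esub> y) = f x \<oplus>\<^bsub>B\<^esub> f y"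
    and "f \<one>\<^bsub>A\<^esub> = \<one>\<^bsub>B\<^esub>"
    and "\<And>r x. r \<in> carrier R \<Longrightarrow> x \<in> carrier A \<Longrightarrow> f (r \<odot>\<^bsub>A\<^esub> x) = r \<odot>\<^bsub>B\<^esub> f x"
  using assms by (auto simp: alg_hom_def ring_hom_def)

locale quotient_algebra = assoc_algebra R A + I: ideal I A
  for R (structure) and A (structure) and I
begin

abbreviation cls where "cls x \<equiv> I +>\<^bsub>A\<^esub> x"
abbreviation Q where "Q \<equiv> alg_quot A I"

lemma Q_carrier: "carrier Q = cls ` carrier A"
  by (auto simp: alg_quot_def FactRing_def A_RCOSETS_def' )

lemma cls_closed [simp]: "x \<in> carrier A \<Longrightarrow> cls x \<in> carrier Q"
  by (simp add: Q_carrier)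

lemma cls_mult [simp]: "x \<in> carrier A \<Longrightarrow> y \<in> carrier A \<Longrightarrow> cls x \<otimes>\<^bsub>Q\<^esub> cls y = cls (x \<otimes>\<^bsub>A\<^esub> y)"
  by (simp add: alg_quot_def FactRing_def I.rcoset_mult_add)

lemma cls_add [simp]: "x \<in> carrier A \<Longrightarrow> y \<in> carrier A \<Longrightarrow> cls x \<oplus>\<^bsub>Q\<^esub> cls y = cls (x \<oplus>\<^bsub>A\<^esub> y)"
  by (simp add: alg_quot_def FactRing_def I.a_rcos_sum)

lemma cls_one: "cls \<one>\<^bsub>A\<^esub> = \<one>\<^bsub>Q\<^esub>"
  by (simp add: alg_quot_def FactRing_def)

text \<open>A scalar acts as left multiplication by its multiple of the unit, so a ring ideal is
  also a submodule.\<close>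

lemma I_smult: "r \<in> carrier R \<Longrightarrow> x \<in> I \<Longrightarrow> r \<odot>\<^bsub>A\<^esub> x \<in> I"
  using I.I_l_closed[of x "r \<odot>\<^bsub>A\<^esub> \<one>\<^bsub>A\<^esub>"] I.Icarr[of x] by (simp add: smult_mult_left)

lemma cls_eq_iff:
  assumes "x \<in> carrier A" "y \<in> carrier A"
  shows "cls x = cls y \<longleftrightarrow> x \<ominus>\<^bsub>A\<^esub> y \<in> I"
  using quotient_eq_iff_same_a_r_cos[OF I.ideal_axioms assms] by (rule sym)

lemma mem_cls:
  assumes "x \<in> carrier A" "y \<in> cls x"
  shows "y \<in> carrier A" "cls y = cls x"
proof -
  show "y \<in> carrier A"
    using assms a_r_coset_subset_G[OF I.a_subset assms(1)] by blast
  show "cls y = cls x"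
    using a_repr_independence[OF assms(2,1) I.a_subgroup] by simp
qed

lemma cls_self: "x \<in> carrier A \<Longrightarrow> x \<in> cls x"
  by (rule I.a_rcos_self)

text \<open>\<open>alg_quot\<close> defines the scalar action as a union over all representatives.
  The cosets in this union coincide because the ideal is closed under scalars.\<close>

lemma cls_smult [simp]:
  assumes "r \<in> carrier R" "x \<in> carrier A"
  shows "r \<odot>\<^bsub>Q\<^esub> cls x = cls (r \<odot>\<^bsub>A\<^esub> x)"
proof -
  have "cls (r \<odot>\<^bsub>A\<^esub> y) = cls (r \<odot>\<^bsub>A\<^esub> x)" if y: "y \<in> cls x" for y
  proof -
    have "y \<in> carrier A" "y \<ominus>\<^bsub>A\<^esub> x \<in> I"
      using mem_cls[OF assms(2) y] assms(2) by (simp_all add: cls_eq_iff)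
    then show ?thesis using I_smult[OF assms(1), of "y \<ominus>\<^bsub>A\<^esub> x"] assms
      by (simp add: cls_eq_iff a_minus_def smult_r_distr smult_r_minus)
  qed
  then have "(\<Union>y\<in>cls x. cls (r \<odot>\<^bsub>A\<^esub> y)) = cls (r \<odot>\<^bsub>A\<^esub> x)"
    using cls_self[OF assms(2)] by (intro SUP_eq_const) blast+
  then show ?thesis by (simp only: alg_quot_def module.simps)
qed

lemma Q_cases [consumes 1]:
  assumes "X \<in> carrier Q"
  obtains x where "x \<in> carrier A" "X = cls x"
  using assms by (auto simp: Q_carrier)

lemma Q_sel:
  "carrier Q = carrier (A Quot I)" "mult Q = mult (A Quot I)" "one Q = one (A Quot I)"
  "zero Q = zero (A Quot I)" "add Q = add (A Quot I)"
  by (simp_all add: alg_quot_def)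

lemma Q_ring: "Ring.ring Q"
proof -
  interpret F: Ring.ring "A Quot I" by (rule I.quotient_is_ring)
  have "abelian_group Q"
  proof (rule abelian_groupI)
    fix X assume "X \<in> carrier Q"
    then show "\<exists>Y\<in>carrier Q. Y \<oplus>\<^bsub>Q\<^esub> X = \<zero>\<^bsub>Q\<^esub>"
      unfolding Q_sel by (intro bexI[of _ "\<ominus>\<^bsub>A Quot I\<^esub> X"]) (simp_all add: F.l_neg)
  qed (unfold Q_sel, simp_all add: F.a_ac)
  moreover have "Group.monoid Q"
    by (rule monoidI) (unfold Q_sel, simp_all add: F.m_assoc)
  ultimately show ?thesis
    by (rule ringI) (unfold Q_sel, simp_all add: F.l_distr F.r_distr)
qed

lemma Q_assoc_algebra: "assoc_algebra R Q"
proof -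
  interpret Q: Ring.ring Q by (rule Q_ring)
  have c: "r \<odot>\<^bsub>Q\<^esub> X \<in> carrier Q" if "r \<in> carrier R" "X \<in> carrier Q" for r X
    using that(2) by (rule Q_cases) (simp add: that)
  have 1: "(r \<oplus>\<^bsub>R\<^esub> s) \<odot>\<^bsub>Q\<^esub> X = r \<odot>\<^bsub>Q\<^esub> X \<oplus>\<^bsub>Q\<^esub> s \<odot>\<^bsub>Q\<^esub> X" 
    "(r \<otimes>\<^bsub>R\<^esub> s) \<odot>\<^bsub>Q\<^esub> X = r \<odot>\<^bsub>Q\<^esub> (s \<odot>\<^bsub>Q\<^esub> X)" 
    if "r \<in> carrier R" "s \<in> carrier R" "X \<in> carrier Q" for r s X
    using that(3) by (rule Q_cases, simp add: that smult_l_distr smult_assoc1)+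
  have 3: "\<one>\<^bsub>R\<^esub> \<odot>\<^bsub>Q\<^esub> X = X" if "X \<in> carrier Q" for X
    using that by (rule Q_cases) simp
  have 2: "r \<odot>\<^bsub>Q\<^esub> (X \<oplus>\<^bsub>Q\<^esub> Y) = r \<odot>\<^bsub>Q\<^esub> X \<oplus>\<^bsub>Q\<^esub> r \<odot>\<^bsub>Q\<^esub> Y" 
    "(r \<odot>\<^bsub>Q\<^esub> X) \<otimes>\<^bsub>Q\<^esub> Y = r \<odot>\<^bsub>Q\<^esub> (X \<otimes>\<^bsub>Q\<^esub> Y)" "X \<otimes>\<^bsub>Q\<^esub> (r \<odot>\<^bsub>Q\<^esub> Y) = r \<odot>\<^bsub>Q\<^esub> (X \<otimes>\<^bsub>Q\<^esub> Y)" 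
    if r: "r \<in> carrier R" and X: "X \<in> carrier Q" and Y: "Y \<in> carrier Q" for r X Y
  proof -
    obtain x where x: "x \<in> carrier A" "X = cls x" using X by (rule Q_cases)
    obtain y where y: "y \<in> carrier A" "Y = cls y" using Y by (rule Q_cases)
    show "r \<odot>\<^bsub>Q\<^esub> (X \<oplus>\<^bsub>Q\<^esub> Y) = r \<odot>\<^bsub>Q\<^esub> X \<oplus>\<^bsub>Q\<^esub> r \<odot>\<^bsub>Q\<^esub> Y" 
      "(r \<odot>\<^bsub>Q\<^esub> X) \<otimes>\<^bsub>Q\<^esub> Y = r \<odot>\<^bsub>Q\<^esub> (X \<otimes>\<^bsub>Q\<^esub> Y)" "X \<otimes>\<^bsub>Q\<^esub> (r \<odot>\<^bsub>Q\<^esub> Y) = r \<odot>\<^bsub>Q\<^esub> (X \<otimes>\<^bsub>Q\<^esub> Y)"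
      unfolding x y using r x y by (simp_all add: smult_r_distr smult_mult_left smult_mult_right)
  qed
  have "Module.module R Q"
    by (rule Module.moduleI[OF R.is_cring Q.is_abelian_group]) (simp_all add: c 1 2 3)
  then show ?thesis
    by (intro assoc_algebra.intro Q.ring_axioms assoc_algebra_axioms.intro) (simp_all add: 2)
qed

lemma cls_alg_hom: "cls \<in> alg_hom R A Q"
  by (rule alg_homI) (simp_all add: cls_one)

lemma some_rep:
  assumes "X \<in> carrier Q"
  shows "(SOME f. f \<in> X) \<in> carrier A" "cls (SOME f. f \<in> X) = X"
proof -
  obtain x where x: "x \<in> carrier A" "X = cls x" using assms by (rule Q_cases)
  have s: "(SOME f. f \<in> X) \<in> cls x" using someI[of "\<lambda>f. f \<in> X" x] cls_self x by simp
  show "(SOME f. f \<in> X) \<in> carrier A" using mem_cls(1)[OF x(1) s] .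
  show "cls (SOME f. f \<in> X) = X" using mem_cls(2)[OF x(1) s] unfolding x(2) .
qed

text \<open>A map that depends on representatives only through their class may be evaluated at the
  representative chosen by \<open>SOME\<close>.\<close>

lemma some_rep_eval:
  assumes x: "x \<in> carrier A" and M: "abelian_group M"
    and closed: "\<And>f. f \<in> carrier A \<Longrightarrow> L f \<in> carrier M"
    and diff: "\<And>f f'. f \<in> carrier A \<Longrightarrow> f' \<in> carrier A \<Longrightarrow> L (f \<ominus>\<^bsub>A\<^esub> f') = L f \<ominus>\<^bsub>M\<^esub> L f'"
    and kill: "\<And>f. f \<in> I \<Longrightarrow> L f = \<zero>\<^bsub>M\<^esub>"
  shows "L (SOME f. f \<in> cls x) = L x"
proof -
  interpret M: abelian_group M by fact
  let ?y = "SOME f. f \<in> cls x"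
  have y: "?y \<in> carrier A" "cls ?y = cls x" using some_rep[of "cls x"] x by simp_all
  then have "L (?y \<ominus>\<^bsub>A\<^esub> x) = \<zero>\<^bsub>M\<^esub>" using kill x by (simp add: cls_eq_iff)
  then have "L ?y \<ominus>\<^bsub>M\<^esub> L x = \<zero>\<^bsub>M\<^esub>" using diff x y by simp
  then show ?thesis 
    using closed[OF x] closed[OF y(1)] M.add.inv_equality[of "L ?y" "\<ominus>\<^bsub>M\<^esub> L x"] by (simp add: a_minus_def)
qed

end

text \<open>Both \<open>tensor\<close> and \<open>u_sl\<close> are of this form.\<close>

locale presentation = monoid_alg R G for R (structure) and G (structure) +
  fixes rels
  assumes rels_sub: "rels \<subseteq> carrier (monoid_algebra R G)"
begin

abbreviation Id where "Id \<equiv> Idl\<^bsub>MA\<^esub> rels"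

sublocale quotient_algebra R MA Id
  by (intro quotient_algebra.intro MA_assoc_algebra MA.genideal_ideal rels_sub)

abbreviation gen where "gen g \<equiv> cls (single R g)"

lemma gen_closed: "g \<in> carrier G \<Longrightarrow> gen g \<in> carrier Q"
  by simp

lemma gen_mult: "x \<in> carrier G \<Longrightarrow> y \<in> carrier G \<Longrightarrow> gen x \<otimes>\<^bsub>Q\<^esub> gen y = gen (x \<otimes>\<^bsub>G\<^esub> y)"
  by (simp add: single_mult)

lemma gen_one: "gen \<one>\<^bsub>G\<^esub> = \<one>\<^bsub>Q\<^esub>"
  using cls_one by (simp add: MA_sel(2))

lemma rel_cls:
  assumes "f \<in> carrier MA" "f' \<in> carrier MA" "f \<ominus>\<^bsub>MA\<^esub> f' \<in> rels"
  shows "cls f = cls f'"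
  using assms MA.genideal_self[OF rels_sub] by (auto simp: cls_eq_iff)

lemma Q_induct [consumes 1, case_names zero add gen]:
  assumes X: "X \<in> carrier Q"
    and zero: "P \<zero>\<^bsub>Q\<^esub>"
    and add: "\<And>X Y. X \<in> carrier Q \<Longrightarrow> Y \<in> carrier Q \<Longrightarrow> P X \<Longrightarrow> P Y \<Longrightarrow> P (X \<oplus>\<^bsub>Q\<^esub> Y)"
    and gen: "\<And>r g. r \<in> carrier R \<Longrightarrow> g \<in> carrier G \<Longrightarrow> P (r \<odot>\<^bsub>Q\<^esub> gen g)"
  shows "P X"
proof -
  interpret Q: assoc_algebra R Q by (rule Q_assoc_algebra)
  obtain f where f: "f \<in> carrier MA" "X = cls f" using X by (rule Q_cases)
  from f(1) have "P (cls f)"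
  proof (induction rule: MA_induct)
    case zero
    have "cls \<zero>\<^bsub>MA\<^esub> = \<zero>\<^bsub>R\<^esub> \<odot>\<^bsub>Q\<^esub> gen \<one>\<^bsub>G\<^esub>" 
      by (subst cls_smult) simp_all
    then show ?case using gen[of "\<zero>\<^bsub>R\<^esub>" "\<one>\<^bsub>G\<^esub>"] by (metis R.zero_closed G.one_closed)
  next
    case (add f f')
    then show ?case using assms(3)[of "cls f" "cls f'"] by simp
  next
    case (single r g)
    then show ?case using gen[of r g] by simp
  qed
  with f show ?thesis by simp
qed

end

text \<open>The map \<open>\<phi>\<close> need not respect products, so killing the relations would
  not suffice to kill the ideal they generate. The hypothesis therefore concerns the products of a
  relation with basis elements on both sides, which span the ideal. This covers maps that are only
  linear, such as contractions of a tensor product.\<close>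

locale presentation_lift = presentation R G rels + lin_extension R G M \<phi>
  for R (structure) and G (structure) and rels and M and \<phi> +
  assumes kill: "\<And>f x y. f \<in> rels \<Longrightarrow> x \<in> carrier G \<Longrightarrow> y \<in> carrier G \<Longrightarrow>
    lin_ext R M \<phi> (single R x \<otimes>\<^bsub>monoid_algebra R G\<^esub> f \<otimes>\<^bsub>monoid_algebra R G\<^esub> single R y) = \<zero>\<^bsub>M\<^esub>"
begin

lemma lx_mult_null:
  assumes f: "f \<in> carrier MA" and k: "k \<in> carrier MA" "k' \<in> carrier MA"
    and 0: "\<And>x y. x \<in> carrier G \<Longrightarrow> y \<in> carrier G \<Longrightarrow> lx (single R x \<otimes>\<^bsub>MA\<^esub> f \<otimes>\<^bsub>MA\<^esub> single R y) = \<zero>\<^bsub>M\<^esub>"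
  shows "lx (k \<otimes>\<^bsub>MA\<^esub> f \<otimes>\<^bsub>MA\<^esub> k') = \<zero>\<^bsub>M\<^esub>"
proof -
  note D = MA_mult_smult MA.l_distr MA.r_distr
  have 1: "lx (single R x \<otimes>\<^bsub>MA\<^esub> f \<otimes>\<^bsub>MA\<^esub> k') = \<zero>\<^bsub>M\<^esub>" if "x \<in> carrier G" for x
    using k(2)
  proof (induction rule: MA_induct)
    case (single r g)
    then show ?case using f that by (simp add: D 0)
  qed (use that f in \<open>simp_all add: D\<close>)
  show ?thesis using k(1)
  proof (induction rule: MA_induct)
    case (single r g)
    then show ?case using f k(2) by (simp add: D 1)
  qed (use f k(2) in \<open>simp_all add: D\<close>)
qed

text \<open>The elements annihilated after multiplying with basis elements on both sides form an ideal.\<close>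

lemma lx_Id:
  assumes "f \<in> Id"
  shows "lx f = \<zero>\<^bsub>M\<^esub>"
proof -
  define J where "J = {f \<in> carrier MA. \<forall>x \<in> carrier G. \<forall>y \<in> carrier G.
    lx (single R x \<otimes>\<^bsub>MA\<^esub> f \<otimes>\<^bsub>MA\<^esub> single R y) = \<zero>\<^bsub>M\<^esub>}"
  have "ideal J MA"
  proof (rule idealI)
    show "Ring.ring MA" by (rule MA_ring)
    show "subgroup J (add_monoid MA)"
    proof (rule MA.add.subgroupI)
      show "J \<noteq> {}" by (auto simp: J_def intro: exI[of _ "\<zero>\<^bsub>MA\<^esub>"])
    qed (auto simp: J_def a_inv_def[symmetric] MA.l_minus MA.r_minus MA.l_distr MA.r_distr)
  next
    fix f k assume f: "f \<in> J" and k: "k \<in> carrier MA"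
    have f': "f \<in> carrier MA" using f by (simp add: J_def)
    have n: "lx (a \<otimes>\<^bsub>MA\<^esub> f \<otimes>\<^bsub>MA\<^esub> a') = \<zero>\<^bsub>M\<^esub>" if "a \<in> carrier MA" "a' \<in> carrier MA" for a a'
      using lx_mult_null[OF f' that] f by (simp add: J_def)
    have "lx (single R x \<otimes>\<^bsub>MA\<^esub> (k \<otimes>\<^bsub>MA\<^esub> f) \<otimes>\<^bsub>MA\<^esub> single R y) = \<zero>\<^bsub>M\<^esub>"
      "lx (single R x \<otimes>\<^bsub>MA\<^esub> (f \<otimes>\<^bsub>MA\<^esub> k) \<otimes>\<^bsub>MA\<^esub> single R y) = \<zero>\<^bsub>M\<^esub>"
      if "x \<in> carrier G" "y \<in> carrier G" for x y
      using n[of "single R x \<otimes>\<^bsub>MA\<^esub> k" "single R y"] n[of "single R x" "k \<otimes>\<^bsub>MA\<^esub> single R y"] that k f'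
      by (simp_all add: MA.m_assoc)
    then show "k \<otimes>\<^bsub>MA\<^esub> f \<in> J" "f \<otimes>\<^bsub>MA\<^esub> k \<in> J"
      using f' k by (simp_all add: J_def)
  qed
  moreover have "rels \<subseteq> J" using kill rels_sub by (auto simp: J_def)
  ultimately have "f \<in> J" using assms MA.genideal_minimal by blast
  then have "lx (single R \<one>\<^bsub>G\<^esub> \<otimes>\<^bsub>MA\<^esub> f \<otimes>\<^bsub>MA\<^esub> single R \<one>\<^bsub>G\<^esub>) = \<zero>\<^bsub>M\<^esub>" "f \<in> carrier MA"
    by (auto simp: J_def)
  then show ?thesis using MA_one by (simp add: MA_sel(2))
qed

text \<open>The representative is chosen exactly as in \<open>tensor_lift\<close>, so that the two
  agree by unfolding in \<open>lift_eq\<close>.\<close>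

definition qlift where "qlift X = lx (SOME f. f \<in> X)"

lemma qlift_cls [simp]: "f \<in> carrier MA \<Longrightarrow> qlift (cls f) = lx f"
  unfolding qlift_def by (rule some_rep_eval[OF _ M.abelian_group_axioms]) (simp_all add: lx_Id)

lemma qlift_closed [simp]: "X \<in> carrier Q \<Longrightarrow> qlift X \<in> carrier M"
  by (auto elim!: Q_cases)

lemma qlift_add: "X \<in> carrier Q \<Longrightarrow> Y \<in> carrier Q \<Longrightarrow> qlift (X \<oplus>\<^bsub>Q\<^esub> Y) = qlift X \<oplus>\<^bsub>M\<^esub> qlift Y"
  by (auto elim!: Q_cases)

lemma qlift_smult: "r \<in> carrier R \<Longrightarrow> X \<in> carrier Q \<Longrightarrow> qlift (r \<odot>\<^bsub>Q\<^esub> X) = r \<odot>\<^bsub>M\<^esub> qlift X"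
  by (auto elim!: Q_cases)

lemma qlift_gen: "g \<in> carrier G \<Longrightarrow> qlift (gen g) = \<phi> g"
  by simp

end

lemma (in lin_extension) lx_mult:
  assumes M: "assoc_algebra R M"
    and mult: "\<And>x y. x \<in> carrier G \<Longrightarrow> y \<in> carrier G \<Longrightarrow> \<phi> (x \<otimes>\<^bsub>G\<^esub> y) = \<phi> x \<otimes>\<^bsub>M\<^esub> \<phi> y"
    and f: "f \<in> carrier MA" "f' \<in> carrier MA"
  shows "lx (f \<otimes>\<^bsub>MA\<^esub> f') = lx f \<otimes>\<^bsub>M\<^esub> lx f'"
proof -
  interpret N: assoc_algebra R M by fact
  note D = MA_mult_smult MA.l_distr MA.r_distr N.l_distr N.r_distr N.smult_mult_left N.smult_mult_right
  have 1: "lx (single R x \<otimes>\<^bsub>MA\<^esub> f') = \<phi> x \<otimes>\<^bsub>M\<^esub> lx f'" if "x \<in> carrier G" for x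
    using f(2)
  proof (induction rule: MA_induct)
    case (single r g)
    then show ?case using that by (simp add: D single_mult mult)
  qed (use that in \<open>simp_all add: D\<close>)
  show ?thesis using f(1)
  proof (induction rule: MA_induct)
    case (single r g)
    then show ?case using f(2) by (simp add: D 1)
  qed (use f(2) in \<open>simp_all add: D\<close>)
qed

lemma (in presentation_lift) qlift_alg_hom:
  assumes M: "assoc_algebra R M"
    and one: "\<phi> \<one>\<^bsub>G\<^esub> = \<one>\<^bsub>M\<^esub>"
    and mult: "\<And>x y. x \<in> carrier G \<Longrightarrow> y \<in> carrier G \<Longrightarrow> \<phi> (x \<otimes>\<^bsub>G\<^esub> y) = \<phi> x \<otimes>\<^bsub>M\<^esub> \<phi> y"
  shows "qlift \<in> alg_hom R Q M"
proof (rule alg_homI)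
  show "qlift \<one>\<^bsub>Q\<^esub> = \<one>\<^bsub>M\<^esub>" using qlift_gen[of "\<one>\<^bsub>G\<^esub>"] gen_one one by simp
qed (auto elim!: Q_cases simp: qlift_add qlift_smult lx_mult[OF M mult])

section \<open>Tensor products\<close>

definition bilin ::
  "('r, 'x) ring_scheme \<Rightarrow> ('r, 'a, 'l) module_scheme \<Rightarrow> ('r, 'b, 'm) module_scheme \<Rightarrow>
    ('r, 'c, 'n) module_scheme \<Rightarrow> ('a \<Rightarrow> 'b \<Rightarrow> 'c) \<Rightarrow> bool" where
  "bilin R A B M \<beta> \<longleftrightarrow>
    (\<forall>a \<in> carrier A. \<forall>b \<in> carrier B. \<beta> a b \<in> carrier M) \<and>
    (\<forall>a \<in> carrier A. \<forall>a' \<in> carrier A. \<forall>b \<in> carrier B. \<beta> (a \<oplus>\<^bsub>A\<^esub> a') b = \<beta> a b \<oplus>\<^bsub>M\<^esub> \<beta> a' b) \<and>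
    (\<forall>a \<in> carrier A. \<forall>b \<in> carrier B. \<forall>b' \<in> carrier B. \<beta> a (b \<oplus>\<^bsub>B\<^esub> b') = \<beta> a b \<oplus>\<^bsub>M\<^esub> \<beta> a b') \<and>
    (\<forall>r \<in> carrier R. \<forall>a \<in> carrier A. \<forall>b \<in> carrier B. \<beta> (r \<odot>\<^bsub>A\<^esub> a) b = r \<odot>\<^bsub>M\<^esub> \<beta> a b) \<and>
    (\<forall>r \<in> carrier R. \<forall>a \<in> carrier A. \<forall>b \<in> carrier B. \<beta> a (r \<odot>\<^bsub>B\<^esub> b) = r \<odot>\<^bsub>M\<^esub> \<beta> a b)"

lemma bilinI:
  assumes "\<And>a b. a \<in> carrier A \<Longrightarrow> b \<in> carrier B \<Longrightarrow> \<beta> a b \<in> carrier M"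
    and "\<And>a a' b. a \<in> carrier A \<Longrightarrow> a' \<in> carrier A \<Longrightarrow> b \<in> carrier B \<Longrightarrow> \<beta> (a \<oplus>\<^bsub>A\<^esub> a') b = \<beta> a b \<oplus>\<^bsub>M\<^esub> \<beta> a' b"
    and "\<And>a b b'. a \<in> carrier A \<Longrightarrow> b \<in> carrier B \<Longrightarrow> b' \<in> carrier B \<Longrightarrow> \<beta> a (b \<oplus>\<^bsub>B\<^esub> b') = \<beta> a b \<oplus>\<^bsub>M\<^esub> \<beta> a b'"
    and "\<And>r a b. r \<in> carrier R \<Longrightarrow> a \<in> carrier A \<Longrightarrow> b \<in> carrier B \<Longrightarrow> \<beta> (r \<odot>\<^bsub>A\<^esub> a) b = r \<odot>\<^bsub>M\<^esub> \<beta> a b"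
    and "\<And>r a b. r \<in> carrier R \<Longrightarrow> a \<in> carrier A \<Longrightarrow> b \<in> carrier B \<Longrightarrow> \<beta> a (r \<odot>\<^bsub>B\<^esub> b) = r \<odot>\<^bsub>M\<^esub> \<beta> a b"
  shows "bilin R A B M \<beta>"
  using assms by (simp add: bilin_def)

lemma bilinD:
  assumes "bilin R A B M \<beta>"
  shows "\<And>a b. a \<in> carrier A \<Longrightarrow> b \<in> carrier B \<Longrightarrow> \<beta> a b \<in> carrier M"
    and "\<And>a a' b. a \<in> carrier A \<Longrightarrow> a' \<in> carrier A \<Longrightarrow> b \<in> carrier B \<Longrightarrow> \<beta> (a \<oplus>\<^bsub>A\<^esub> a') b = \<beta> a b \<oplus>\<^bsub>M\<^esub> \<beta> a' b"
    and "\<And>a b b'. a \<in> carrier A \<Longrightarrow> b \<in> carrier B \<Longrightarrow> b' \<in> carrier B \<Longrightarrow> \<beta> a (b \<oplus>\<^bsub>B\<^esub> b') = \<beta> a b \<oplus>\<^bsub>M\<^esub> \<beta> a b'"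
    and "\<And>r a b. r \<in> carrier R \<Longrightarrow> a \<in> carrier A \<Longrightarrow> b \<in> carrier B \<Longrightarrow> \<beta> (r \<odot>\<^bsub>A\<^esub> a) b = r \<odot>\<^bsub>M\<^esub> \<beta> a b"
    and "\<And>r a b. r \<in> carrier R \<Longrightarrow> a \<in> carrier A \<Longrightarrow> b \<in> carrier B \<Longrightarrow> \<beta> a (r \<odot>\<^bsub>B\<^esub> b) = r \<odot>\<^bsub>M\<^esub> \<beta> a b"
  using assms by (simp_all add: bilin_def)

locale two_algebras = A: assoc_algebra R A + B: assoc_algebra R B
  for R (structure) and A and B
begin

abbreviation T where "T \<equiv> tensor R A B"
abbreviation pt where "pt \<equiv> pure_tensor R A B"

lemma AB_sel:
  "carrier (A \<times>\<times> B) = carrier A \<times> carrier B"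
  "one (A \<times>\<times> B) = (\<one>\<^bsub>A\<^esub>, \<one>\<^bsub>B\<^esub>)"
  "(a, b) \<otimes>\<^bsub>A \<times>\<times> B\<^esub> (a', b') = (a \<otimes>\<^bsub>A\<^esub> a', b \<otimes>\<^bsub>B\<^esub> b')"
  by (simp_all add: DirProd_def)

lemma AB_monoid_alg: "monoid_alg R (A \<times>\<times> B)"
  by (intro monoid_alg.intro A.R.is_cring DirProd_monoid A.monoid_axioms B.monoid_axioms)

interpretation F: monoid_alg R "A \<times>\<times> B"
  by (rule AB_monoid_alg)

lemma single_AB: "a \<in> carrier A \<Longrightarrow> b \<in> carrier B \<Longrightarrow> single R (a, b) \<in> carrier F.MA"
  by (rule F.single_closed) (simp add: AB_sel)

lemma rels_sub: "tensor_rels R A B \<subseteq> carrier F.MA"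
  by (auto simp: tensor_rels_def Let_def single_AB)

lemma AB_presentation: "presentation R (A \<times>\<times> B) (tensor_rels R A B)"
  by (intro presentation.intro presentation_axioms.intro AB_monoid_alg rels_sub)

interpretation P: presentation R "A \<times>\<times> B" "tensor_rels R A B"
  by (rule AB_presentation)

lemma T_eq: "P.Q = T" "P.cls (single R (a, b)) = pt a b"
  by (simp_all add: tensor_def tensor_ideal_def pure_tensor_def)

lemma T_algebra: "assoc_algebra R T"
  using P.Q_assoc_algebra by (simp add: T_eq)

sublocale T: assoc_algebra R T
  by (rule T_algebra)

lemma pt_closed [simp]: "a \<in> carrier A \<Longrightarrow> b \<in> carrier B \<Longrightarrow> pt a b \<in> carrier T"
  using P.gen_closed[of "(a, b)"] by (simp add: T_eq AB_sel)

lemma pt_mult [simp]: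
  "a \<in> carrier A \<Longrightarrow> b \<in> carrier B \<Longrightarrow> a' \<in> carrier A \<Longrightarrow> b' \<in> carrier B \<Longrightarrow>
    pt a b \<otimes>\<^bsub>T\<^esub> pt a' b' = pt (a \<otimes>\<^bsub>A\<^esub> a') (b \<otimes>\<^bsub>B\<^esub> b')"
  using P.gen_mult[of "(a, b)" "(a', b')"] by (simp add: T_eq AB_sel)

lemma pt_one: "\<one>\<^bsub>T\<^esub> = pt \<one>\<^bsub>A\<^esub> \<one>\<^bsub>B\<^esub>"
  using P.gen_one by (simp add: T_eq AB_sel)

lemma rels1:
  assumes "a \<in> carrier A" "a' \<in> carrier A" "b \<in> carrier B"
  shows "single R (a \<oplus>\<^bsub>A\<^esub> a', b) \<ominus>\<^bsub>F.MA\<^esub> (single R (a, b) \<oplus>\<^bsub>F.MA\<^esub> single R (a', b)) \<in> tensor_rels R A B"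
  unfolding tensor_rels_def Let_def using assms by blast

lemma rels2:
  assumes "a \<in> carrier A" "b' \<in> carrier B" "b \<in> carrier B"
  shows "single R (a, b \<oplus>\<^bsub>B\<^esub> b') \<ominus>\<^bsub>F.MA\<^esub> (single R (a, b) \<oplus>\<^bsub>F.MA\<^esub> single R (a, b')) \<in> tensor_rels R A B"
  unfolding tensor_rels_def Let_def using assms by blast

lemma rels3:
  assumes "r \<in> carrier R" "a \<in> carrier A" "b \<in> carrier B"
  shows "single R (r \<odot>\<^bsub>A\<^esub> a, b) \<ominus>\<^bsub>F.MA\<^esub> r \<odot>\<^bsub>F.MA\<^esub> single R (a, b) \<in> tensor_rels R A B"
  unfolding tensor_rels_def Let_def using assms by blast

lemma rels4:
  assumes "r \<in> carrier R" "a \<in> carrier A" "b \<in> carrier B"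
  shows "single R (a, r \<odot>\<^bsub>B\<^esub> b) \<ominus>\<^bsub>F.MA\<^esub> r \<odot>\<^bsub>F.MA\<^esub> single R (a, b) \<in> tensor_rels R A B"
  unfolding tensor_rels_def Let_def using assms by blast

lemma pt_add_l [simp]:
  assumes "a \<in> carrier A" "a' \<in> carrier A" "b \<in> carrier B"
  shows "pt (a \<oplus>\<^bsub>A\<^esub> a') b = pt a b \<oplus>\<^bsub>T\<^esub> pt a' b"
  using P.rel_cls[OF _ _ rels1[OF assms]] P.cls_add[of "single R (a, b)" "single R (a', b)"] assms
  by (simp add: T_eq single_AB)

lemma pt_add_r [simp]:
  assumes "a \<in> carrier A" "b \<in> carrier B" "b' \<in> carrier B"
  shows "pt a (b \<oplus>\<^bsub>B\<^esub> b') = pt a b \<oplus>\<^bsub>T\<^esub> pt a b'"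
  using P.rel_cls[OF _ _ rels2[OF assms(1,3,2)]] P.cls_add[of "single R (a, b)" "single R (a, b')"] assms
  by (simp add: T_eq single_AB)

lemma pt_smult_l [simp]:
  assumes "r \<in> carrier R" "a \<in> carrier A" "b \<in> carrier B"
  shows "pt (r \<odot>\<^bsub>A\<^esub> a) b = r \<odot>\<^bsub>T\<^esub> pt a b"
  using P.rel_cls[OF _ _ rels3[OF assms]] P.cls_smult[of r "single R (a, b)"] assms
  by (simp add: T_eq single_AB)

lemma pt_smult_r [simp]:
  assumes "r \<in> carrier R" "a \<in> carrier A" "b \<in> carrier B"
  shows "pt a (r \<odot>\<^bsub>B\<^esub> b) = r \<odot>\<^bsub>T\<^esub> pt a b"
  using P.rel_cls[OF _ _ rels4[OF assms]] P.cls_smult[of r "single R (a, b)"] assms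
  by (simp add: T_eq single_AB)

lemma pt_zero_l [simp]: "b \<in> carrier B \<Longrightarrow> pt \<zero>\<^bsub>A\<^esub> b = \<zero>\<^bsub>T\<^esub>"
  using pt_smult_l[of "\<zero>\<^bsub>R\<^esub>" "\<zero>\<^bsub>A\<^esub>" b] by simp

lemma pt_zero_r [simp]: "a \<in> carrier A \<Longrightarrow> pt a \<zero>\<^bsub>B\<^esub> = \<zero>\<^bsub>T\<^esub>"
  using pt_smult_r[of "\<zero>\<^bsub>R\<^esub>" a "\<zero>\<^bsub>B\<^esub>"] by simp

lemma pt_minus_l [simp]:
  "a \<in> carrier A \<Longrightarrow> b \<in> carrier B \<Longrightarrow> pt (\<ominus>\<^bsub>A\<^esub> a) b = \<ominus>\<^bsub>T\<^esub> pt a b"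
  by (rule T.minus_equality[symmetric]) (simp_all flip: pt_add_l add: A.l_neg)

lemma pt_minus_r [simp]:
  "a \<in> carrier A \<Longrightarrow> b \<in> carrier B \<Longrightarrow> pt a (\<ominus>\<^bsub>B\<^esub> b) = \<ominus>\<^bsub>T\<^esub> pt a b"
  by (rule T.minus_equality[symmetric]) (simp_all flip: pt_add_r add: B.l_neg)

text \<open>Zero is itself a pure tensor and a scalar can be absorbed by the left factor, so sums
  and pure tensors are the only cases.\<close>

lemma T_induct [consumes 1, case_names add pt]:
  assumes X: "X \<in> carrier T"
    and add: "\<And>X Y. X \<in> carrier T \<Longrightarrow> Y \<in> carrier T \<Longrightarrow> P X \<Longrightarrow> P Y \<Longrightarrow> P (X \<oplus>\<^bsub>T\<^esub> Y)"
    and pt: "\<And>a b. a \<in> carrier A \<Longrightarrow> b \<in> carrier B \<Longrightarrow> P (pt a b)"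
  shows "P X"
proof -
  from X have "X \<in> carrier P.Q" by (simp add: T_eq)
  then show ?thesis
  proof (induction rule: P.Q_induct)
    case zero
    then show ?case using pt[of "\<zero>\<^bsub>A\<^esub>" "\<zero>\<^bsub>B\<^esub>"] by (simp add: T_eq)
  next
    case (add X Y)
    then show ?case using assms(2)[of X Y] by (simp add: T_eq)
  next
    case (gen r g)
    obtain a b where g: "g = (a, b)" "a \<in> carrier A" "b \<in> carrier B" using gen by (auto simp: AB_sel)
    then show ?case using pt[of "r \<odot>\<^bsub>A\<^esub> a" b] gen by (simp add: T_eq)
  qed
qed

text \<open>Each family of relations is stable under multiplication by basis elements on both sides:
  \<open>c\<close> and \<open>c'\<close> are absorbed into the first components, \<open>d\<close>
  and \<open>d'\<close> into the second. The result is a relation of the same family, and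
  bilinearity kills it.\<close>

lemma lift_kill:
  assumes M: "Module.module R M" and \<beta>: "bilin R A B M \<beta>"
  shows "presentation_lift R (A \<times>\<times> B) (tensor_rels R A B) M (\<lambda>z. \<beta> (fst z) (snd z))"
proof -
  interpret M: Module.module R M by fact
  interpret L: lin_extension R "A \<times>\<times> B" M "\<lambda>z. \<beta> (fst z) (snd z)"
    by (intro lin_extension.intro lin_extension_axioms.intro AB_monoid_alg M)
      (use bilinD(1)[OF \<beta>] in \<open>auto simp: AB_sel\<close>)
  have lx: "L.lx (single R (a, b)) = \<beta> a b" if "a \<in> carrier A" "b \<in> carrier B" for a b
    using that by (simp add: AB_sel)
  have sm: "single R (a, b) \<otimes>\<^bsub>F.MA\<^esub> single R (a', b') = single R (a \<otimes>\<^bsub>A\<^esub> a', b \<otimes>\<^bsub>B\<^esub> b')"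
    if "a \<in> carrier A" "b \<in> carrier B" "a' \<in> carrier A" "b' \<in> carrier B" for a b a' b'
    using that by (simp add: F.single_mult AB_sel)
  show ?thesis
  proof (intro presentation_lift.intro presentation_lift_axioms.intro AB_presentation L.lin_extension_axioms)
    fix f x y assume f: "f \<in> tensor_rels R A B" and x: "x \<in> carrier (A \<times>\<times> B)" and y: "y \<in> carrier (A \<times>\<times> B)"
    obtain c d where x: "x = (c, d)" "c \<in> carrier A" "d \<in> carrier B" using x by (auto simp: AB_sel)
    obtain c' d' where y: "y = (c', d')" "c' \<in> carrier A" "d' \<in> carrier B" using y by (auto simp: AB_sel)
    note D = a_minus_def F.MA.r_distr F.MA.l_distr F.MA.r_minus F.MA.l_minus F.MA.smult_mult_left
      F.MA.smult_mult_right sm lx single_AB bilinD[OF \<beta>] A.l_distr A.r_distr B.l_distr B.r_distr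
      A.smult_mult_left A.smult_mult_right B.smult_mult_left B.smult_mult_right M.r_neg
    from f consider
      (1) a a' b where "a \<in> carrier A" "a' \<in> carrier A" "b \<in> carrier B"
        "f = single R (a \<oplus>\<^bsub>A\<^esub> a', b) \<ominus>\<^bsub>F.MA\<^esub> (single R (a, b) \<oplus>\<^bsub>F.MA\<^esub> single R (a', b))"
      | (2) a b b' where "a \<in> carrier A" "b \<in> carrier B" "b' \<in> carrier B"
        "f = single R (a, b \<oplus>\<^bsub>B\<^esub> b') \<ominus>\<^bsub>F.MA\<^esub> (single R (a, b) \<oplus>\<^bsub>F.MA\<^esub> single R (a, b'))"
      | (3) r a b where "r \<in> carrier R" "a \<in> carrier A" "b \<in> carrier B"
        "f = single R (r \<odot>\<^bsub>A\<^esub> a, b) \<ominus>\<^bsub>F.MA\<^esub> r \<odot>\<^bsub>F.MA\<^esub> single R (a, b)"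
      | (4) r a b where "r \<in> carrier R" "a \<in> carrier A" "b \<in> carrier B"
        "f = single R (a, r \<odot>\<^bsub>B\<^esub> b) \<ominus>\<^bsub>F.MA\<^esub> r \<odot>\<^bsub>F.MA\<^esub> single R (a, b)"
      unfolding tensor_rels_def Let_def
      apply (elim UnE CollectE exE conjE)
      subgoal by (rule that(1))
      subgoal by (rule that(2))
      subgoal by (rule that(3))
      subgoal by (rule that(4))
      done
    then show "L.lx (single R x \<otimes>\<^bsub>F.MA\<^esub> f \<otimes>\<^bsub>F.MA\<^esub> single R y) = \<zero>\<^bsub>M\<^esub>"
    proof cases
      case 1
      then show ?thesis unfolding x(1) y(1) 1(4) using x(2,3) y(2,3) by (simp add: D)
    next
      case 2
      then show ?thesis unfolding x(1) y(1) 2(4) using x(2,3) y(2,3) by (simp add: D)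
    next
      case 3
      then show ?thesis unfolding x(1) y(1) 3(4) using x(2,3) y(2,3) by (simp add: D)
    next
      case 4
      then show ?thesis unfolding x(1) y(1) 4(4) using x(2,3) y(2,3) by (simp add: D)
    qed
  qed
qed

lemma lift_eq:
  assumes M: "Module.module R M" and \<beta>: "bilin R A B M \<beta>"
  shows "tensor_lift R M \<beta> = presentation_lift.qlift R M (\<lambda>z. \<beta> (fst z) (snd z))"
  by (rule ext)
    (simp add: tensor_lift_def presentation_lift.qlift_def[OF lift_kill[OF assms]] lin_ext_def Let_def)

context
  fixes M \<beta>
  assumes M: "Module.module R M" and \<beta>: "bilin R A B M \<beta>"
begin

interpretation L: presentation_lift R "A \<times>\<times> B" "tensor_rels R A B" M "\<lambda>z. \<beta> (fst z) (snd z)"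
  by (rule lift_kill[OF M \<beta>])

lemma lift_closed: "X \<in> carrier T \<Longrightarrow> tensor_lift R M \<beta> X \<in> carrier M"
  using L.qlift_closed by (simp add: lift_eq[OF M \<beta>] T_eq)

lemma lift_add:
  "X \<in> carrier T \<Longrightarrow> Y \<in> carrier T \<Longrightarrow>
    tensor_lift R M \<beta> (X \<oplus>\<^bsub>T\<^esub> Y) = tensor_lift R M \<beta> X \<oplus>\<^bsub>M\<^esub> tensor_lift R M \<beta> Y"
  using L.qlift_add by (simp add: lift_eq[OF M \<beta>] T_eq)

lemma lift_smult:
  "r \<in> carrier R \<Longrightarrow> X \<in> carrier T \<Longrightarrow> tensor_lift R M \<beta> (r \<odot>\<^bsub>T\<^esub> X) = r \<odot>\<^bsub>M\<^esub> tensor_lift R M \<beta> X"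
  using L.qlift_smult by (simp add: lift_eq[OF M \<beta>] T_eq)

lemma lift_pt: "a \<in> carrier A \<Longrightarrow> b \<in> carrier B \<Longrightarrow> tensor_lift R M \<beta> (pt a b) = \<beta> a b"
  using L.qlift_gen[of "(a, b)"] by (simp add: lift_eq[OF M \<beta>] T_eq AB_sel)

end

lemma lift_alg_hom:
  assumes M: "assoc_algebra R M" and \<beta>: "bilin R A B M \<beta>"
    and one: "\<beta> \<one>\<^bsub>A\<^esub> \<one>\<^bsub>B\<^esub> = \<one>\<^bsub>M\<^esub>"
    and mult: "\<And>a b a' b'. a \<in> carrier A \<Longrightarrow> b \<in> carrier B \<Longrightarrow> a' \<in> carrier A \<Longrightarrow> b' \<in> carrier B \<Longrightarrow>
      \<beta> (a \<otimes>\<^bsub>A\<^esub> a') (b \<otimes>\<^bsub>B\<^esub> b') = \<beta> a b \<otimes>\<^bsub>M\<^esub> \<beta> a' b'"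
  shows "tensor_lift R M \<beta> \<in> alg_hom R T M"
proof -
  interpret M: assoc_algebra R M by fact
  interpret L: presentation_lift R "A \<times>\<times> B" "tensor_rels R A B" M "\<lambda>z. \<beta> (fst z) (snd z)"
    by (rule lift_kill[OF M.module_axioms \<beta>])
  have "L.qlift \<in> alg_hom R P.Q M"
    by (rule L.qlift_alg_hom[OF M]) (use mult one in \<open>auto simp: AB_sel\<close>)
  then show ?thesis by (simp add: lift_eq[OF M.module_axioms \<beta>] T_eq)
qed

end

section \<open>Powers in characteristic p\<close>

lemma (in Group.monoid) pow_commute:
  assumes x: "x \<in> carrier G" and y: "y \<in> carrier G" and xy: "x \<otimes> y = y \<otimes> x"
  shows "y [^] (j::nat) \<otimes> x = x \<otimes> y [^] j"
proof (induction j)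
  case (Suc j)
  have "y [^] Suc j \<otimes> x = y [^] j \<otimes> x \<otimes> y" using x y xy by (simp add: m_assoc)
  also have "\<dots> = x \<otimes> y [^] Suc j" using x y Suc by (simp add: m_assoc)
  finally show ?case .
qed (use x in simp)

lemma ring_binomial:
  fixes R (structure)
  assumes "Ring.ring R" and x: "x \<in> carrier R" and y: "y \<in> carrier R" and xy: "x \<otimes> y = y \<otimes> x"
  shows "(x \<oplus> y) [^] (n::nat) = (\<Oplus>i\<in>{..n}. [(n choose i)] \<cdot> (x [^] i \<otimes> y [^] (n - i)))"
proof -
  interpret Ring.ring R by fact
  show ?thesis
  proof (induction n)
    case 0
    then show ?case by simp
  next
    case (Suc n)
    define f where "f m i = [(m choose i)] \<cdot> (x [^] i \<otimes> y [^] (m - i))" for m i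
    have f: "f m i \<in> carrier R" for m i using x y by (simp add: f_def)
    have fx: "f n i \<otimes> x = [(n choose i)] \<cdot> (x [^] Suc i \<otimes> y [^] (n - i))" for i
    proof -
      have "x [^] i \<otimes> y [^] (n - i) \<otimes> x = x [^] Suc i \<otimes> y [^] (n - i)"
        using x y pow_commute[OF x y xy] by (simp add: m_assoc)
      then show ?thesis using x y unfolding f_def by (subst add_pow_ldistr) simp_all
    qed
    have fy: "f n i \<otimes> y = [(n choose i)] \<cdot> (x [^] i \<otimes> y [^] (Suc n - i))" if "i \<le> n" for i
      using x y that unfolding f_def by (subst add_pow_ldistr) (simp_all add: m_assoc Suc_diff_le)
    have step: "f (Suc n) (Suc i) = f n i \<otimes> x \<oplus> [(n choose Suc i)] \<cdot> (x [^] Suc i \<otimes> y [^] (n - i))" for i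
      unfolding fx using x y by (simp add: f_def add.nat_pow_mult)
    have "(x \<oplus> y) [^] Suc n = (\<Oplus>i\<in>{..n}. f n i) \<otimes> x \<oplus> (\<Oplus>i\<in>{..n}. f n i) \<otimes> y"
      using Suc x y f by (simp add: f_def[symmetric] r_distr)
    also have "(\<Oplus>i\<in>{..n}. f n i) \<otimes> x = (\<Oplus>i\<in>{..n}. f n i \<otimes> x)"
      using x f by (intro finsum_ldistr) auto
    also have "(\<Oplus>i\<in>{..n}. f n i) \<otimes> y = (\<Oplus>i\<in>{..n}. f n i \<otimes> y)"
      using y f by (intro finsum_ldistr) auto
    also have "(\<Oplus>i\<in>{..n}. f n i \<otimes> y) = (\<Oplus>i\<in>{..n}. [(n choose i)] \<cdot> (x [^] i \<otimes> y [^] (Suc n - i)))"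
      using x y by (intro finsum_cong') (auto simp: fy)
    \<comment> \<open>The added top term has coefficient \<open>n choose Suc n\<close>, which is
      zero. Splitting off the bottom term next aligns the indices with \<open>step\<close>.\<close>
    also have "\<dots> = (\<Oplus>i\<in>{..Suc n}. [(n choose i)] \<cdot> (x [^] i \<otimes> y [^] (Suc n - i)))"
      using x y by (subst finsum_Suc) (auto simp: binomial_eq_0)
    also have "\<dots> = (\<Oplus>i\<in>{..n}. [(n choose Suc i)] \<cdot> (x [^] Suc i \<otimes> y [^] (n - i))) \<oplus> f (Suc n) 0"
      using x y by (subst finsum_Suc2) (auto simp: f_def simp del: nat_pow_Suc)
    also have "(\<Oplus>i\<in>{..n}. f n i \<otimes> x) \<oplus>
        ((\<Oplus>i\<in>{..n}. [(n choose Suc i)] \<cdot> (x [^] Suc i \<otimes> y [^] (n - i))) \<oplus> f (Suc n) 0) =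
      (\<Oplus>i\<in>{..n}. f n i \<otimes> x \<oplus> [(n choose Suc i)] \<cdot> (x [^] Suc i \<otimes> y [^] (n - i))) \<oplus> f (Suc n) 0"
      using x y f by (subst finsum_addf) (auto simp: a_assoc intro!: finsum_closed)
    also have "\<dots> = (\<Oplus>i\<in>{..Suc n}. f (Suc n) i)"
      unfolding step[symmetric] using f by (subst finsum_Suc2) auto
    finally show ?case by (simp add: f_def)
  qed
qed

text \<open>The ambient ring is noncommutative in all applications; commutation of \<open>x\<close>
  with \<open>y\<close> is enough for the binomial formula, whose middle coefficients are divisible
  by \<open>p\<close>.\<close>

lemma frobenius_add:
  fixes R (structure)
  assumes R: "Ring.ring R" and x: "x \<in> carrier R" and y: "y \<in> carrier R" and xy: "x \<otimes> y = y \<otimes> x"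
    and p: "prime p" and char: "\<And>z. z \<in> carrier R \<Longrightarrow> [p] \<cdot> z = \<zero>"
  shows "(x \<oplus> y) [^] (p::nat) = x [^] p \<oplus> y [^] p"
proof -
  interpret Ring.ring R by fact
  obtain k where k: "p = Suc k" using p by (metis not0_implies_Suc not_prime_0)
  have k0: "k \<noteq> 0" using prime_gt_1_nat[OF p] k by simp
  obtain j where j: "k = Suc j" using k0 not0_implies_Suc by blast
  define f where "f i = [(p choose i)] \<cdot> (x [^] i \<otimes> y [^] (p - i))" for i
  have f: "f i \<in> carrier R" for i using x y by (simp add: f_def)
  have 0: "f i = \<zero>" if "0 < i" "i < p" for i
  proof -
    have "p dvd (p choose i)" using p that by (intro dvd_choose_prime) auto
    then obtain c where c: "p choose i = p * c" by blast
    have "f i = [c] \<cdot> ([p] \<cdot> (x [^] i \<otimes> y [^] (p - i)))"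
      unfolding f_def c using x y by (simp add: add.nat_pow_pow)
    then show ?thesis using char x y by simp
  qed
  have "(x \<oplus> y) [^] p = (\<Oplus>i\<in>{..p}. f i)"
    unfolding f_def by (rule ring_binomial[OF R x y xy])
  also have "\<dots> = f p \<oplus> (\<Oplus>i\<in>{..k}. f i)"
    unfolding k using f by (subst finsum_Suc) auto
  also have "(\<Oplus>i\<in>{..k}. f i) = (\<Oplus>i\<in>{..j}. f (Suc i)) \<oplus> f 0"
    unfolding j using f by (subst finsum_Suc2) auto
  also have "(\<Oplus>i\<in>{..j}. f (Suc i)) = \<zero>"
    using 0 k j by (intro add.finprod_one_eqI) auto
  finally show ?thesis using x y f by (simp add: f_def)
qed

section \<open>The trace of the p-th power of a matrix\<close>

lemma prod_one_minus:
  fixes y :: "'a::comm_ring_1"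
  assumes "finite S"
  shows "\<exists>r. (\<Prod>i\<in>S. 1 - y * m i) = 1 - y * sum m S + y\<^sup>2 * r"
  using assms
proof (induction S rule: finite_induct)
  case empty
  then show ?case by (intro exI[of _ 0]) simp
next
  case (insert i S)
  then obtain r where r: "(\<Prod>i\<in>S. 1 - y * m i) = 1 - y * sum m S + y\<^sup>2 * r" by blast
  have "(\<Prod>i\<in>insert i S. 1 - y * m i) = (1 - y * m i) * (1 - y * sum m S + y\<^sup>2 * r)"
    using insert r by simp
  also have "\<dots> = 1 - y * sum m (insert i S) + y\<^sup>2 * (r - y * m i * r + m i * sum m S)"
    using insert by (simp add: algebra_simps power2_eq_square)
  finally show ?case by blast
qed

text \<open>Modulo the square of \<open>y\<close> only the identity permutation matters up to its
  linear term: any other permutation moves some \<open>i\<close> and also its image, and both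
  entries lie off the diagonal, hence are divisible by \<open>y\<close>.\<close>

lemma det_one_minus:
  fixes M :: "'a::comm_ring_1^'n^'n"
  shows "\<exists>r. det (mat 1 - (\<chi> i j. y * M $ i $ j)) = 1 - y * trace M + y\<^sup>2 * r"
proof -
  let ?N = "mat 1 - (\<chi> i j. y * M $ i $ j)"
  have dvd: "y\<^sup>2 dvd of_int (sign s) * (\<Prod>i\<in>UNIV. ?N $ i $ s i)" if s: "s permutes UNIV" "s \<noteq> id" for s :: "'n \<Rightarrow> 'n"
  proof -
    obtain i where i: "s i \<noteq> i" using s(2) by (auto simp: fun_eq_iff)
    have si: "s (s i) \<noteq> s i" using i s(1) by (metis permutes_inv_eq)
    have "(\<Prod>i\<in>UNIV. ?N $ i $ s i) = ?N $ i $ s i * (?N $ s i $ s (s i) * (\<Prod>i\<in>UNIV - {i} - {s i}. ?N $ i $ s i))"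
      using i by (subst prod.remove[of _ i], simp, simp, subst prod.remove[of _ "s i"]) auto
    moreover have "?N $ i $ s i = - y * M $ i $ s i" "?N $ s i $ s (s i) = - y * M $ s i $ s (s i)"
      using i si by (simp_all add: mat_def)
    ultimately have "(\<Prod>i\<in>UNIV. ?N $ i $ s i) =
        y\<^sup>2 * (M $ i $ s i * M $ s i $ s (s i) * (\<Prod>i\<in>UNIV - {i} - {s i}. ?N $ i $ s i))"
      by (simp add: power2_eq_square mult_ac)
    then show ?thesis by (simp only: dvd_mult dvd_triv_left)
  qed
  have fin: "finite {s. s permutes (UNIV :: 'n set)}" by (rule finite_permutations) simp
  have "det ?N = (\<Prod>i\<in>UNIV. ?N $ i $ i) + (\<Sum>s\<in>{s. s permutes UNIV} - {id}. of_int (sign s) * (\<Prod>i\<in>UNIV. ?N $ i $ s i))"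
    unfolding det_def using fin by (subst sum.remove[of _ id]) (simp_all add: permutes_id)
  moreover have "y\<^sup>2 dvd (\<Sum>s\<in>{s. s permutes UNIV} - {id}. of_int (sign s) * (\<Prod>i\<in>UNIV. ?N $ i $ s i))"
    using dvd by (intro dvd_sum) auto
  moreover obtain r where "(\<Prod>i\<in>UNIV. 1 - y * M $ i $ i) = 1 - y * (\<Sum>i\<in>UNIV. M $ i $ i) + y\<^sup>2 * r"
    using prod_one_minus[of UNIV y "\<lambda>i. M $ i $ i"] by auto
  moreover have "(\<Prod>i\<in>UNIV. ?N $ i $ i) = (\<Prod>i\<in>UNIV. 1 - y * M $ i $ i)"
    by (simp add: mat_def)
  ultimately obtain r' r where "det ?N = 1 - y * trace M + y\<^sup>2 * r + y\<^sup>2 * r'"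
    by (auto simp: trace_def elim!: dvdE)
  then show ?thesis by (intro exI[of _ "r + r'"]) (simp add: algebra_simps)
qed

text \<open>The class operations on vectors are componentwise, so the ring of square matrices is
  packaged as a record. This makes the Frobenius identity for commuting elements available for
  matrices.\<close>

definition matrix_ring :: "('a::comm_ring_1^'n^'n) ring" where
  "matrix_ring = \<lparr>carrier = UNIV, mult = (**), one = mat 1, zero = 0, add = (+)\<rparr>"

lemma matrix_ring_ring: "Ring.ring matrix_ring"
proof (rule ringI)
  show "abelian_group (matrix_ring :: ('a^'n^'n) ring)"
    by (rule abelian_groupI) (auto simp: matrix_ring_def ac_simps intro: exI[of _ "- _"])
  show "Group.monoid (matrix_ring :: ('a^'n^'n) ring)"
    by (rule monoidI) (simp_all add: matrix_ring_def matrix_mul_assoc)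
qed (simp_all add: matrix_ring_def matrix_matrix_mult_def vec_eq_iff algebra_simps sum.distrib)

lemma matrix_power_Suc: "matrix_power X (Suc r) = X ** matrix_power X r"
  by (simp add: matrix_power_def)

lemma matrix_power_comm: "X ** matrix_power X r = matrix_power X r ** X"
proof (induction r)
  case 0
  then show ?case by (simp add: matrix_power_def)
next
  case (Suc r)
  then show ?case by (metis matrix_power_Suc matrix_mul_assoc)
qed

lemma matrix_power_ring: "matrix_power (X::'a::comm_ring_1^'n^'n) r = X [^]\<^bsub>matrix_ring\<^esub> r"
proof (induction r)
  case 0
  then show ?case by (simp add: matrix_power_def matrix_ring_def)
next
  case (Suc r)
  have "mult matrix_ring = ((**) :: 'a::comm_ring_1^'n^'n \<Rightarrow> _)" by (simp add: matrix_ring_def)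
  moreover have "matrix_power X (Suc r) = matrix_power X r ** X"
    unfolding matrix_power_Suc by (rule matrix_power_comm)
  ultimately show ?case using Suc by simp
qed

lemma det_matrix_power: "det (matrix_power X r) = det X ^ r"
  by (induction r) (simp_all add: matrix_power_Suc det_mul, simp add: matrix_power_def)

lemma matrix_power_scale:
  fixes X :: "'a::comm_ring_1^'n^'n"
  shows "matrix_power (\<chi> i j. c * X $ i $ j) r = (\<chi> i j. c ^ r * matrix_power X r $ i $ j)"
proof (induction r)
  case 0
  then show ?case by (simp add: matrix_power_def)
next
  case (Suc r)
  then show ?case by (simp add: matrix_power_Suc matrix_matrix_mult_def sum_distrib_left mult_ac)
qed

lemma matrix_power_map_C:
  "matrix_power (\<chi> i j. [:(X::'a::comm_ring_1^'n^'n) $ i $ j:]) r = (\<chi> i j. [:matrix_power X r $ i $ j:])"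
proof (induction r)
  case 0
  then show ?case by (simp add: matrix_power_def mat_def vec_eq_iff one_pCons)
next
  case (Suc r)
  have s: "(\<Sum>i\<in>S. [:f i:]) = [:\<Sum>i\<in>S. f i:]" for f :: "'n \<Rightarrow> 'a" and S
    by (induction S rule: infinite_finite_induct) auto
  from Suc show ?case by (simp add: matrix_power_Suc matrix_matrix_mult_def s mult.commute)
qed

lemma add_pow_class:
  assumes "carrier R = UNIV" "zero R = 0" "add R = (+)"
  shows "[(n::nat)] \<cdot>\<^bsub>R\<^esub> (x::'a::monoid_add) = ((+) x ^^ n) 0"
proof (induction n)
  case 0
  then show ?case using assms by (simp add: add_pow_def nat_pow_def)
next
  case (Suc n)
  have "((+) x ^^ n) 0 + x = x + ((+) x ^^ n) 0" by (induction n) (simp_all add: add.assoc)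
  then show ?case using Suc assms by (simp add: add_pow_def nat_pow_def)
qed

text \<open>Over the polynomial ring in \<open>s\<close> one has
  \<open>(1 - s X)^p = 1 - s^p X^p\<close>. Taking determinants, the left side is
  \<open>(1 - s tr X + s^2 r)^p = 1 - s^p (tr X)^p + s^(2p) r^p\<close>, and the coefficients of
  \<open>s^p\<close> give the claim. It shows that the trace zero matrices are closed under the
  p-map.\<close>

lemma trace_matrix_power_char:
  fixes X :: "'k::field^'n^'n"
  assumes "CHAR('k) = p" and "prime p"
  shows "trace (matrix_power X p) = trace X ^ p"
proof -
  let ?C = "\<lambda>X :: 'k^'n^'n. (\<chi> i j. [:X $ i $ j:]) :: 'k poly^'n^'n"
  let ?s = "\<lambda>y (X :: 'k poly^'n^'n). (\<chi> i j. y * X $ i $ j)"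
  define s where "s = (monom 1 1 :: 'k poly)"
  have char: "CHAR('k poly) = p" using assms by simp
  have p0: "p > 0" using assms(2) by (rule prime_gt_0_nat)
  have z: "[p] \<cdot>\<^bsub>matrix_ring\<^esub> Z = \<zero>\<^bsub>matrix_ring\<^esub>" for Z :: "'k poly^'n^'n"
  proof -
    have "[n] \<cdot>\<^bsub>matrix_ring\<^esub> Z = (\<chi> i j. of_nat n * Z $ i $ j)" for n
      by (subst add_pow_class; (simp add: matrix_ring_def)?) (induction n; simp add: vec_eq_iff algebra_simps)
    then show ?thesis using char by (metis (no_types, lifting) matrix_ring_def mult_zero_left of_nat_CHAR ring.simps(1) vec_lambda_beta vec_eq_iff zero_index)
  qed
  have neg: "matrix_power (- Y) p = - matrix_power Y p" for Y :: "'k poly^'n^'n"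
  proof -
    have "- Y = ?s (-1) Y" "- matrix_power Y p = ?s (-1) (matrix_power Y p)" by (simp_all add: vec_eq_iff)
    moreover have "(-1 :: 'k poly) ^ p = -1"
    proof -
      \<comment> \<open>Deriving the sign from the Frobenius identity instead of from the parity of
        \<open>p\<close> includes p = 2.\<close>
      have "(1 + (-1) :: 'k poly) ^ p = 1 ^ p + (-1) ^ p" using char assms by (intro freshmans_dream) auto
      then show ?thesis using p0 by (simp add: zero_power add_eq_0_iff)
    qed
    ultimately show ?thesis by (simp only: matrix_power_scale)
  qed
  have one: "matrix_power (mat 1) p = (mat 1 :: 'k poly^'n^'n)"
    by (induction p) (simp_all add: matrix_power_Suc, simp add: matrix_power_def)
  have "matrix_power (mat 1 + - ?s s (?C X)) p = matrix_power (mat 1) p + matrix_power (- ?s s (?C X)) p"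
    unfolding matrix_power_ring
    using frobenius_add[OF matrix_ring_ring, of "mat 1" "- ?s s (?C X)" p] assms(2) z
    by (simp add: matrix_ring_def)
  then have m: "matrix_power (mat 1 - ?s s (?C X)) p = mat 1 - ?s (s ^ p) (?C (matrix_power X p))"
    unfolding neg one matrix_power_scale matrix_power_map_C by simp
  obtain r where r: "det (mat 1 - ?s s (?C X)) = 1 - s * trace (?C X) + s\<^sup>2 * r"
    using det_one_minus by blast
  obtain r' where r': "det (mat 1 - ?s (s ^ p) (?C (matrix_power X p))) =
      1 - s ^ p * trace (?C (matrix_power X p)) + (s ^ p)\<^sup>2 * r'"
    using det_one_minus by blast
  have tr: "trace (?C Y) = [:trace Y:]" for Y
  proof -
    have s: "(\<Sum>i\<in>S. [:f i:]) = [:\<Sum>i\<in>S. f i:]" for f :: "'n \<Rightarrow> 'k" and S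
      by (induction S rule: infinite_finite_induct) auto
    show ?thesis by (simp add: trace_def s)
  qed
  have fd: "(a + b) ^ p = a ^ p + b ^ p" for a b :: "'k poly"
    using char assms by (intro freshmans_dream) auto
  have "(1 - s * [:trace X:] + s\<^sup>2 * r) ^ p = 1 - s ^ p * [:trace (matrix_power X p):] + (s ^ p)\<^sup>2 * r'"
    using arg_cong[OF m, of det] unfolding det_matrix_power r r' tr .
  moreover have "(1 - s * [:trace X:] + s\<^sup>2 * r) ^ p = 1 - s ^ p * [:trace X ^ p:] + (s ^ p)\<^sup>2 * r ^ p"
  proof -
    have "(1 - c) ^ p = 1 - c ^ p" for c :: "'k poly"
      using fd[of "1 - c" c] by (simp add: algebra_simps)
    then show ?thesis unfolding fd by (simp add: power_mult_distrib poly_const_pow power_mult[symmetric] mult.commute smult_power)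
  qed
  moreover have "A - B = C - D" if "1 - A + B = 1 - C + D" for A B C D :: "'k poly"
    using that by (simp add: algebra_simps)
  ultimately have "coeff (s ^ p * [:trace X ^ p:] - (s ^ p)\<^sup>2 * r ^ p) p =
      coeff (s ^ p * [:trace (matrix_power X p):] - (s ^ p)\<^sup>2 * r') p"
    by metis
  \<comment> \<open>A multiple of \<open>s^(2p)\<close> has no term of degree \<open>p\<close>
    because \<open>p\<close> is positive.\<close>
  moreover have "coeff ((s ^ p)\<^sup>2 * c) p = 0" for c
    using p0 by (simp add: s_def monom_power power2_eq_square mult_monom coeff_monom_mult mult.assoc[symmetric])
  ultimately show ?thesis by (simp add: s_def monom_power coeff_monom_mult)
qed

section \<open>The restricted enveloping algebra\<close>

text \<open>Serves records that take over the ring operations of another structure and change only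
  the scalar action.\<close>

lemma ring_cong:
  assumes "Ring.ring B" "carrier A = carrier B" "mult A = mult B" "one A = one B" "zero A = zero B" "add A = add B"
  shows "Ring.ring A"
proof -
  interpret B: Ring.ring B by fact
  have "abelian_group A"
  proof (rule abelian_groupI)
    fix X assume "X \<in> carrier A"
    then show "\<exists>Y\<in>carrier A. Y \<oplus>\<^bsub>A\<^esub> X = \<zero>\<^bsub>A\<^esub>"
      unfolding assms by (intro bexI[of _ "\<ominus>\<^bsub>B\<^esub> X"]) (simp_all add: B.l_neg)
  qed (unfold assms, simp_all add: B.a_ac)
  moreover have "Group.monoid A"
    by (rule monoidI) (unfold assms, simp_all add: B.m_assoc)
  ultimately show ?thesis
    by (rule ringI) (unfold assms, simp_all add: B.l_distr B.r_distr)
qed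

lemma alg_hom_zero:
  assumes "Ring.ring A" "Ring.ring B" "f \<in> alg_hom R A B"
  shows "f \<zero>\<^bsub>A\<^esub> = \<zero>\<^bsub>B\<^esub>"
proof -
  interpret A: Ring.ring A by fact
  interpret B: Ring.ring B by fact
  have "f \<zero>\<^bsub>A\<^esub> \<in> carrier B" "f \<zero>\<^bsub>A\<^esub> \<oplus>\<^bsub>B\<^esub> f \<zero>\<^bsub>A\<^esub> = f \<zero>\<^bsub>A\<^esub>"
    using alg_homD[OF assms(3)] by (simp_all flip: alg_homD(3)[OF assms(3)])
  then show ?thesis by simp
qed

lemma alg_hom_minus:
  assumes "Ring.ring A" "Ring.ring B" "f \<in> alg_hom R A B" "x \<in> carrier A"
  shows "f (\<ominus>\<^bsub>A\<^esub> x) = \<ominus>\<^bsub>B\<^esub> f x"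
proof -
  interpret A: Ring.ring A by fact
  interpret B: Ring.ring B by fact
  show ?thesis
    by (rule B.minus_equality[symmetric])
      (use assms(4) alg_homD[OF assms(3)] alg_hom_zero[OF assms(1-3)] in \<open>simp_all flip: alg_homD(3)[OF assms(3)] add: A.l_neg\<close>)
qed

lemma alg_hom_pow:
  assumes "Ring.ring A" "Ring.ring B" "f \<in> alg_hom R A B" "x \<in> carrier A"
  shows "f (x [^]\<^bsub>A\<^esub> (k::nat)) = f x [^]\<^bsub>B\<^esub> k"
proof -
  interpret A: Ring.ring A by fact
  interpret B: Ring.ring B by fact
  show ?thesis by (induction k) (use assms(4) alg_homD[OF assms(3)] in simp_all)
qed

lemma ring_of_class_sel [simp]:
  "carrier ring_of_class = UNIV" "mult ring_of_class = (*)" "one ring_of_class = 1"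
  "zero ring_of_class = 0" "add ring_of_class = (+)"
  by (simp_all add: ring_of_class_def)

lemma ring_of_class_cring: "cring ring_of_class"
proof (rule cringI)
  show "abelian_group (ring_of_class :: 'a::comm_ring_1 ring)"
    by (rule abelian_groupI) (auto simp: algebra_simps intro: exI[of _ "- _"])
  show "Group.comm_monoid (ring_of_class :: 'a::comm_ring_1 ring)"
    by (rule comm_monoidI) (simp_all add: mult_ac)
qed (simp add: algebra_simps)

section \<open>The base ring K[t]/(t^p - q t)\<close>

lemma poly_algebra_sel [simp]:
  "carrier poly_algebra = UNIV" "mult poly_algebra = (*)" "one poly_algebra = 1"
  "zero poly_algebra = 0" "add poly_algebra = (+)" "module.smult poly_algebra = Polynomial.smult"
  by (simp_all add: poly_algebra_def)

lemma poly_algebra_cring: "cring poly_algebra"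
proof (rule cringI)
  show "abelian_group (poly_algebra :: ('a::comm_ring_1, 'a poly) module)"
    by (rule abelian_groupI) (auto simp: algebra_simps intro: exI[of _ "- _"])
  show "Group.comm_monoid (poly_algebra :: ('a::comm_ring_1, 'a poly) module)"
    by (rule comm_monoidI) (simp_all add: mult_ac)
qed (simp add: algebra_simps)

lemma poly_algebra_assoc: "assoc_algebra ring_of_class poly_algebra"
proof -
  interpret P: cring "poly_algebra :: ('a::comm_ring_1, 'a poly) module" by (rule poly_algebra_cring)
  have "Module.module ring_of_class (poly_algebra :: ('a, 'a poly) module)"
    by (rule Module.moduleI[OF ring_of_class_cring P.is_abelian_group])
      (simp_all add: smult_add_left smult_add_right)
  then show ?thesis
    by (intro assoc_algebra.intro assoc_algebra_axioms.intro P.ring_axioms) simp_all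
qed

lemma tpoly_quotient: "quotient_algebra ring_of_class poly_algebra (tpoly_ideal p q)"
proof -
  interpret P: cring "poly_algebra :: ('a, 'a poly) module" by (rule poly_algebra_cring)
  show ?thesis
    unfolding tpoly_ideal_def by (intro quotient_algebra.intro poly_algebra_assoc P.genideal_ideal) simp
qed

lemma tpoly_assoc: "assoc_algebra ring_of_class (tpoly p q)"
  unfolding tpoly_def by (rule quotient_algebra.Q_assoc_algebra[OF tpoly_quotient])

lemma tpoly_cring: "cring (tpoly p q)"
proof -
  interpret quotient_algebra ring_of_class poly_algebra "tpoly_ideal p q" by (rule tpoly_quotient)
  interpret T: assoc_algebra ring_of_class "tpoly p q" by (rule tpoly_assoc)
  have "x \<otimes>\<^bsub>tpoly p q\<^esub> y = y \<otimes>\<^bsub>tpoly p q\<^esub> x"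
    if x: "x \<in> carrier (tpoly p q)" and y: "y \<in> carrier (tpoly p q)" for x y
  proof -
    obtain f where f: "x = tpoly_ideal p q +>\<^bsub>poly_algebra\<^esub> f" using x unfolding tpoly_def by (rule Q_cases)
    obtain g where g: "y = tpoly_ideal p q +>\<^bsub>poly_algebra\<^esub> g" using y unfolding tpoly_def by (rule Q_cases)
    show ?thesis unfolding f g tpoly_def by (simp add: mult.commute)
  qed
  then show ?thesis
    by (intro cring.intro comm_monoid.intro comm_monoid_axioms.intro T.ring_axioms T.monoid_axioms)
qed

lemma tvar_closed: "tvar p q \<in> carrier (tpoly p q)"
  unfolding tvar_def tpoly_def by (rule quotient_algebra.cls_closed[OF tpoly_quotient]) simp

lemma add_pow_char:
  fixes A :: "('k::field, 'a, 'm) module_scheme"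
  assumes "assoc_algebra ring_of_class A" and "CHAR('k) = p" and x: "x \<in> carrier A"
  shows "[p] \<cdot>\<^bsub>A\<^esub> x = \<zero>\<^bsub>A\<^esub>"
proof -
  interpret A: assoc_algebra ring_of_class A by fact
  have "[n] \<cdot>\<^bsub>A\<^esub> x = of_nat n \<odot>\<^bsub>A\<^esub> x" for n
  proof (induction n)
    case 0
    then show ?case using x A.smult_l_null[of x] by simp
  next
    case (Suc n)
    have "of_nat (Suc n) \<odot>\<^bsub>A\<^esub> x = of_nat n \<odot>\<^bsub>A\<^esub> x \<oplus>\<^bsub>A\<^esub> 1 \<odot>\<^bsub>A\<^esub> x"
      using A.smult_l_distr[of "of_nat n" 1 x] x by (simp add: add.commute)
    also have "1 \<odot>\<^bsub>A\<^esub> x = x" using A.smult_one[of x] x by simp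
    finally show ?case using Suc x by simp
  qed
  then have "[p] \<cdot>\<^bsub>A\<^esub> x = of_nat p \<odot>\<^bsub>A\<^esub> x" .
  then show ?thesis using assms(2) A.smult_l_null[of x] x by (metis of_nat_CHAR ring_of_class_sel(4))
qed

text \<open>The parameter \<open>n_type\<close> brings the type of matrix indices into the locale,
  since \<open>p\<close> and \<open>q\<close> do not mention it.\<close>

locale sl_char =
  fixes p :: nat and q :: "'k::field" and n_type :: "'n::finite itself"
  assumes char: "CHAR('k) = p" and prime: "prime p"
begin

abbreviation K where "K \<equiv> ring_of_class :: 'k ring"
abbreviation SL where "SL \<equiv> sl :: ('k^'n^'n) set"
abbreviation W where "W \<equiv> \<lparr>carrier = lists SL, mult = (@), one = []\<rparr>"
abbreviation U where "U \<equiv> u_sl p :: ('k, (('k^'n^'n) list \<Rightarrow> 'k) set) module"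
abbreviation ug where "ug \<equiv> u_sl_gen p :: 'k^'n^'n \<Rightarrow> _"

lemma sl_add: "X \<in> SL \<Longrightarrow> Y \<in> SL \<Longrightarrow> X + Y \<in> SL"
  by (simp add: sl_def trace_add)

lemma sl_scale:
  assumes "X \<in> SL"
  shows "map_matrix (\<lambda>x. c * x) X \<in> SL"
proof -
  have "trace (map_matrix (\<lambda>x. c * x) X) = c * trace X"
    unfolding trace_def sum_distrib_left by (rule sum.cong) (simp_all add: map_matrix_def)
  then show ?thesis using assms by (simp add: sl_def)
qed

lemma sl_comm: "X ** Y - Y ** X \<in> SL"
  using trace_mul_sym[of X Y] by (simp add: sl_def trace_sub)

text \<open>This is what makes the p-th power relations meaningful: the generator of a matrix
  outside \<open>sl\<close> does not belong to the free algebra.\<close>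

lemma sl_pow:
  assumes "X \<in> SL"
  shows "matrix_power X p \<in> SL"
proof -
  have "trace (matrix_power X p) = 0 ^ p"
    using assms trace_matrix_power_char[OF char prime, of X] by (simp add: sl_def)
  then show ?thesis using prime_gt_0_nat[OF prime] by (simp add: sl_def)
qed

lemma W_monoid_alg: "monoid_alg K W"
  by (intro monoid_alg.intro ring_of_class_cring monoidI) auto

interpretation F: monoid_alg K W
  by (rule W_monoid_alg)

abbreviation sg where "sg \<equiv> \<lambda>X. single K [X]"

lemma FA_eq: "free_algebra_sl = F.MA"
  by (simp add: free_algebra_sl_def)

lemma sg_closed: "X \<in> SL \<Longrightarrow> sg X \<in> carrier F.MA"
  by (rule F.single_closed) simp

lemma u_rels_cases [consumes 1, case_names add scale comm pow]:
  assumes "f \<in> u_sl_rels p"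
  obtains X Y where "X \<in> SL" "Y \<in> SL" "f = sg (X + Y) \<ominus>\<^bsub>F.MA\<^esub> (sg X \<oplus>\<^bsub>F.MA\<^esub> sg Y)"
  | c X where "X \<in> SL" "f = sg (map_matrix (\<lambda>x. c * x) X) \<ominus>\<^bsub>F.MA\<^esub> c \<odot>\<^bsub>F.MA\<^esub> sg X"
  | X Y where "X \<in> SL" "Y \<in> SL"
      "f = sg (X ** Y - Y ** X) \<ominus>\<^bsub>F.MA\<^esub> (sg X \<otimes>\<^bsub>F.MA\<^esub> sg Y \<ominus>\<^bsub>F.MA\<^esub> sg Y \<otimes>\<^bsub>F.MA\<^esub> sg X)"
  | X where "X \<in> SL" "f = sg (matrix_power X p) \<ominus>\<^bsub>F.MA\<^esub> sg X [^]\<^bsub>F.MA\<^esub> p"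
  using assms unfolding u_sl_rels_def Let_def FA_eq
  apply (elim UnE CollectE exE conjE)
  subgoal by (rule that(1))
  subgoal by (rule that(2))
  subgoal by (rule that(3))
  subgoal by (rule that(4))
  done

lemma u_rels_sub: "u_sl_rels p \<subseteq> carrier F.MA"
proof
  fix f :: "('k^'n^'n) list \<Rightarrow> 'k" assume "f \<in> u_sl_rels p"
  then show "f \<in> carrier F.MA"
  proof (cases rule: u_rels_cases)
    case (add X Y)
    then show ?thesis using sl_add[of X Y] sg_closed[of X] sg_closed[of Y] sg_closed[of "X + Y"] by simp
  next
    case (scale c X)
    then show ?thesis using sl_scale[of X c] sg_closed[of X] sg_closed[of "map_matrix (\<lambda>x. c * x) X"] by simp
  next
    case (comm X Y)
    then show ?thesis using sl_comm[of X Y] sg_closed[of X] sg_closed[of Y] sg_closed[of "X ** Y - Y ** X"] by simp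
  next
    case (pow X)
    then show ?thesis using sl_pow[of X] sg_closed[of X] sg_closed[of "matrix_power X p"] by simp
  qed
qed

lemma u_presentation: "presentation K W (u_sl_rels p)"
  by (intro presentation.intro presentation_axioms.intro W_monoid_alg u_rels_sub)

interpretation P: presentation K W "u_sl_rels p"
  by (rule u_presentation)

lemma U_eq: "P.Q = U" "P.cls (sg X) = ug X"
  by (simp_all add: u_sl_def u_sl_ideal_def u_sl_gen_def FA_eq)

lemma U_algebra: "assoc_algebra K U"
  using P.Q_assoc_algebra by (simp add: U_eq)

sublocale U: assoc_algebra K U
  by (rule U_algebra)

lemma ug_closed [simp]: "X \<in> SL \<Longrightarrow> ug X \<in> carrier U"
  using P.gen_closed[of "[X]"] by (simp add: U_eq)

lemma u_rel_cls:
  assumes "f \<in> carrier F.MA" "f' \<in> carrier F.MA" "f \<ominus>\<^bsub>F.MA\<^esub> f' \<in> u_sl_rels p"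
  shows "P.cls f = P.cls f'"
  using assms by (rule P.rel_cls)

lemma ug_add:
  assumes "X \<in> SL" "Y \<in> SL"
  shows "ug (X + Y) = ug X \<oplus>\<^bsub>U\<^esub> ug Y"
proof -
  note c = sg_closed[OF assms(1)] sg_closed[OF assms(2)] sg_closed[OF sl_add[OF assms]]
  have "P.cls (sg (X + Y)) = P.cls (sg X \<oplus>\<^bsub>F.MA\<^esub> sg Y)"
  proof (rule u_rel_cls)
    show "sg (X + Y) \<ominus>\<^bsub>F.MA\<^esub> (sg X \<oplus>\<^bsub>F.MA\<^esub> sg Y) \<in> u_sl_rels p"
      unfolding u_sl_rels_def Let_def FA_eq using assms by blast
  qed (use c in simp_all)
  then show ?thesis using P.cls_add[OF c(1,2)] by (simp add: U_eq)
qed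

lemma ug_scale:
  assumes "X \<in> SL"
  shows "ug (map_matrix (\<lambda>x. c * x) X) = c \<odot>\<^bsub>U\<^esub> ug X"
proof -
  note c = sg_closed[OF assms(1)] sg_closed[OF sl_scale[OF assms, of c]]
  have "P.cls (sg (map_matrix (\<lambda>x. c * x) X)) = P.cls (c \<odot>\<^bsub>F.MA\<^esub> sg X)"
  proof (rule u_rel_cls)
    show "sg (map_matrix (\<lambda>x. c * x) X) \<ominus>\<^bsub>F.MA\<^esub> c \<odot>\<^bsub>F.MA\<^esub> sg X \<in> u_sl_rels p"
      unfolding u_sl_rels_def Let_def FA_eq using assms by blast
  qed (use c in simp_all)
  then show ?thesis using P.cls_smult[of c "sg X"] c by (simp add: U_eq)
qed

lemma ug_comm:
  assumes "X \<in> SL" "Y \<in> SL"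
  shows "ug (X ** Y - Y ** X) = ug X \<otimes>\<^bsub>U\<^esub> ug Y \<ominus>\<^bsub>U\<^esub> ug Y \<otimes>\<^bsub>U\<^esub> ug X"
proof -
  note c = sg_closed[OF assms(1)] sg_closed[OF assms(2)] sg_closed[OF sl_comm[of X Y]]
  have "P.cls (sg (X ** Y - Y ** X)) = P.cls (sg X \<otimes>\<^bsub>F.MA\<^esub> sg Y \<ominus>\<^bsub>F.MA\<^esub> sg Y \<otimes>\<^bsub>F.MA\<^esub> sg X)"
  proof (rule u_rel_cls)
    show "sg (X ** Y - Y ** X) \<ominus>\<^bsub>F.MA\<^esub> (sg X \<otimes>\<^bsub>F.MA\<^esub> sg Y \<ominus>\<^bsub>F.MA\<^esub> sg Y \<otimes>\<^bsub>F.MA\<^esub> sg X) \<in> u_sl_rels p"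
      unfolding u_sl_rels_def Let_def FA_eq using assms by blast
  qed (use c in simp_all)
  moreover have "P.cls (\<ominus>\<^bsub>F.MA\<^esub> z) = \<ominus>\<^bsub>U\<^esub> P.cls z" if "z \<in> carrier F.MA" for z
    using alg_hom_minus[OF F.MA_ring U.ring_axioms _ that, of "P.cls" K] P.cls_alg_hom by (simp add: U_eq)
  moreover have "P.cls (sg X \<otimes>\<^bsub>F.MA\<^esub> sg Y \<ominus>\<^bsub>F.MA\<^esub> sg Y \<otimes>\<^bsub>F.MA\<^esub> sg X) =
      P.cls (sg X \<otimes>\<^bsub>F.MA\<^esub> sg Y) \<oplus>\<^bsub>P.Q\<^esub> P.cls (\<ominus>\<^bsub>F.MA\<^esub> (sg Y \<otimes>\<^bsub>F.MA\<^esub> sg X))"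
    unfolding a_minus_def by (rule P.cls_add[symmetric]) (use c in simp_all)
  moreover have "P.cls (sg X \<otimes>\<^bsub>F.MA\<^esub> sg Y) = ug X \<otimes>\<^bsub>U\<^esub> ug Y" "P.cls (sg Y \<otimes>\<^bsub>F.MA\<^esub> sg X) = ug Y \<otimes>\<^bsub>U\<^esub> ug X"
    using P.cls_mult[OF c(1,2)] P.cls_mult[OF c(2,1)] by (simp_all add: U_eq)
  ultimately show ?thesis using c by (simp add: U_eq) (simp add: a_minus_def)
qed

lemma ug_pow:
  assumes "X \<in> SL"
  shows "ug (matrix_power X p) = ug X [^]\<^bsub>U\<^esub> p"
proof -
  note c = sg_closed[OF assms(1)] sg_closed[OF sl_pow[OF assms]]
  have "P.cls (sg (matrix_power X p)) = P.cls (sg X [^]\<^bsub>F.MA\<^esub> p)"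
  proof (rule u_rel_cls)
    show "sg (matrix_power X p) \<ominus>\<^bsub>F.MA\<^esub> sg X [^]\<^bsub>F.MA\<^esub> p \<in> u_sl_rels p"
      unfolding u_sl_rels_def Let_def FA_eq using assms by blast
  qed (use c in simp_all)
  moreover have "P.cls (sg X [^]\<^bsub>F.MA\<^esub> p) = P.cls (sg X) [^]\<^bsub>U\<^esub> p"
    using alg_hom_pow[OF F.MA_ring U.ring_axioms _ c(1), of "P.cls" K] P.cls_alg_hom by (simp add: U_eq)
  ultimately show ?thesis by (simp add: U_eq)
qed

lemma u_induct [consumes 1, case_names one gen add mult smult]:
  assumes x: "x \<in> carrier U"
    and one: "P \<one>\<^bsub>U\<^esub>"
    and gen: "\<And>X. X \<in> SL \<Longrightarrow> P (ug X)"
    and add: "\<And>x y. x \<in> carrier U \<Longrightarrow> y \<in> carrier U \<Longrightarrow> P x \<Longrightarrow> P y \<Longrightarrow> P (x \<oplus>\<^bsub>U\<^esub> y)"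
    and mult: "\<And>x y. x \<in> carrier U \<Longrightarrow> y \<in> carrier U \<Longrightarrow> P x \<Longrightarrow> P y \<Longrightarrow> P (x \<otimes>\<^bsub>U\<^esub> y)"
    and smult: "\<And>c x. x \<in> carrier U \<Longrightarrow> P x \<Longrightarrow> P (c \<odot>\<^bsub>U\<^esub> x)"
  shows "P x"
proof -
  have words: "P (P.gen w) \<and> P.gen w \<in> carrier U" if "w \<in> lists SL" for w
    using that
  proof (induction w)
    case Nil
    then show ?case using P.gen_one one by (simp add: U_eq)
  next
    case (Cons X w)
    have "P.gen (X # w) = ug X \<otimes>\<^bsub>U\<^esub> P.gen w"
      using P.gen_mult[of "[X]" w] Cons by (simp add: U_eq)
    then show ?case using Cons gen[of X] mult by simp
  qed
  have "x \<in> carrier P.Q" using x by (simp add: U_eq)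
  then show ?thesis
  proof (induction rule: P.Q_induct)
    case zero
    have "\<zero>\<^bsub>U\<^esub> = 0 \<odot>\<^bsub>U\<^esub> \<one>\<^bsub>U\<^esub>" using U.smult_l_null[of "\<one>\<^bsub>U\<^esub>"] by simp
    then show ?case using one smult[of "\<one>\<^bsub>U\<^esub>" 0] by (simp add: U_eq)
  next
    case (add x y)
    then show ?case using assms(4)[of x y] by (simp add: U_eq)
  next
    case (gen r g)
    then show ?case using words[of g] smult[of "P.gen g" r] by (simp add: U_eq)
  qed
qed

text \<open>A word goes to the ordered product of the values of its letters. The linear extension is
  then multiplicative, so a relation with value zero keeps value zero between basis elements, as
  \<open>presentation_lift\<close> demands.\<close>

lemma u_universal:
  assumes B: "assoc_algebra K B"
    and f: "\<And>X. X \<in> SL \<Longrightarrow> f X \<in> carrier B"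
    and add: "\<And>X Y. X \<in> SL \<Longrightarrow> Y \<in> SL \<Longrightarrow> f (X + Y) = f X \<oplus>\<^bsub>B\<^esub> f Y"
    and scale: "\<And>c X. X \<in> SL \<Longrightarrow> f (map_matrix (\<lambda>x. c * x) X) = c \<odot>\<^bsub>B\<^esub> f X"
    and comm: "\<And>X Y. X \<in> SL \<Longrightarrow> Y \<in> SL \<Longrightarrow> f (X ** Y - Y ** X) = f X \<otimes>\<^bsub>B\<^esub> f Y \<ominus>\<^bsub>B\<^esub> f Y \<otimes>\<^bsub>B\<^esub> f X"
    and pow: "\<And>X. X \<in> SL \<Longrightarrow> f (matrix_power X p) = f X [^]\<^bsub>B\<^esub> p"
  shows "\<exists>\<Phi> \<in> alg_hom K U B. \<forall>X \<in> SL. \<Phi> (ug X) = f X"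
proof -
  interpret B: assoc_algebra K B by fact
  define \<phi> where "\<phi> w = foldr (\<lambda>X b. f X \<otimes>\<^bsub>B\<^esub> b) w \<one>\<^bsub>B\<^esub>" for w
  have \<phi>c: "\<phi> w \<in> carrier B" if "w \<in> lists SL" for w
    using that by (induction w) (simp_all add: \<phi>_def f)
  have \<phi>m: "\<phi> (v @ w) = \<phi> v \<otimes>\<^bsub>B\<^esub> \<phi> w" if "v \<in> lists SL" "w \<in> lists SL" for v w
    using that(1)
  proof (induction v)
    case Nil
    then show ?case using \<phi>c[OF that(2)] by (simp add: \<phi>_def)
  next
    case (Cons X v)
    then show ?case using \<phi>c[of v] \<phi>c[OF that(2)] f[of X] by (simp add: \<phi>_def B.m_assoc)
  qed
  interpret L: lin_extension K W B \<phi>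
    by (intro lin_extension.intro lin_extension_axioms.intro W_monoid_alg B.module_axioms) (simp add: \<phi>c)
  have lm: "L.lx (g \<otimes>\<^bsub>F.MA\<^esub> g') = L.lx g \<otimes>\<^bsub>B\<^esub> L.lx g'" if "g \<in> carrier F.MA" "g' \<in> carrier F.MA" for g g'
    using L.lx_mult[OF B _ that] \<phi>m by simp
  have l1: "L.lx \<one>\<^bsub>F.MA\<^esub> = \<one>\<^bsub>B\<^esub>"
    using L.lx_single[of "[]"] by (simp add: F.MA_sel(2) \<phi>_def)
  have lp: "L.lx (g [^]\<^bsub>F.MA\<^esub> (i::nat)) = L.lx g [^]\<^bsub>B\<^esub> i" if "g \<in> carrier F.MA" for g i
    by (induction i) (use that l1 in \<open>simp_all add: lm\<close>)
  have ls: "\<phi> [X] = f X" if "X \<in> SL" for X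
    using that f by (simp add: \<phi>_def)
  have rel: "L.lx g = \<zero>\<^bsub>B\<^esub>" if "g \<in> u_sl_rels p" for g :: "('k^'n^'n) list \<Rightarrow> 'k"
    using that
  proof (cases rule: u_rels_cases)
    case (add X Y)
    then show ?thesis
      using sg_closed[of X] sg_closed[of Y] sg_closed[OF sl_add[of X Y]] f[of X] f[of Y]
      by (simp add: ls sl_add assms(3) a_minus_def B.r_neg)
  next
    case (scale c X)
    then show ?thesis
      using sg_closed[of X] sg_closed[OF sl_scale[of X c]] f[of X]
      by (simp add: ls sl_scale assms(4) a_minus_def B.r_neg)
  next
    case (comm X Y)
    then show ?thesis
      using sg_closed[of X] sg_closed[of Y] sg_closed[OF sl_comm[of X Y]] f[of X] f[of Y]
      by (simp add: ls lm sl_comm assms(5)) (simp add: a_minus_def B.r_neg)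
  next
    case (pow X)
    then show ?thesis
      using sg_closed[of X] sg_closed[OF sl_pow[of X]] f[of X]
      by (simp add: ls lp sl_pow assms(6)) (simp add: a_minus_def B.r_neg)
  qed
  interpret L: presentation_lift K W "u_sl_rels p" B \<phi>
  proof (intro presentation_lift.intro presentation_lift_axioms.intro u_presentation L.lin_extension_axioms)
    fix g :: "('k^'n^'n) list \<Rightarrow> 'k" and x y assume g: "g \<in> u_sl_rels p" and xy: "x \<in> carrier W" "y \<in> carrier W"
    have "g \<in> carrier F.MA" using g u_rels_sub by blast
    then show "L.lx (single K x \<otimes>\<^bsub>F.MA\<^esub> g \<otimes>\<^bsub>F.MA\<^esub> single K y) = \<zero>\<^bsub>B\<^esub>"
      using xy F.single_closed[of x] F.single_closed[of y] \<phi>c by (simp add: lm rel[OF g])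
  qed
  have "L.qlift \<in> alg_hom K P.Q B"
    by (rule L.qlift_alg_hom[OF B]) (simp_all add: \<phi>m, simp add: \<phi>_def)
  moreover have "L.qlift (P.gen [X]) = f X" if "X \<in> SL" for X
    using L.qlift_gen[of "[X]"] that f by (simp add: \<phi>_def)
  ultimately show ?thesis unfolding U_eq by blast
qed

end

section \<open>Extension of scalars to the truncated polynomials\<close>

context sl_char
begin

abbreviation R where "R \<equiv> tpoly p q"
abbreviation A where "A \<equiv> utq_sl p q :: ('k poly set, ('k, 'n) utq_elem) module"
abbreviation G where "G \<equiv> utq_gen p q :: 'k^'n^'n \<Rightarrow> ('k, 'n) utq_elem"

lemma UR_two_algebras: "two_algebras K U R"
  by (intro two_algebras.intro U_algebra tpoly_assoc)

interpretation UR: two_algebras K U R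
  by (rule UR_two_algebras)

interpretation R: cring R
  by (rule tpoly_cring)

lemma A_sel:
  "carrier A = carrier UR.T" "mult A = mult UR.T" "one A = one UR.T" "zero A = zero UR.T" "add A = add UR.T"
  "module.smult A = (\<lambda>r x. UR.pt \<one>\<^bsub>U\<^esub> r \<otimes>\<^bsub>A\<^esub> x)"
  by (simp_all add: utq_sl_def Let_def)

lemma A_ring: "Ring.ring A"
  by (rule ring_cong[OF UR.T.ring_axioms]) (simp_all add: A_sel)

interpretation A: Ring.ring A
  by (rule A_ring)

lemma pt_mult_A:
  "u \<in> carrier U \<Longrightarrow> r \<in> carrier R \<Longrightarrow> u' \<in> carrier U \<Longrightarrow> r' \<in> carrier R \<Longrightarrow>
    UR.pt u r \<otimes>\<^bsub>A\<^esub> UR.pt u' r' = UR.pt (u \<otimes>\<^bsub>U\<^esub> u') (r \<otimes>\<^bsub>R\<^esub> r')"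
  by (simp add: A_sel)

lemma pt_closed_A: "u \<in> carrier U \<Longrightarrow> r \<in> carrier R \<Longrightarrow> UR.pt u r \<in> carrier A"
  by (simp add: A_sel)

text \<open>The second tensor factor is central because \<open>R\<close> is commutative. Without
  this, \<open>A\<close> would only be a left module over \<open>R\<close> and not an
  algebra.\<close>

lemma pt_central:
  assumes r: "r \<in> carrier R" and x: "x \<in> carrier A"
  shows "UR.pt \<one>\<^bsub>U\<^esub> r \<otimes>\<^bsub>A\<^esub> x = x \<otimes>\<^bsub>A\<^esub> UR.pt \<one>\<^bsub>U\<^esub> r"
proof -
  have "x \<in> carrier UR.T" using x by (simp add: A_sel)
  then show ?thesis
  proof (induction rule: UR.T_induct)
    case (add X Y)
    then show ?case using r by (simp add: A_sel UR.T.l_distr UR.T.r_distr)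
  next
    case (pt a b)
    then show ?case using r by (simp add: pt_mult_A R.m_comm)
  qed
qed

lemma A_algebra: "assoc_algebra R A"
proof -
  note c = pt_closed_A[OF U.one_closed]
  have "Module.module R A"
  proof (rule Module.moduleI[OF tpoly_cring A.is_abelian_group])
    fix r s x assume rs: "r \<in> carrier R" "s \<in> carrier R" and x: "x \<in> carrier A"
    have "UR.pt \<one>\<^bsub>U\<^esub> (r \<oplus>\<^bsub>R\<^esub> s) = UR.pt \<one>\<^bsub>U\<^esub> r \<oplus>\<^bsub>A\<^esub> UR.pt \<one>\<^bsub>U\<^esub> s"
      using rs by (simp add: A_sel)
    then show "(r \<oplus>\<^bsub>R\<^esub> s) \<odot>\<^bsub>A\<^esub> x = r \<odot>\<^bsub>A\<^esub> x \<oplus>\<^bsub>A\<^esub> s \<odot>\<^bsub>A\<^esub> x"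
      using rs x c by (simp add: A_sel(6) A.l_distr)
    show "(r \<otimes>\<^bsub>R\<^esub> s) \<odot>\<^bsub>A\<^esub> x = r \<odot>\<^bsub>A\<^esub> (s \<odot>\<^bsub>A\<^esub> x)"
      using rs x c by (simp add: A_sel(6) pt_mult_A flip: A.m_assoc)
  next
    fix x assume x: "x \<in> carrier A"
    have "UR.pt \<one>\<^bsub>U\<^esub> \<one>\<^bsub>R\<^esub> = \<one>\<^bsub>A\<^esub>" by (simp add: A_sel UR.pt_one)
    then show "\<one>\<^bsub>R\<^esub> \<odot>\<^bsub>A\<^esub> x = x" using x by (simp add: A_sel(6))
  qed (use c in \<open>simp_all add: A_sel(6) A.r_distr\<close>)
  then show ?thesis
  proof (intro assoc_algebra.intro assoc_algebra_axioms.intro A_ring)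
    fix r x y assume r: "r \<in> carrier R" and xy: "x \<in> carrier A" "y \<in> carrier A"
    show "(r \<odot>\<^bsub>A\<^esub> x) \<otimes>\<^bsub>A\<^esub> y = r \<odot>\<^bsub>A\<^esub> (x \<otimes>\<^bsub>A\<^esub> y)"
      using r xy c by (simp add: A_sel(6) A.m_assoc)
    have "x \<otimes>\<^bsub>A\<^esub> (UR.pt \<one>\<^bsub>U\<^esub> r \<otimes>\<^bsub>A\<^esub> y) = (x \<otimes>\<^bsub>A\<^esub> UR.pt \<one>\<^bsub>U\<^esub> r) \<otimes>\<^bsub>A\<^esub> y"
      using r xy c by (simp add: A.m_assoc)
    also have "\<dots> = UR.pt \<one>\<^bsub>U\<^esub> r \<otimes>\<^bsub>A\<^esub> (x \<otimes>\<^bsub>A\<^esub> y)"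
      using r xy c by (simp add: pt_central[symmetric] A.m_assoc)
    finally show "x \<otimes>\<^bsub>A\<^esub> (r \<odot>\<^bsub>A\<^esub> y) = r \<odot>\<^bsub>A\<^esub> (x \<otimes>\<^bsub>A\<^esub> y)"
      by (simp add: A_sel(6))
  qed
qed

lemma G_eq: "G X = UR.pt (ug X) \<one>\<^bsub>R\<^esub>"
  by (simp add: utq_gen_def)

lemma G_closed [simp]: "X \<in> SL \<Longrightarrow> G X \<in> carrier A"
  by (simp add: G_eq pt_closed_A)

lemma G_add: "X \<in> SL \<Longrightarrow> Y \<in> SL \<Longrightarrow> G (X + Y) = G X \<oplus>\<^bsub>A\<^esub> G Y"
  by (simp add: G_eq ug_add A_sel)

lemma pt_one_smult: "u \<in> carrier U \<Longrightarrow> r \<in> carrier R \<Longrightarrow> UR.pt u r = r \<odot>\<^bsub>A\<^esub> UR.pt u \<one>\<^bsub>R\<^esub>"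
  by (simp add: A_sel(6) pt_mult_A)

text \<open>The record \<open>A\<close> carries only the action of \<open>R\<close>, so a scalar of
  the field acts through its image in \<open>R\<close>.\<close>

lemma G_scale: "X \<in> SL \<Longrightarrow> G (map_matrix (\<lambda>x. c * x) X) = (c \<odot>\<^bsub>R\<^esub> \<one>\<^bsub>R\<^esub>) \<odot>\<^bsub>A\<^esub> G X"
  using pt_one_smult[of "ug X" "c \<odot>\<^bsub>R\<^esub> \<one>\<^bsub>R\<^esub>"] by (simp add: G_eq ug_scale A_sel(6))

lemma alg_hom_pt_one: "(\<lambda>u. UR.pt u \<one>\<^bsub>R\<^esub>) \<in> alg_hom K U UR.T"
  by (rule alg_homI) (simp_all add: UR.pt_one)

lemma A_minus: "x \<in> carrier A \<Longrightarrow> \<ominus>\<^bsub>A\<^esub> x = \<ominus>\<^bsub>UR.T\<^esub> x"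
  by (rule A.minus_equality) (simp_all add: A_sel UR.T.l_neg)

lemma A_pow: "x \<in> carrier A \<Longrightarrow> x [^]\<^bsub>A\<^esub> (i::nat) = x [^]\<^bsub>UR.T\<^esub> i"
  by (induction i) (simp_all add: A_sel)

lemma G_comm: "X \<in> SL \<Longrightarrow> Y \<in> SL \<Longrightarrow> G (X ** Y - Y ** X) = G X \<otimes>\<^bsub>A\<^esub> G Y \<ominus>\<^bsub>A\<^esub> G Y \<otimes>\<^bsub>A\<^esub> G X"
  by (simp add: G_eq ug_comm a_minus_def A_minus pt_closed_A pt_mult_A) (simp add: A_sel)

lemma G_pow: "X \<in> SL \<Longrightarrow> G (matrix_power X p) = G X [^]\<^bsub>A\<^esub> p"
  using alg_hom_pow[OF U.ring_axioms UR.T.ring_axioms alg_hom_pt_one, of "ug X" p]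
  by (simp add: G_eq ug_pow A_pow pt_closed_A)

lemma A_char: "x \<in> carrier A \<Longrightarrow> [p] \<cdot>\<^bsub>A\<^esub> x = \<zero>\<^bsub>A\<^esub>"
  using add_pow_char[OF UR.T_algebra char, of x] by (simp add: add_pow_def nat_pow_def A_sel)

lemma R_char: "r \<in> carrier R \<Longrightarrow> [p] \<cdot>\<^bsub>R\<^esub> r = \<zero>\<^bsub>R\<^esub>"
  by (rule add_pow_char[OF tpoly_assoc char])

lemma A_induct [consumes 1, case_names one gen add mult smult]:
  assumes x: "x \<in> carrier A"
    and one: "P \<one>\<^bsub>A\<^esub>"
    and gen: "\<And>X. X \<in> SL \<Longrightarrow> P (G X)"
    and add: "\<And>x y. x \<in> carrier A \<Longrightarrow> y \<in> carrier A \<Longrightarrow> P x \<Longrightarrow> P y \<Longrightarrow> P (x \<oplus>\<^bsub>A\<^esub> y)"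
    and mult: "\<And>x y. x \<in> carrier A \<Longrightarrow> y \<in> carrier A \<Longrightarrow> P x \<Longrightarrow> P y \<Longrightarrow> P (x \<otimes>\<^bsub>A\<^esub> y)"
    and smult: "\<And>r x. r \<in> carrier R \<Longrightarrow> x \<in> carrier A \<Longrightarrow> P x \<Longrightarrow> P (r \<odot>\<^bsub>A\<^esub> x)"
  shows "P x"
proof -
  have 1: "P (UR.pt u \<one>\<^bsub>R\<^esub>)" if "u \<in> carrier U" for u
    using that
  proof (induction rule: u_induct)
    case one
    then show ?case using assms(2) by (simp add: A_sel UR.pt_one)
  next
    case (gen X)
    then show ?case using assms(3) by (simp add: G_eq)
  next
    case (add x y)
    then show ?case using assms(4)[of "UR.pt x \<one>\<^bsub>R\<^esub>" "UR.pt y \<one>\<^bsub>R\<^esub>"] by (simp add: A_sel)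
  next
    case (mult x y)
    then show ?case using assms(5)[of "UR.pt x \<one>\<^bsub>R\<^esub>" "UR.pt y \<one>\<^bsub>R\<^esub>"]
      by (simp add: pt_mult_A pt_closed_A)
  next
    case (smult c x)
    have "UR.pt (c \<odot>\<^bsub>U\<^esub> x) \<one>\<^bsub>R\<^esub> = (c \<odot>\<^bsub>R\<^esub> \<one>\<^bsub>R\<^esub>) \<odot>\<^bsub>A\<^esub> UR.pt x \<one>\<^bsub>R\<^esub>"
      using pt_one_smult[of x "c \<odot>\<^bsub>R\<^esub> \<one>\<^bsub>R\<^esub>"] smult by (simp add: A_sel(6))
    then show ?case using smult assms(6)[of "c \<odot>\<^bsub>R\<^esub> \<one>\<^bsub>R\<^esub>" "UR.pt x \<one>\<^bsub>R\<^esub>"]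
      by (simp add: pt_closed_A)
  qed
  have "x \<in> carrier UR.T" using x by (simp add: A_sel)
  then show ?thesis
  proof (induction rule: UR.T_induct)
    case (add X Y)
    then show ?case using assms(4)[of X Y] by (simp add: A_sel)
  next
    case (pt a b)
    then show ?case using 1[of a] pt_one_smult[of a b] assms(6)[of b "UR.pt a \<one>\<^bsub>R\<^esub>"]
      by (simp add: pt_closed_A)
  qed
qed

text \<open>Restricting the scalars of \<open>B\<close> from \<open>R\<close> to the field gives a
  target \<open>BK\<close> for the universal property of \<open>u_sl\<close>. The map obtained there
  extends to the tensor product by letting the second factor act through scalars of
  \<open>B\<close>.\<close>

lemma A_universal:
  assumes B: "assoc_algebra R B"
    and f: "\<And>X. X \<in> SL \<Longrightarrow> f X \<in> carrier B"
    and add: "\<And>X Y. X \<in> SL \<Longrightarrow> Y \<in> SL \<Longrightarrow> f (X + Y) = f X \<oplus>\<^bsub>B\<^esub> f Y"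
    and scale: "\<And>c X. X \<in> SL \<Longrightarrow> f (map_matrix (\<lambda>x. c * x) X) = (c \<odot>\<^bsub>R\<^esub> \<one>\<^bsub>R\<^esub>) \<odot>\<^bsub>B\<^esub> f X"
    and comm: "\<And>X Y. X \<in> SL \<Longrightarrow> Y \<in> SL \<Longrightarrow> f (X ** Y - Y ** X) = f X \<otimes>\<^bsub>B\<^esub> f Y \<ominus>\<^bsub>B\<^esub> f Y \<otimes>\<^bsub>B\<^esub> f X"
    and pow: "\<And>X. X \<in> SL \<Longrightarrow> f (matrix_power X p) = f X [^]\<^bsub>B\<^esub> p"
  shows "\<exists>\<Phi> \<in> alg_hom R A B. \<forall>X \<in> SL. \<Phi> (G X) = f X"
proof -
  interpret B: assoc_algebra R B by fact
  let ?\<kappa> = "\<lambda>c. c \<odot>\<^bsub>R\<^esub> \<one>\<^bsub>R\<^esub>"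
  define BK where "BK = \<lparr>carrier = carrier B, mult = mult B, one = one B, zero = zero B, add = add B,
     smult = (\<lambda>c::'k. \<lambda>x. ?\<kappa> c \<odot>\<^bsub>B\<^esub> x)\<rparr>"
  have sel: "carrier BK = carrier B" "mult BK = mult B" "one BK = one B" "zero BK = zero B" "add BK = add B"
    "module.smult BK = (\<lambda>c x. ?\<kappa> c \<odot>\<^bsub>B\<^esub> x)"
    by (simp_all add: BK_def)
  have \<kappa>: "?\<kappa> c \<in> carrier R" "?\<kappa> (c + d) = ?\<kappa> c \<oplus>\<^bsub>R\<^esub> ?\<kappa> d" "?\<kappa> (c * d) = ?\<kappa> c \<otimes>\<^bsub>R\<^esub> ?\<kappa> d" "?\<kappa> 1 = \<one>\<^bsub>R\<^esub>" for c d
    using UR.B.smult_l_distr[of c d "\<one>\<^bsub>R\<^esub>"] UR.B.smult_assoc1[of c d "\<one>\<^bsub>R\<^esub>"] UR.B.smult_one[of "\<one>\<^bsub>R\<^esub>"]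
      UR.B.smult_mult_left[of c "\<one>\<^bsub>R\<^esub>" "?\<kappa> d"] by simp_all
  have "Ring.ring BK" by (rule ring_cong[OF B.ring_axioms]) (simp_all add: sel)
  then interpret BK: Ring.ring BK .
  have "Module.module K BK"
    by (rule Module.moduleI[OF ring_of_class_cring BK.is_abelian_group])
      (use \<kappa>(1) in \<open>simp_all add: sel \<kappa>(2-) B.smult_l_distr B.smult_r_distr B.smult_assoc1\<close>)
  then have BK: "assoc_algebra K BK"
    by (intro assoc_algebra.intro assoc_algebra_axioms.intro BK.ring_axioms)
      (use \<kappa>(1) in \<open>simp_all add: sel B.smult_mult_left B.smult_mult_right\<close>)
  then interpret BK: assoc_algebra K BK .
  have minus: "\<ominus>\<^bsub>BK\<^esub> x = \<ominus>\<^bsub>B\<^esub> x" if "x \<in> carrier B" for x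
    by (rule BK.minus_equality) (use that in \<open>simp_all add: sel B.l_neg\<close>)
  have powB: "x [^]\<^bsub>BK\<^esub> i = x [^]\<^bsub>B\<^esub> i" for x and i :: nat
    by (induction i) (simp_all add: sel)
  have "\<exists>\<Phi> \<in> alg_hom K U BK. \<forall>X \<in> SL. \<Phi> (ug X) = f X"
    by (rule u_universal[OF BK])
      (simp_all add: sel a_minus_def minus powB f add scale comm pow)
  then obtain \<Phi> where \<Phi>: "\<Phi> \<in> alg_hom K U BK" "\<And>X. X \<in> SL \<Longrightarrow> \<Phi> (ug X) = f X" by blast
  note \<Phi>D = alg_homD[OF \<Phi>(1), unfolded sel]
  define \<beta> where "\<beta> u r = r \<odot>\<^bsub>B\<^esub> \<Phi> u" for u r
  have \<kappa>r: "c \<odot>\<^bsub>R\<^esub> r = ?\<kappa> c \<otimes>\<^bsub>R\<^esub> r" if "r \<in> carrier R" for c r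
    using UR.B.smult_mult_left[of c "\<one>\<^bsub>R\<^esub>" r] that by simp
  have \<beta>: "bilin K U R BK \<beta>"
  proof (rule bilinI)
    fix c u r assume ur: "u \<in> carrier U" "r \<in> carrier R"
    show "\<beta> (c \<odot>\<^bsub>U\<^esub> u) r = c \<odot>\<^bsub>BK\<^esub> \<beta> u r"
      using ur \<kappa>(1)[of c] by (simp add: \<beta>_def sel \<Phi>D R.m_comm flip: B.smult_assoc1)
    show "\<beta> u (c \<odot>\<^bsub>R\<^esub> r) = c \<odot>\<^bsub>BK\<^esub> \<beta> u r"
      using ur \<kappa>(1)[of c] by (simp add: \<beta>_def sel \<Phi>D \<kappa>r[of r] flip: B.smult_assoc1)
  qed (simp_all add: \<beta>_def sel \<Phi>D B.smult_r_distr B.smult_l_distr)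
  define L where "L = tensor_lift K BK \<beta>"
  have "L \<in> alg_hom K UR.T BK" unfolding L_def
  proof (rule UR.lift_alg_hom[OF BK \<beta>])
    show "\<beta> \<one>\<^bsub>U\<^esub> \<one>\<^bsub>R\<^esub> = \<one>\<^bsub>BK\<^esub>" by (simp add: \<beta>_def sel \<Phi>D)
    fix a b a' b' assume a: "a \<in> carrier U" "b \<in> carrier R" "a' \<in> carrier U" "b' \<in> carrier R"
    then show "\<beta> (a \<otimes>\<^bsub>U\<^esub> a') (b \<otimes>\<^bsub>R\<^esub> b') = \<beta> a b \<otimes>\<^bsub>BK\<^esub> \<beta> a' b'"
      using B.smult_assoc1[of b' b "\<Phi> a \<otimes>\<^bsub>B\<^esub> \<Phi> a'"]
      by (simp add: \<beta>_def sel \<Phi>D B.smult_mult_left B.smult_mult_right R.m_comm[of b b'] flip: B.smult_assoc1)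
  qed
  note LD = alg_homD[OF this, unfolded sel]
  have Lpt: "L (UR.pt u r) = r \<odot>\<^bsub>B\<^esub> \<Phi> u" if "u \<in> carrier U" "r \<in> carrier R" for u r
    using UR.lift_pt[OF BK.module_axioms \<beta> that] by (simp add: L_def \<beta>_def)
  have "L \<in> alg_hom R A B"
  proof (rule alg_homI)
    fix r x assume r: "r \<in> carrier R" and x: "x \<in> carrier A"
    have "L (UR.pt \<one>\<^bsub>U\<^esub> r) = r \<odot>\<^bsub>B\<^esub> \<one>\<^bsub>B\<^esub>" using r by (simp add: Lpt \<Phi>D)
    then show "L (r \<odot>\<^bsub>A\<^esub> x) = r \<odot>\<^bsub>B\<^esub> L x"
      using r x LD(1)[of x] by (simp add: A_sel LD B.smult_mult_left)
  qed (simp_all add: A_sel LD)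
  moreover have "L (G X) = f X" if "X \<in> SL" for X
    using that f[OF that] by (simp add: G_eq Lpt \<Phi>)
  ultimately show ?thesis by blast
qed

end

section \<open>Idempotents of an element with h^p = h\<close>

text \<open>The sum of \<open>(c + 1)^(e + 1) - c^(e + 1)\<close> over c < p telescopes to a power
  of \<open>p\<close>. Its binomial expansion expresses \<open>e + 1\<close> times the wanted sum
  through lower power sums, and \<open>e + 1\<close> is not divisible by \<open>p\<close>.\<close>

lemma prime_dvd_power_sum:
  assumes p: "prime p" and e: "e + 1 < p"
  shows "int p dvd (\<Sum>c<p. int c ^ e)"
  using e
proof (induction e rule: less_induct)
  case (less e)
  let ?S = "\<lambda>i. \<Sum>c<p. int c ^ i"
  have b: "(int c + 1) ^ Suc e - int c ^ Suc e = (\<Sum>i\<le>e. of_nat (Suc e choose i) * int c ^ i)" for c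
    using binomial_ring[of "int c" 1 "Suc e"] by simp
  have "(\<Sum>c<p. int (Suc c) ^ Suc e - int c ^ Suc e) = int p ^ Suc e"
    by (subst sum_lessThan_telescope) simp
  moreover have "(\<Sum>c<p. int (Suc c) ^ Suc e - int c ^ Suc e) =
      (\<Sum>c<p. \<Sum>i\<le>e. of_nat (Suc e choose i) * int c ^ i)"
    using b by (intro sum.cong) (simp_all add: add.commute)
  ultimately have "int p ^ Suc e = (\<Sum>i\<le>e. of_nat (Suc e choose i) * ?S i)"
    by (subst (asm) sum.swap) (simp add: sum_distrib_left)
  also have "\<dots> = (\<Sum>i<e. of_nat (Suc e choose i) * ?S i) + of_nat (Suc e) * ?S e"
    by (simp add: lessThan_Suc_atMost[symmetric])
  finally have eq: "int p ^ Suc e = (\<Sum>i<e. of_nat (Suc e choose i) * ?S i) + of_nat (Suc e) * ?S e" .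
  have "int p dvd (\<Sum>i<e. of_nat (Suc e choose i) * ?S i)"
    by (rule dvd_sum) (use less in \<open>auto intro!: dvd_mult\<close>)
  moreover have "int p dvd int p ^ Suc e" by simp
  ultimately have "int p dvd of_nat (Suc e) * ?S e" unfolding eq by (simp add: dvd_add_right_iff)
  moreover have "\<not> int p dvd of_nat (Suc e)"
    using less(2) by (metis Suc_eq_plus1 int_dvd_int_iff nat_dvd_not_less zero_less_Suc)
  ultimately show ?case using p by (simp add: prime_dvd_mult_iff)
qed

lemma fermat_int_power:
  assumes p: "prime p"
  shows "int p dvd c ^ p - c"
proof -
  have p0: "p > 0" using p by (rule prime_gt_0_nat)
  have nat: "int p dvd int a ^ p - int a" for a
  proof (induction a)
    case 0
    then show ?case using p0 by (simp add: zero_power)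
  next
    case (Suc a)
    have s: "{..p} = insert 0 (insert p {0<..<p})" using p0 by auto
    have "(int a + 1) ^ p = (\<Sum>i\<le>p. of_nat (p choose i) * int a ^ i)"
      using binomial_ring[of "int a" 1 p] by simp
    also have "\<dots> = 1 + int a ^ p + (\<Sum>i\<in>{0<..<p}. of_nat (p choose i) * int a ^ i)"
      unfolding s using p0 by simp
    finally have "int (Suc a) ^ p - int (Suc a) =
        (int a ^ p - int a) + (\<Sum>i\<in>{0<..<p}. of_nat (p choose i) * int a ^ i)"
      by (simp add: add.commute)
    moreover have "int p dvd (\<Sum>i\<in>{0<..<p}. of_nat (p choose i) * int a ^ i)"
      by (rule dvd_sum) (use p in \<open>auto intro!: dvd_mult2 dvd_choose_prime simp: int_dvd_int_iff\<close>)
    ultimately show ?case using Suc by (simp only: dvd_add)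
  qed
  \<comment> \<open>The induction reaches nonnegative bases only, so an arbitrary integer is
    replaced by its residue.\<close>
  define a where "a = nat (c mod int p)"
  have a: "int a = c mod int p" using p0 by (simp add: a_def)
  have "int a ^ p mod int p = int a mod int p" using nat[of a] by (simp add: mod_eq_dvd_iff)
  then have "c ^ p mod int p = c mod int p" unfolding a by (simp add: power_mod)
  then show ?thesis by (simp add: mod_eq_dvd_iff)
qed

lemma fermat_int:
  assumes p: "prime p" and c: "\<not> int p dvd c"
  shows "int p dvd c ^ (p - 1) - 1"
proof -
  have "c ^ p - c = c * (c ^ (p - 1) - 1)"
    using power_minus_mult[OF prime_gt_0_nat[OF p], of c] by (simp add: algebra_simps)
  then have "int p dvd c * (c ^ (p - 1) - 1)" using fermat_int_power[OF p, of c] by simp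
  then show ?thesis using p c by (simp add: prime_dvd_mult_iff)
qed

text \<open>Reading the exponent modulo \<open>p\<close> gives negative powers without inverses. The
  exponent laws hold for elements with \<open>y^p = 1\<close>, to which it is applied.\<close>

definition zpow :: "('a, 'm) ring_scheme \<Rightarrow> nat \<Rightarrow> 'a \<Rightarrow> int \<Rightarrow> 'a" where
  "zpow R p y c = y [^]\<^bsub>R\<^esub> nat (c mod int p)"

text \<open>By Fermat's theorem the polynomial \<open>1 - (a - c)^(p - 1)\<close> is the indicator
  function of the point \<open>c\<close> on the field with \<open>p\<close> elements; here it is
  evaluated at \<open>h\<close>.\<close>

definition idem :: "('a, 'm) ring_scheme \<Rightarrow> nat \<Rightarrow> 'a \<Rightarrow> int \<Rightarrow> 'a" where
  "idem R p h c = \<one>\<^bsub>R\<^esub> \<ominus>\<^bsub>R\<^esub> (h \<ominus>\<^bsub>R\<^esub> [c] \<cdot>\<^bsub>R\<^esub> \<one>\<^bsub>R\<^esub>) [^]\<^bsub>R\<^esub> (p - 1)"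

lemma (in abelian_group) minus_zero_imp_eq:
  assumes "x \<ominus> y = \<zero>" "x \<in> carrier G" "y \<in> carrier G"
  shows "x = y"
proof -
  have "\<ominus> (\<ominus> y) = x" by (rule minus_equality) (use assms in \<open>simp_all add: a_minus_def\<close>)
  then show ?thesis using assms by simp
qed

locale char_p_ring = Ring.ring R for R (structure) +
  fixes p :: nat
  assumes prime: "prime p" and char: "x \<in> carrier R \<Longrightarrow> [p] \<cdot> x = \<zero>"
begin

lemma p_pos: "p > 0"
  using prime by (rule prime_gt_0_nat)

lemma p_gt_1: "p > 1"
  using prime by (rule prime_gt_1_nat)

lemma int_mult_closed [simp]: "x \<in> carrier R \<Longrightarrow> [(c::int)] \<cdot> x \<in> carrier R"
  by (rule add.int_pow_closed)

lemma int_mult_add: "x \<in> carrier R \<Longrightarrow> [(a + b::int)] \<cdot> x = [a] \<cdot> x \<oplus> [b] \<cdot> x"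
  by (rule add.int_pow_mult)

lemma int_mult_neg: "x \<in> carrier R \<Longrightarrow> [(- a::int)] \<cdot> x = \<ominus> ([a] \<cdot> x)"
  by (rule add.int_pow_neg)

lemma int_mult_diff: "x \<in> carrier R \<Longrightarrow> [(a - b::int)] \<cdot> x = [a] \<cdot> x \<ominus> [b] \<cdot> x"
  unfolding a_minus_def by (metis int_mult_add int_mult_neg diff_conv_add_uminus)

lemma int_mult_mult: "x \<in> carrier R \<Longrightarrow> [a] \<cdot> ([(b::int)] \<cdot> x) = [(a * b::int)] \<cdot> x"
  using add.int_pow_pow[of x a b] add.int_pow_pow[of x b a] by (simp add: mult.commute)

lemma int_mult_r_add: "x \<in> carrier R \<Longrightarrow> y \<in> carrier R \<Longrightarrow> [(a::int)] \<cdot> (x \<oplus> y) = [a] \<cdot> x \<oplus> [a] \<cdot> y"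
  by (rule add.int_pow_distrib)

lemma int_mult_r_neg: "x \<in> carrier R \<Longrightarrow> [(a::int)] \<cdot> (\<ominus> x) = \<ominus> ([a] \<cdot> x)"
  by (rule add.int_pow_inv)

lemma int_mult_of_nat: "[int k] \<cdot> x = [k] \<cdot> x"
  by (simp add: add_pow_def int_pow_int)

lemma int_mult_dvd: "int p dvd c \<Longrightarrow> x \<in> carrier R \<Longrightarrow> [c] \<cdot> x = \<zero>"
  by (metis char dvdE int_mult_closed int_mult_mult int_mult_of_nat)

lemma int_mult_cong:
  assumes "int p dvd c - d" and x: "x \<in> carrier R"
  shows "[c] \<cdot> x = [d] \<cdot> x"
proof (rule minus_zero_imp_eq)
  show "[c] \<cdot> x \<ominus> [d] \<cdot> x = \<zero>"
    unfolding int_mult_diff[OF x, symmetric] by (rule int_mult_dvd[OF assms])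
qed (use x in simp_all)

lemma int_mult_one_l: "x \<in> carrier R \<Longrightarrow> ([(c::int)] \<cdot> \<one>) \<otimes> x = [c] \<cdot> x"
  by (simp add: add_pow_ldistr_int)

lemma int_mult_one_r: "x \<in> carrier R \<Longrightarrow> x \<otimes> ([(c::int)] \<cdot> \<one>) = [c] \<cdot> x"
  by (simp add: add_pow_rdistr_int)

lemma int_mult_1 [simp]: "x \<in> carrier R \<Longrightarrow> [(1::int)] \<cdot> x = x"
  by (simp add: add.int_pow_1)

lemma int_mult_0 [simp]: "[(0::int)] \<cdot> x = \<zero>"
  by (simp add: add_pow_def)

lemmas int_mult_simps = int_mult_add int_mult_neg int_mult_diff int_mult_mult int_mult_r_add int_mult_r_neg
  add_pow_ldistr_int add_pow_rdistr_int

lemma int_mult_one_pow: "([(c::int)] \<cdot> \<one>) [^] (k::nat) = [(c ^ k)] \<cdot> \<one>"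
  by (induction k) (simp_all add: add_pow_ldistr_int int_mult_mult int_mult_one_r mult.commute)

lemma finsum_swap:
  assumes "finite S" "finite T" and f: "\<And>i c. f i c \<in> carrier R"
  shows "(\<Oplus>c\<in>S. \<Oplus>i\<in>T. f i c) = (\<Oplus>i\<in>T. \<Oplus>c\<in>S. f i c)"
  using assms(1)
proof (induction S rule: finite_induct)
  case empty
  then show ?case by simp
next
  case (insert c S)
  then have "(\<Oplus>i\<in>T. \<Oplus>c\<in>insert c S. f i c) = (\<Oplus>i\<in>T. f i c \<oplus> (\<Oplus>c\<in>S. f i c))"
    using f by (intro finsum_cong') (auto intro!: finsum_closed)
  also have "\<dots> = (\<Oplus>i\<in>T. f i c) \<oplus> (\<Oplus>i\<in>T. \<Oplus>c\<in>S. f i c)"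
    using f by (intro finsum_addf) (auto intro!: finsum_closed)
  finally show ?case using insert f by (simp add: finsum_closed)
qed

lemma frobenius:
  assumes "x \<in> carrier R" "y \<in> carrier R" "x \<otimes> y = y \<otimes> x"
  shows "(x \<oplus> y) [^] p = x [^] p \<oplus> y [^] p"
  using frobenius_add[OF ring_axioms assms prime char] .

lemma frobenius_minus_one:
  shows "(\<ominus> \<one>) [^] p = \<ominus> \<one>"
proof -
  have "(\<one> \<oplus> \<ominus> \<one>) [^] p = \<one> [^] p \<oplus> (\<ominus> \<one>) [^] p" by (rule frobenius) (simp_all add: l_minus r_minus)
  then have "(\<ominus> \<one>) [^] p \<oplus> \<one> = \<zero>" using p_pos by (simp add: r_neg nat_pow_zero a_comm)
  then show ?thesis by (intro minus_equality[symmetric]) simp_all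
qed

lemma minus_pow_p:
  assumes x: "x \<in> carrier R"
  shows "(\<ominus> x) [^] p = \<ominus> (x [^] p)"
proof -
  have "(\<ominus> x) [^] p = (\<ominus> \<one> \<otimes> x) [^] p" using x by (simp add: l_minus)
  also have "\<dots> = (\<ominus> \<one>) [^] p \<otimes> x [^] p"
    using x by (intro pow_mult_distrib) (simp_all add: l_minus r_minus)
  finally show ?thesis using x by (simp add: frobenius_minus_one l_minus)
qed

lemma frobenius_diff:
  assumes "x \<in> carrier R" "y \<in> carrier R" "x \<otimes> y = y \<otimes> x"
  shows "(x \<ominus> y) [^] p = x [^] p \<ominus> y [^] p"
  using frobenius[of x "\<ominus> y"] assms by (simp add: a_minus_def l_minus r_minus minus_pow_p)

context
  fixes y assumes y: "y \<in> carrier R" and yp: "y [^] p = \<one>"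
begin

abbreviation "Zy \<equiv> zpow R p y"

lemma zpow_closed: "Zy c \<in> carrier R"
  using y by (simp add: zpow_def)

lemma pow_mod: "y [^] (k mod p) = y [^] k"
proof -
  have "y [^] k = y [^] (p * (k div p) + k mod p)" by simp
  also have "\<dots> = (y [^] p) [^] (k div p) \<otimes> y [^] (k mod p)"
    using y by (simp only: nat_pow_pow nat_pow_mult nat_pow_closed)
  finally show ?thesis using y yp by simp
qed

lemma zpow_of_nat: "Zy (int k) = y [^] k"
  by (simp add: zpow_def pow_mod nat_mod_as_int[symmetric] flip: of_nat_mod)

lemma zpow_cong: "int p dvd c - d \<Longrightarrow> Zy c = Zy d"
  unfolding zpow_def by (simp flip: mod_eq_dvd_iff)

lemma zpow_nat_ex: "\<exists>k. int p dvd c - int k \<and> Zy c = y [^] k"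
  using p_pos by (intro exI[of _ "nat (c mod int p)"]) (simp add: zpow_def mod_eq_dvd_iff[symmetric])

lemma zpow_add: "Zy (a + b) = Zy a \<otimes> Zy b"
proof -
  obtain k where k: "int p dvd a - int k" "Zy a = y [^] k" using zpow_nat_ex by blast
  obtain l where l: "int p dvd b - int l" "Zy b = y [^] l" using zpow_nat_ex by blast
  have "int p dvd a + b - int (k + l)" using dvd_add[OF k(1) l(1)] by (simp add: algebra_simps)
  then have "Zy (a + b) = y [^] (k + l)" using zpow_cong[of "a + b" "int (k + l)"] zpow_of_nat[of "k + l"] by simp
  also have "\<dots> = Zy a \<otimes> Zy b" unfolding k(2) l(2) using y by (rule nat_pow_mult[symmetric])
  finally show ?thesis .
qed

lemma zpow_0: "Zy 0 = \<one>" and zpow_1: "Zy 1 = y"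
  using zpow_of_nat[of 0] zpow_of_nat[of 1] y by simp_all

lemma zpow_mult_assoc: "x \<in> carrier R \<Longrightarrow> Zy a \<otimes> (Zy b \<otimes> x) = Zy (a + b) \<otimes> x"
  unfolding zpow_add using zpow_closed by (intro m_assoc[symmetric])

lemma zpow_inverse: "Zy a \<otimes> Zy (- a) = \<one>" "Zy (- a) \<otimes> Zy a = \<one>"
  using zpow_add[of a "- a"] zpow_add[of "- a" a] zpow_0 by simp_all

text \<open>The theorem speaks of integer powers, which rest on inverses of units. This is the link
  to the powers used in all computations.\<close>

lemma zpow_int_pow: "y [^] (c::int) = Zy c"
proof (cases "c < 0")
  case False
  then show ?thesis using zpow_of_nat[of "nat c"] unfolding int_pow_def2 by (simp del: pow_nat)
next
  case True
  have c: "y [^] nat (- c) = Zy (- c)" using zpow_of_nat[of "nat (- c)"] True by (simp del: pow_nat)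
  have "inv (y [^] nat (- c)) = Zy c"
    unfolding c using zpow_inverse[of c] zpow_closed by (intro inv_char)
  then show ?thesis using True unfolding int_pow_def2 by (simp del: pow_nat)
qed

end

end

locale twist_ring = char_p_ring +
  fixes h
  assumes h [simp]: "h \<in> carrier R" and hp: "h [^] p = h"
begin

abbreviation P where "P \<equiv> idem R p h"

abbreviation hc where "hc c \<equiv> h \<ominus> [(c::int)] \<cdot> \<one>"

lemma P_closed [simp]: "P c \<in> carrier R"
  by (simp add: idem_def)

text \<open>The Frobenius identity reduces this to \<open>h [^] p = h\<close> and to Fermat's
  theorem for \<open>c\<close>.\<close>

lemma hc_pow: "hc c [^] p = hc c"
proof -
  have "int p dvd c ^ p - c" by (rule fermat_int_power[OF prime])
  then have "[(c ^ p)] \<cdot> \<one> = [c] \<cdot> \<one>" by (rule int_mult_cong) simp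
  then show ?thesis
    by (subst frobenius_diff) (simp_all add: int_mult_one_l int_mult_one_r int_mult_one_pow hp)
qed

lemma hc_P: "hc c \<otimes> P c = \<zero>"
proof -
  have "hc c \<otimes> hc c [^] (p - 1) = hc c [^] p"
    using p_pos nat_pow_Suc2[of "hc c" "p - 1"] by simp
  then have "hc c \<otimes> (\<one> \<oplus> \<ominus> (hc c [^] (p - 1))) = hc c \<oplus> \<ominus> hc c"
    by (simp add: r_distr r_minus hc_pow)
  then show ?thesis by (simp add: idem_def r_neg a_minus_def[of R \<one>])
qed

lemma h_P: "h \<otimes> P c = [c] \<cdot> P c"
proof -
  have "h \<otimes> P c \<ominus> [c] \<cdot> P c = \<zero>"
    using hc_P[of c] by (simp add: a_minus_def l_distr l_minus int_mult_one_l)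
  then show ?thesis by (rule minus_zero_imp_eq) simp_all
qed

text \<open>\<open>P d\<close> is a polynomial in \<open>h\<close>, so it acts on \<open>P c\<close>
  by its value \<open>1 - (c - d)^(p - 1)\<close> at the eigenvalue \<open>c\<close>, which Fermat's
  theorem determines.\<close>

lemma P_P: "P d \<otimes> P c = (if int p dvd c - d then P c else \<zero>)"
proof -
  have "hc d \<otimes> P c = [(c - d)] \<cdot> P c"
    by (simp add: a_minus_def l_distr l_minus int_mult_one_l h_P int_mult_add int_mult_neg diff_conv_add_uminus del: add_uminus_conv_diff)
  then have *: "hc d [^] k \<otimes> P c = [((c - d) ^ k)] \<cdot> P c" for k :: nat
    by (induction k) (simp_all add: m_assoc add_pow_rdistr_int int_mult_mult)
  have e: "P d \<otimes> P c = P c \<ominus> [((c - d) ^ (p - 1))] \<cdot> P c"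
    unfolding idem_def[of R p h d] using *[of "p - 1"] by (simp add: a_minus_def l_distr l_minus)
  show ?thesis
  proof (cases "int p dvd c - d")
    case True
    then have "int p dvd (c - d) ^ (p - 1)" using p_gt_1 by (intro dvd_trans[OF True dvd_power]) simp
    then show ?thesis using True unfolding e by (simp add: int_mult_dvd a_minus_def)
  next
    case False
    have "[((c - d) ^ (p - 1))] \<cdot> P c = [(1::int)] \<cdot> P c"
      by (rule int_mult_cong) (use fermat_int[OF prime False] in simp_all)
    then show ?thesis using False unfolding e by (simp add: r_neg a_minus_def)
  qed
qed

text \<open>Expand \<open>(h - c)^(p - 1)\<close> and sum over \<open>c\<close>: the coefficient of
  \<open>h^i\<close> is a binomial coefficient times a power sum of exponent
  \<open>p - 1 - i\<close>. These vanish modulo \<open>p\<close> except for \<open>i = 0\<close>,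
  where the sum is -1. Hence the idempotents add up to \<open>p - (-1) = 1\<close>.\<close>

lemma sum_P: "(\<Oplus>c\<in>{..<p}. P (int c)) = \<one>"
proof -
  define f where "f i c = [(int (p - 1 choose i) * (- int c) ^ (p - 1 - i))] \<cdot> (h [^] i)" for i c
  have fc: "f i c \<in> carrier R" for i c by (simp add: f_def)
  have b: "hc (int c) [^] (p - 1) = (\<Oplus>i\<in>{..p - 1}. f i c)" for c
  proof -
    have "hc (int c) [^] (p - 1) =
        (\<Oplus>i\<in>{..p - 1}. [(p - 1 choose i)] \<cdot> (h [^] i \<otimes> ([(- int c)] \<cdot> \<one>) [^] (p - 1 - i)))"
      unfolding a_minus_def int_mult_neg[OF one_closed, symmetric]
      by (rule ring_binomial[OF ring_axioms]) (simp_all add: int_mult_one_l int_mult_one_r)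
    also have "\<dots> = (\<Oplus>i\<in>{..p - 1}. f i c)"
      by (rule finsum_cong')
        (simp_all add: f_def int_mult_one_pow int_mult_one_r int_mult_mult flip: int_mult_of_nat)
    finally show ?thesis .
  qed
  have s: "(\<Oplus>c\<in>S. f i c) = [(\<Sum>c\<in>S. int (p - 1 choose i) * (- int c) ^ (p - 1 - i))] \<cdot> (h [^] i)"
    if "finite S" for i and S :: "nat set"
    using that by (induction S) (simp_all add: fc int_mult_add, simp add: f_def)
  \<comment> \<open>For \<open>i = p - 1\<close> the exponent is zero and the power sum counts
    \<open>p\<close> ones, the term \<open>0^0\<close> included.\<close>
  have z: "(\<Oplus>c\<in>{..<p}. f i c) = \<zero>" if i: "0 < i" "i \<le> p - 1" for i
  proof -
    have "(\<Sum>c<p. (- int c) ^ (p - 1 - i)) = (- 1) ^ (p - 1 - i) * (\<Sum>c<p. int c ^ (p - 1 - i))"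
      unfolding sum_distrib_left by (intro sum.cong) (simp_all add: power_minus[of "int _"])
    then have "int p dvd (\<Sum>c<p. (- int c) ^ (p - 1 - i))"
      using prime_dvd_power_sum[OF prime, of "p - 1 - i"] i p_gt_1 by simp
    then show ?thesis unfolding s[OF finite_lessThan]
      by (intro int_mult_dvd) (simp_all flip: sum_distrib_left)
  qed
  \<comment> \<open>The exponent is now \<open>p - 1\<close>: every nonzero \<open>c\<close>
    contributes 1 by Fermat's theorem, altogether \<open>p - 1\<close>.\<close>
  have o: "(\<Oplus>c\<in>{..<p}. f 0 c) = \<ominus> \<one>"
  proof -
    have "int p dvd (- int c) ^ (p - 1) - (if c = 0 then 0 else 1)" if "c < p" for c
    proof (cases "c = 0")
      case True
      then show ?thesis using p_gt_1 by (simp add: zero_power)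
    next
      case False
      have "\<not> int p dvd - int c" using False that by (simp add: nat_dvd_not_less)
      then show ?thesis using fermat_int[OF prime, of "- int c"] False by simp
    qed
    then have "int p dvd (\<Sum>c<p. (- int c) ^ (p - 1) - (if c = 0 then 0 else 1))"
      by (intro dvd_sum) auto
    moreover have "(\<Sum>c<p. (if c = 0 then 0 else 1 :: int)) = int p - 1"
    proof -
      have "(\<Sum>c<p. (if c = 0 then 0 else 1 :: int)) = (\<Sum>c<p. 1 - (if c = 0 then 1 else 0))"
        by (rule sum.cong) auto
      then show ?thesis using p_pos by (simp add: sum_subtractf)
    qed
    ultimately have d: "int p dvd (\<Sum>c<p. (- int c) ^ (p - 1)) - (int p - 1)"
      by (simp add: sum_subtractf)
    have "(\<Sum>c<p. (- int c) ^ (p - 1)) - (- 1) = ((\<Sum>c<p. (- int c) ^ (p - 1)) - (int p - 1)) + int p"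
      by simp
    with d have "int p dvd (\<Sum>c<p. (- int c) ^ (p - 1)) - (- 1)" by (simp only: dvd_add dvd_refl)
    then have "[(\<Sum>c<p. (- int c) ^ (p - 1))] \<cdot> \<one> = [(- 1 :: int)] \<cdot> \<one>" by (rule int_mult_cong) simp
    then show ?thesis unfolding s[OF finite_lessThan] by (simp add: int_mult_neg)
  qed
  have "(\<Oplus>c\<in>{..<p}. hc (int c) [^] (p - 1)) = (\<Oplus>i\<in>{..p - 1}. \<Oplus>c\<in>{..<p}. f i c)"
    unfolding b using finsum_swap[of "{..<p}" "{..p - 1}" f] fc by simp
  also have "\<dots> = (\<Oplus>i\<in>{..p - 1}. if i = 0 then \<ominus> \<one> else \<zero>)"
    by (rule finsum_cong') (use z o in auto)
  also have "\<dots> = \<ominus> \<one>"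
    using add.finprod_singleton[of 0 "{..p - 1}" "\<lambda>_. \<ominus> \<one>"] by (simp add: eq_commute)
  finally have 1: "(\<Oplus>c\<in>{..<p}. hc (int c) [^] (p - 1)) = \<ominus> \<one>" .
  have "(\<Oplus>c\<in>{..<p}. P (int c)) \<oplus> (\<Oplus>c\<in>{..<p}. hc (int c) [^] (p - 1)) = (\<Oplus>c\<in>{..<p}. \<one>)"
    by (subst finsum_addf[symmetric]) (auto intro!: finsum_cong' simp: idem_def a_minus_def a_assoc l_neg)
  also have "\<dots> = [p] \<cdot> \<one>" by (simp add: add.finprod_const)
  finally have "(\<Oplus>c\<in>{..<p}. P (int c)) \<oplus> \<ominus> \<one> = \<zero>" unfolding 1 char[OF one_closed] .
  then show ?thesis using add.inv_equality[of "\<Oplus>c\<in>{..<p}. P (int c)" "\<ominus> \<one>"] by (simp add: finsum_closed)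
qed

end

section \<open>The Jordanian relation\<close>

text \<open>The shape comes from the recipe for the antipode of a twisted Hopf algebra. Applying the
  undeformed antipode to the second factor of the twist and multiplying gives the sum of
  \<open>P\<^sub>c u\<^sup>c\<close> with u = 1 + n. Moving \<open>n\<close> to the left past the
  idempotents shifts their index, and the resulting binomial coefficients are those of
  \<open>(1 - n)^(- c - 1)\<close>. The argument \<open>y\<close> stays free because the inverse is
  the same expression with \<open>u\<close> in place of \<open>w\<close>.\<close>

definition tw :: "('a, 'm) ring_scheme \<Rightarrow> nat \<Rightarrow> 'a \<Rightarrow> 'a \<Rightarrow> 'a" where
  "tw R p h y = (\<Oplus>\<^bsub>R\<^esub>d\<in>{..<p}. zpow R p y (- int d - 1) \<otimes>\<^bsub>R\<^esub> idem R p h (int d))"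

context twist_ring
begin

text \<open>Orthogonality leaves the one summand whose index is the residue of \<open>d\<close>; by
  \<open>cong\<close> its coefficient may be written with \<open>d\<close> itself.\<close>

lemma finsum_P_r:
  assumes f: "\<And>c. f c \<in> carrier R" and cong: "\<And>c d. int p dvd c - d \<Longrightarrow> f c = f d"
  shows "(\<Oplus>c\<in>{..<p}. f (int c) \<otimes> P (int c)) \<otimes> P d = f d \<otimes> P d"
proof -
  define i where "i = nat (d mod int p)"
  have i: "int i = d mod int p" "i < p" using p_pos by (simp_all add: i_def nat_less_iff)
  have di: "int p dvd d - int c \<longleftrightarrow> i = c" if "c < p" for c
    using that i by (metis mod_eq_dvd_iff mod_pos_pos_trivial of_nat_0_le_iff of_nat_eq_iff of_nat_less_iff)
  have "(\<Oplus>c\<in>{..<p}. f (int c) \<otimes> P (int c)) \<otimes> P d = (\<Oplus>c\<in>{..<p}. f (int c) \<otimes> P (int c) \<otimes> P d)"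
    using f by (intro finsum_ldistr) auto
  also have "\<dots> = (\<Oplus>c\<in>{..<p}. if i = c then f (int c) \<otimes> P d else \<zero>)"
    using f di by (intro finsum_cong') (auto simp: m_assoc P_P)
  also have "\<dots> = f (int i) \<otimes> P d"
    using i f by (intro finsum_singleton) auto
  also have "f (int i) = f d" using i di[of i] by (intro cong) (simp add: dvd_diff_commute)
  finally show ?thesis .
qed

lemma eq_P:
  assumes "X \<in> carrier R" "Y \<in> carrier R" and eq: "\<And>c. X \<otimes> P c = Y \<otimes> P c"
  shows "X = Y"
proof -
  have *: "X = (\<Oplus>c\<in>{..<p}. X \<otimes> P (int c))" if "X \<in> carrier R" for X
    using that sum_P finsum_rdistr[of "{..<p}" X "\<lambda>c. P (int c)"] by simp
  show ?thesis using *[OF assms(1)] *[OF assms(2)] by (simp add: eq)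
qed

definition wt where "wt b X \<longleftrightarrow> X \<in> carrier R \<and> h \<otimes> X = X \<otimes> h \<oplus> [(b::int)] \<cdot> X"

text \<open>The weight relation says that \<open>h - (c + b)\<close> times \<open>X\<close> is
  \<open>X\<close> times \<open>h - c\<close>. This passes to powers and so to the polynomials
  defining the idempotents.\<close>

lemma wt_P:
  assumes "wt b X"
  shows "X \<otimes> P c = P (c + b) \<otimes> X"
proof -
  have X: "X \<in> carrier R" "h \<otimes> X = X \<otimes> h \<oplus> [b] \<cdot> X" using assms by (simp_all add: wt_def)
  have "hc (c + b) \<otimes> X = X \<otimes> hc c"
    using X(1) by (simp add: a_minus_def l_distr r_distr l_minus r_minus int_mult_one_l int_mult_one_r X(2)
      int_mult_add minus_add a_ac r_neg2 r_neg1 r_neg)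
  then have "hc (c + b) [^] k \<otimes> X = X \<otimes> hc c [^] k" for k :: nat
  proof (induction k)
    case (Suc k)
    have "hc (c + b) [^] Suc k \<otimes> X = hc (c + b) [^] k \<otimes> X \<otimes> hc c" using X Suc(2) by (simp add: m_assoc)
    then show ?case using Suc X by (simp add: m_assoc)
  qed (use X in simp)
  then show ?thesis using X unfolding idem_def by (simp add: a_minus_def l_distr r_distr l_minus r_minus)
qed

lemma tw_closed:
  assumes "y \<in> carrier R" "y [^] p = \<one>"
  shows "tw R p h y \<in> carrier R"
  unfolding tw_def using zpow_closed[OF assms] by (intro finsum_closed) auto

lemma tw_P:
  assumes y: "y \<in> carrier R" "y [^] p = \<one>"
  shows "tw R p h y \<otimes> P d = zpow R p y (- d - 1) \<otimes> P d"
  unfolding tw_def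
proof (rule finsum_P_r)
  fix c d assume "int p dvd c - d"
  then show "zpow R p y (- c - 1) = zpow R p y (- d - 1)"
    by (intro zpow_cong[OF y]) (simp add: dvd_diff_commute)
qed (rule zpow_closed[OF y])

end

section \<open>Powers of w = 1 - n when [h, n] = n and n^p = 0\<close>

locale jordan_ring = twist_ring +
  fixes n
  assumes n [simp]: "n \<in> carrier R" and np: "n [^] p = \<zero>" and hn: "h \<otimes> n = n \<otimes> h \<oplus> n"
begin

definition w where "w = \<one> \<ominus> n"
definition u where "u = \<one> \<oplus> n"

lemma wp: "w [^] p = \<one>"
  unfolding w_def by (subst frobenius_diff) (simp_all add: np a_minus_def)

lemma up: "u [^] p = \<one>"
  unfolding u_def by (subst frobenius) (simp_all add: np)

lemma w_closed [simp]: "w \<in> carrier R"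
  by (simp add: w_def)

abbreviation "W \<equiv> zpow R p w"

lemmas W_closed [simp] = zpow_closed[OF w_closed wp]
lemmas W_add = zpow_add[OF w_closed wp]
lemmas W_0 [simp] = zpow_0[OF w_closed wp]
lemmas W_1 = zpow_1[OF w_closed wp]
lemmas W_cong = zpow_cong[OF w_closed wp]
lemmas W_nat_ex = zpow_nat_ex[OF w_closed wp]
lemmas W_assoc = zpow_mult_assoc[OF w_closed wp]

lemma W_W [simp]: "W a \<otimes> W b = W (a + b)"
  by (simp add: W_add)

lemma W_W_assoc [simp]: "x \<in> carrier R \<Longrightarrow> W a \<otimes> (W b \<otimes> x) = W (a + b) \<otimes> x"
  by (rule W_assoc)

lemma w_W: "w \<otimes> W a = W (a + 1)" and W_w: "W a \<otimes> w = W (a + 1)"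
  using W_add[of 1 a] W_add[of a 1] by (simp_all add: W_1 add.commute)

lemma w_W_assoc: "x \<in> carrier R \<Longrightarrow> w \<otimes> (W a \<otimes> x) = W (a + 1) \<otimes> x"
  using w_W[of a] by (simp flip: m_assoc)

lemma w_mult: "x \<in> carrier R \<Longrightarrow> w \<otimes> x = x \<ominus> n \<otimes> x"
  by (simp add: w_def a_minus_def l_distr l_minus)

lemma int_mult_2: "x \<in> carrier R \<Longrightarrow> [(2 * a::int)] \<cdot> x = [a] \<cdot> x \<oplus> [a] \<cdot> x"
  using int_mult_add[of x a a] by simp

lemma w_plus_n: "w \<oplus> n = \<one>"
  by (simp add: w_def a_minus_def a_assoc l_neg)

lemma wt_n: "wt 1 n"
  using hn by (simp add: wt_def)

text \<open>The twisting construction applies to elements \<open>X\<close> of this kind; here \<open>b\<close> is the weight of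
  \<open>X\<close>, \<open>x\<close> is the commutator of \<open>n\<close> with \<open>X\<close> and \<open>- 2 z\<close> that of \<open>n\<close> with \<open>x\<close>.\<close>

definition good :: "int \<Rightarrow> 'a \<Rightarrow> 'a \<Rightarrow> 'a \<Rightarrow> bool" where
  "good b X x z \<longleftrightarrow> wt b X \<and> wt (b + 1) x \<and> wt (b + 2) z \<and>
    n \<otimes> X = X \<otimes> n \<oplus> x \<and> n \<otimes> x = x \<otimes> n \<oplus> [(-2::int)] \<cdot> z \<and> n \<otimes> z = z \<otimes> n"

lemma wt_closed: "wt b X \<Longrightarrow> X \<in> carrier R"
  by (simp add: wt_def)

lemma good_closed: "good b X x z \<Longrightarrow> X \<in> carrier R \<and> x \<in> carrier R \<and> z \<in> carrier R"
  by (simp add: good_def wt_def)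

lemma wt_zero [simp]: "wt b \<zero>"
  by (simp add: wt_def)

lemma wt_int_mult: "wt b X \<Longrightarrow> wt b ([(k::int)] \<cdot> X)"
  by (simp add: wt_def int_mult_simps mult.commute)

lemma wt_minus: "wt b X \<Longrightarrow> wt b (\<ominus> X)"
  by (simp add: wt_def r_minus l_minus minus_add int_mult_r_neg)

lemma good_h: "good 0 h (\<ominus> n) \<zero>"
  unfolding good_def using wt_minus[OF wt_n] by (simp add: wt_def hn l_minus r_minus a_assoc r_neg)

lemma good_n: "good 1 n \<zero> \<zero>"
  unfolding good_def using wt_n by simp

text \<open>Since \<open>z\<close> commutes with \<open>n\<close>, the member \<open>x\<close>
  starts a triple of its own, and so does \<open>z\<close> in the next lemma. Thus every formula
  proved for \<open>X\<close> is available for \<open>x\<close> and \<open>z\<close>.\<close>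

lemma good_x: "good b X x z \<Longrightarrow> good (b + 1) x ([(-2::int)] \<cdot> z) \<zero>"
  unfolding good_def by (auto simp: add.assoc add_pow_ldistr_int add_pow_rdistr_int wt_closed intro: wt_int_mult)

lemma good_z: "good b X x z \<Longrightarrow> good (b + 2) z \<zero> \<zero>"
  unfolding good_def by (auto simp: wt_closed)

lemma good_w:
  assumes "good b X x z"
  shows "w \<otimes> X = X \<otimes> w \<ominus> x" "w \<otimes> x = x \<otimes> w \<oplus> (z \<oplus> z)" "w \<otimes> z = z \<otimes> w"
proof -
  have c: "X \<in> carrier R" "x \<in> carrier R" "z \<in> carrier R" using good_closed[OF assms] by simp_all
  have e: "n \<otimes> X = X \<otimes> n \<oplus> x" "n \<otimes> x = x \<otimes> n \<oplus> [(-2::int)] \<cdot> z" "n \<otimes> z = z \<otimes> n"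
    using assms by (simp_all add: good_def)
  have "[(-2::int)] \<cdot> z = \<ominus> (z \<oplus> z)"
    using c int_mult_add[of z 1 1] int_mult_neg[of z 2] by simp
  note e' = e[unfolded this]
  show "w \<otimes> X = X \<otimes> w \<ominus> x" "w \<otimes> x = x \<otimes> w \<oplus> (z \<oplus> z)" "w \<otimes> z = z \<otimes> w"
    using c by (simp_all add: w_def a_minus_def l_distr r_distr l_minus r_minus e' minus_add a_assoc)
qed

text \<open>This is the binomial formula for ad w: it sends \<open>X\<close> to -x and, applied
  twice, gives -2z, while its third power vanishes on \<open>X\<close>. The factor 2 cancels the
  denominator of \<open>c (c - 1) / 2\<close>, so the formula holds for p = 2 as well.\<close>

lemma W_good_r:
  assumes "good b X x z"
  shows "W c \<otimes> X = X \<otimes> W c \<ominus> [c] \<cdot> (x \<otimes> W (c - 1)) \<ominus> [(c * (c - 1))] \<cdot> (z \<otimes> W (c - 2))"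
proof -
  have c: "X \<in> carrier R" "x \<in> carrier R" "z \<in> carrier R" using good_closed[OF assms] by simp_all
  note g = good_w[OF assms]
  have nat: "W (int k) \<otimes> X = X \<otimes> W (int k) \<ominus> [(int k)] \<cdot> (x \<otimes> W (int k - 1)) \<ominus>
      [(int k * (int k - 1))] \<cdot> (z \<otimes> W (int k - 2))" for k
  proof (induction k)
    case 0
    then show ?case using c by (simp add: a_minus_def)
  next
    case (Suc k)
    let ?k = "int k"
    define m1 where "m1 = X \<otimes> W (?k + 1)"
    define m2 where "m2 = x \<otimes> W ?k"
    define m3 where "m3 = z \<otimes> W (?k - 1)"
    have m: "m1 \<in> carrier R" "m2 \<in> carrier R" "m3 \<in> carrier R" using c by (simp_all add: m1_def m2_def m3_def)
    have 1: "w \<otimes> (X \<otimes> W ?k) = m1 \<ominus> m2"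
      using c by (simp add: m1_def m2_def g m_assoc[symmetric] a_minus_def l_distr l_minus) (simp add: m_assoc w_W flip: a_minus_def)
    have 2: "w \<otimes> (x \<otimes> W (?k - 1)) = m2 \<oplus> (m3 \<oplus> m3)"
      using c by (simp add: m3_def m2_def g m_assoc[symmetric] l_distr) (simp add: m_assoc w_W)
    have 3: "w \<otimes> (z \<otimes> W (?k - 2)) = m3"
      using c by (simp add: m3_def g m_assoc[symmetric]) (simp add: m_assoc w_W)
    have "W (int (Suc k)) \<otimes> X = w \<otimes> (W ?k \<otimes> X)"
      using c by (simp add: w_W_assoc add.commute)
    also have "\<dots> = m1 \<ominus> m2 \<ominus> [?k] \<cdot> (m2 \<oplus> (m3 \<oplus> m3)) \<ominus> [(?k * (?k - 1))] \<cdot> m3"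
      unfolding Suc using c by (simp add: a_minus_def r_distr r_minus add_pow_rdistr_int) (simp add: 1 2 3 a_minus_def)
    also have "\<dots> = m1 \<ominus> [(?k + 1)] \<cdot> m2 \<ominus> [((?k + 1) * ?k)] \<cdot> m3"
    proof -
      have e: "(?k + 1) * ?k = ?k + ?k + ?k * (?k - 1)" by (simp add: algebra_simps)
      show ?thesis unfolding e using m
        by (simp add: int_mult_add int_mult_2 int_mult_r_add a_minus_def minus_add a_ac)
    qed
    finally show ?case by (simp add: m1_def m2_def m3_def add.commute)
  qed
  \<comment> \<open>Powers of \<open>w\<close> and integer multiples depend on \<open>c\<close>
    modulo \<open>p\<close> only, so the case of natural exponents is enough.\<close>
  obtain k where k: "int p dvd c - int k" using W_nat_ex by blast
  have k1: "W c = W (int k)" "W (c - 1) = W (int k - 1)" "W (c - 2) = W (int k - 2)"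
    using k by (auto intro!: W_cong)
  have "c * (c - 1) - int k * (int k - 1) = (c - int k) * (c + int k - 1)" by (simp add: algebra_simps)
  then have k2: "int p dvd c * (c - 1) - int k * (int k - 1)" using k by simp
  show ?thesis unfolding k1 nat using c int_mult_cong[OF k] int_mult_cong[OF k2] by simp
qed

text \<open>The same expansion with the powers of \<open>w\<close> to the left of \<open>x\<close>
  and \<open>z\<close>, the order in which they occur in the coproduct. Moving \<open>x\<close> past
  \<open>W (- 1)\<close> costs \<open>2 z\<close>, which changes the coefficient
  \<open>c (c - 1)\<close> into \<open>c (c + 1)\<close>.\<close>

lemma W_good_l:
  assumes "good b X x z"
  shows "W c \<otimes> X = (X \<ominus> [c] \<cdot> (W (-1) \<otimes> x) \<ominus> [(c * (c + 1))] \<cdot> (W (-2) \<otimes> z)) \<otimes> W c"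
proof -
  have c: "X \<in> carrier R" "x \<in> carrier R" "z \<in> carrier R" using good_closed[OF assms] by simp_all
  have Wz: "z \<otimes> W a = W a \<otimes> z" for a
    using W_good_r[OF good_z[OF assms], of a] c by (simp add: a_minus_def)
  have Wx: "x \<otimes> W a = W a \<otimes> x \<ominus> [(2 * a)] \<cdot> (W (a - 1) \<otimes> z)" for a
  proof -
    have "W a \<otimes> x = x \<otimes> W a \<ominus> [a] \<cdot> ([(-2::int)] \<cdot> z \<otimes> W (a - 1))"
      using W_good_r[OF good_x[OF assms], of a] c by (simp add: a_minus_def)
    also have "[a] \<cdot> ([(-2::int)] \<cdot> z \<otimes> W (a - 1)) = \<ominus> ([(2 * a)] \<cdot> (W (a - 1) \<otimes> z))"
      using c by (simp add: add_pow_ldistr_int int_mult_mult Wz mult.commute flip: int_mult_neg)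
    finally show ?thesis using c by (simp add: a_minus_def a_assoc r_neg)
  qed
  have "W c \<otimes> X = X \<otimes> W c \<ominus> [c] \<cdot> (x \<otimes> W (c - 1)) \<ominus> [(c * (c - 1))] \<cdot> (z \<otimes> W (c - 2))"
    by (rule W_good_r[OF assms])
  also have "x \<otimes> W (c - 1) = (x \<otimes> W (- 1)) \<otimes> W c" using c by (simp add: m_assoc)
  also have "x \<otimes> W (- 1) = W (- 1) \<otimes> x \<oplus> [(2::int)] \<cdot> (W (- 2) \<otimes> z)"
    using Wx[of "- 1"] c int_mult_neg[of "W (- 2) \<otimes> z" 2] by (simp add: a_minus_def)
  also have "z \<otimes> W (c - 2) = (W (- 2) \<otimes> z) \<otimes> W c"
  proof -
    have "z \<otimes> W (c - 2) = z \<otimes> W (- 2) \<otimes> W c" using c by (simp add: m_assoc)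
    then show ?thesis by (simp add: Wz)
  qed
  also have "X \<otimes> W c \<ominus> [c] \<cdot> ((W (- 1) \<otimes> x \<oplus> [(2::int)] \<cdot> (W (- 2) \<otimes> z)) \<otimes> W c) \<ominus>
      [(c * (c - 1))] \<cdot> (W (- 2) \<otimes> z \<otimes> W c) =
      (X \<ominus> [c] \<cdot> (W (-1) \<otimes> x) \<ominus> [(c * (c + 1))] \<cdot> (W (-2) \<otimes> z)) \<otimes> W c"
  proof -
    define m1 where "m1 = W (- 1) \<otimes> x"
    define m2 where "m2 = W (- 2) \<otimes> z"
    have m: "m1 \<in> carrier R" "m2 \<in> carrier R" using c by (simp_all add: m1_def m2_def)
    have e: "c * (c + 1) = c * 2 + c * (c - 1)" by (simp add: algebra_simps)
    show ?thesis unfolding m1_def[symmetric] m2_def[symmetric] e using m c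
      by (simp add: a_minus_def l_distr l_minus add_pow_ldistr_int int_mult_add int_mult_r_add int_mult_mult minus_add a_ac)
  qed
  finally show ?thesis .
qed

text \<open>Because \<open>n = 1 - w\<close>, the element \<open>h\<close> sends
  \<open>W c \<otimes> P d\<close> to \<open>d + c\<close> times itself minus \<open>c\<close> times
  \<open>W (c - 1) \<otimes> P d\<close>. The shift \<open>s\<close> is chosen to cancel the first
  term. Consecutive shifts of \<open>h\<close> thus build up the product \<open>c (c - 1)\<close>
  while lowering the exponent.\<close>

lemma h_W_P:
  assumes "s + d = - c"
  shows "(h \<oplus> [s] \<cdot> \<one>) \<otimes> (W c \<otimes> P d) = [(- c)] \<cdot> (W (c - 1) \<otimes> P d)"
proof -
  have "W c \<otimes> h = h \<otimes> W c \<oplus> [c] \<cdot> (n \<otimes> W (c - 1))"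
    using W_good_r[OF good_h, of c] by (simp add: a_minus_def l_minus int_mult_r_neg)
  then have hW: "h \<otimes> W c = W c \<otimes> h \<ominus> [c] \<cdot> (n \<otimes> W (c - 1))"
    by (simp add: a_minus_def a_assoc r_neg)
  have nW: "n \<otimes> W (c - 1) = W (c - 1) \<ominus> W c"
  proof -
    have "W c = W (c - 1) \<oplus> \<ominus> (n \<otimes> W (c - 1))"
      using w_W[of "c - 1"] w_mult[of "W (c - 1)"] by (simp add: a_minus_def)
    then show ?thesis by (simp add: a_minus_def minus_add a_assoc[symmetric] r_neg)
  qed
  define a where "a = W c \<otimes> P d"
  define a' where "a' = W (c - 1) \<otimes> P d"
  have aa: "a \<in> carrier R" "a' \<in> carrier R" by (simp_all add: a_def a'_def)
  have "h \<otimes> a = h \<otimes> W c \<otimes> P d" by (simp add: a_def m_assoc)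
  also have "\<dots> = [d] \<cdot> a \<ominus> [c] \<cdot> (a' \<ominus> a)"
    unfolding hW nW by (simp add: a_def a'_def a_minus_def l_distr l_minus m_assoc h_P add_pow_rdistr_int add_pow_ldistr_int int_mult_r_add int_mult_r_neg)
  finally have ha: "h \<otimes> a = [d] \<cdot> a \<ominus> [c] \<cdot> (a' \<ominus> a)" .
  have d: "d = - c - s" using assms by simp
  have "(h \<oplus> [s] \<cdot> \<one>) \<otimes> a = [d] \<cdot> a \<ominus> [c] \<cdot> (a' \<ominus> a) \<oplus> [s] \<cdot> a"
    using aa by (simp add: l_distr ha int_mult_one_l)
  also have "\<dots> = [(d + c + s)] \<cdot> a \<oplus> [(- c)] \<cdot> a'"
    using aa by (simp add: int_mult_simps a_minus_def minus_add a_ac)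
  also have "d + c + s = 0" by (simp add: d)
  finally show ?thesis using aa by (simp add: a_def a'_def)
qed

section \<open>Conjugation by the antipode twist\<close>

abbreviation "V \<equiv> tw R p h w"
abbreviation "V' \<equiv> tw R p h u"

lemma u_closed [simp]: "u \<in> carrier R"
  by (simp add: u_def)

lemmas V_closed [simp] = tw_closed[OF w_closed wp]
lemmas V'_closed [simp] = tw_closed[OF u_closed up]
lemmas V_P = tw_P[OF w_closed wp]
lemmas V'_P = tw_P[OF u_closed up]

lemma V_P_assoc: "x \<in> carrier R \<Longrightarrow> V \<otimes> (P d \<otimes> x) = W (- d - 1) \<otimes> (P d \<otimes> x)"
  by (simp add: V_P flip: m_assoc)

text \<open>One more factor \<open>u = 1 + n\<close> adds a term in which \<open>n\<close> raises
  the index of the idempotent by one. The two terms carry consecutive powers of \<open>w\<close> and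
  recombine by \<open>w + n = 1\<close>.\<close>

lemma V_u_pow: "V \<otimes> (u [^] (k::nat) \<otimes> P d) = W (- d - 1 - int k) \<otimes> P d"
proof (induction k arbitrary: d)
  case 0
  then show ?case by (simp add: V_P)
next
  case (Suc k)
  have nP: "n \<otimes> P d = P (d + 1) \<otimes> n" using wt_P[OF wt_n] .
  have e: "- d - 1 - int (Suc k) = - d - 2 - int k" "- (d + 1) - 1 - int k = - d - 2 - int k" by simp_all
  have "V \<otimes> (u [^] Suc k \<otimes> P d) = V \<otimes> (u [^] k \<otimes> P d) \<oplus> V \<otimes> (u [^] k \<otimes> P (d + 1)) \<otimes> n"
    by (simp add: u_def m_assoc l_distr r_distr nP)
  also have "\<dots> = W (- d - 1 - int k) \<otimes> P d \<oplus> W (- d - 2 - int k) \<otimes> n \<otimes> P d"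
    unfolding Suc e by (simp add: m_assoc nP)
  also have "W (- d - 1 - int k) = W (- d - 2 - int k) \<otimes> w"
    unfolding W_w by (rule arg_cong[of _ _ W]) simp
  also have "W (- d - 2 - int k) \<otimes> w \<otimes> P d \<oplus> W (- d - 2 - int k) \<otimes> n \<otimes> P d = W (- d - 2 - int k) \<otimes> P d"
    using w_plus_n by (simp flip: l_distr r_distr)
  finally show ?case unfolding e .
qed

lemma V_V': "V \<otimes> V' = \<one>"
proof (rule eq_P)
  fix d
  obtain k where k: "int p dvd (- d - 1) - int k" "zpow R p u (- d - 1) = u [^] k"
    using zpow_nat_ex[OF u_closed up] by blast
  have "V \<otimes> V' \<otimes> P d = W (- d - 1 - int k) \<otimes> P d"
    by (simp add: m_assoc V'_P k V_u_pow)
  also have "W (- d - 1 - int k) = W 0" using k by (intro W_cong) simp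
  finally show "V \<otimes> V' \<otimes> P d = \<one> \<otimes> P d" by simp
qed simp_all

text \<open>Replacing \<open>n\<close> by its negative preserves all hypotheses and exchanges
  \<open>w\<close> with \<open>u\<close>, so this is the previous identity for the other ring
  element.\<close>

lemma V'_V: "V' \<otimes> V = \<one>"
proof -
  interpret N: jordan_ring R p h "\<ominus> n"
    by unfold_locales (simp_all add: minus_pow_p np hn r_minus l_minus minus_add)
  have "N.w = u" "N.u = w" by (simp_all add: N.w_def N.u_def w_def u_def a_minus_def)
  then show ?thesis using N.V_V' by simp
qed

text \<open>Two ways to order the same conjugate. The first, with the power of \<open>w\<close> on
  the right, combines directly with the coproduct in the antipode axiom; the second is the form of
  the antipode in the theorem. On each idempotent the left side expands by \<open>W_good_r\<close>
  and the right side is evaluated by \<open>h_W_P\<close>.\<close>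

lemma V_good:
  assumes "good b X x z"
  shows "V \<otimes> X = (X \<oplus> h \<otimes> x \<ominus> h \<otimes> (h \<ominus> \<one>) \<otimes> z) \<otimes> W (- b) \<otimes> V" (is "_ = ?B")
    and "V \<otimes> X = W (- b) \<otimes> (X \<oplus> x \<otimes> (h \<oplus> \<one>) \<ominus> z \<otimes> ((h \<oplus> \<one>) \<otimes> (h \<oplus> \<one> \<oplus> \<one>))) \<otimes> V" (is "_ = ?C")
proof -
  have c: "X \<in> carrier R" "x \<in> carrier R" "z \<in> carrier R" using good_closed[OF assms] by simp_all
  have wts: "wt b X" "wt (b + 1) x" "wt (b + 2) z" using assms by (simp_all add: good_def)
  \<comment> \<open>\<open>X\<close> shifts the index of the idempotent by its weight, and on the
    shifted idempotent \<open>V\<close> is an ordinary power of \<open>w\<close>, namely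
    \<open>W c\<close>.\<close>
  have A: "V \<otimes> X \<otimes> P d = (X \<otimes> W c \<ominus> [c] \<cdot> (x \<otimes> W (c - 1)) \<ominus> [(c * (c - 1))] \<cdot> (z \<otimes> W (c - 2))) \<otimes> P d"
    if "c = - b - d - 1" for c d
  proof -
    have e: "- d - b - 1 = c" using that by simp
    have "V \<otimes> X \<otimes> P d = W c \<otimes> X \<otimes> P d"
      using c by (simp add: m_assoc wt_P[OF wts(1)] V_P_assoc e)
    then show ?thesis unfolding W_good_r[OF assms] .
  qed
  \<comment> \<open>Moving \<open>h\<close> and \<open>h - 1\<close> to the right of
    \<open>x\<close> and \<open>z\<close> adds the weights of these elements and produces the
    shifted factors that \<open>h_W_P\<close> handles.\<close>
  have hx: "h \<otimes> x = x \<otimes> (h \<oplus> [(b + 1)] \<cdot> \<one>)" "h \<otimes> z = z \<otimes> (h \<oplus> [(b + 2)] \<cdot> \<one>)"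
    "(h \<ominus> \<one>) \<otimes> z = z \<otimes> (h \<oplus> [(b + 1)] \<cdot> \<one>)"
  proof -
    show "h \<otimes> x = x \<otimes> (h \<oplus> [(b + 1)] \<cdot> \<one>)" "h \<otimes> z = z \<otimes> (h \<oplus> [(b + 2)] \<cdot> \<one>)"
      using wts(2,3) c by (simp_all add: wt_def r_distr int_mult_one_r)
    have e: "b + 2 = b + 1 + 1" by simp
    have "[(b + 2)] \<cdot> z = [(b + 1)] \<cdot> z \<oplus> z" unfolding e using c by (subst int_mult_add) simp_all
    then have "h \<otimes> z = z \<otimes> h \<oplus> ([(b + 1)] \<cdot> z \<oplus> z)"
      using wts(3) by (simp add: wt_def)
    then show "(h \<ominus> \<one>) \<otimes> z = z \<otimes> (h \<oplus> [(b + 1)] \<cdot> \<one>)"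
      using c by (simp add: a_minus_def l_distr l_minus r_distr int_mult_one_r a_assoc r_neg)
  qed
  show "V \<otimes> X = ?B"
  proof (rule eq_P)
    fix d :: int
    \<comment> \<open>The exponent of the power of \<open>w\<close> that
      \<open>W (- b) \<otimes> V\<close> becomes on \<open>P d\<close>. It satisfies (b + 1) + d = -
      c' and (b + 2) + d = - (c' - 1), which are the two conditions for \<open>h_W_P\<close>
      below.\<close>
    define c' where "c' = - b - d - 1"
    let ?wp = "W c' \<otimes> P d"
    have e: "- b + (- d - 1) = c'" by (simp add: c'_def)
    have 1: "h \<otimes> x \<otimes> ?wp = [(- c')] \<cdot> (x \<otimes> (W (c' - 1) \<otimes> P d))"
      unfolding hx using c h_W_P[of "b + 1" d c'] by (simp add: m_assoc c'_def add_pow_rdistr_int)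
    have hx3: "(h \<ominus> \<one>) \<otimes> (z \<otimes> y) = z \<otimes> ((h \<oplus> [(b + 1)] \<cdot> \<one>) \<otimes> y)" if "y \<in> carrier R" for y
    proof -
      have "(h \<ominus> \<one>) \<otimes> (z \<otimes> y) = (h \<ominus> \<one>) \<otimes> z \<otimes> y" using c that by (simp add: m_assoc)
      then show ?thesis unfolding hx(3) using c that by (simp add: m_assoc)
    qed
    have 2: "h \<otimes> (h \<ominus> \<one>) \<otimes> z \<otimes> ?wp = [(c' * (c' - 1))] \<cdot> (z \<otimes> (W (c' - 2) \<otimes> P d))"
    proof -
      have "h \<otimes> (h \<ominus> \<one>) \<otimes> z \<otimes> ?wp = h \<otimes> (z \<otimes> ((h \<oplus> [(b + 1)] \<cdot> \<one>) \<otimes> ?wp))"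
        using c hx3[of ?wp] by (simp add: m_assoc)
      also have "\<dots> = [(- c')] \<cdot> (h \<otimes> z \<otimes> (W (c' - 1) \<otimes> P d))"
        using c h_W_P[of "b + 1" d c'] by (simp add: m_assoc c'_def add_pow_rdistr_int)
      also have "h \<otimes> z \<otimes> (W (c' - 1) \<otimes> P d) = [(- (c' - 1))] \<cdot> (z \<otimes> (W (c' - 2) \<otimes> P d))"
        unfolding hx(2) using c h_W_P[of "b + 2" d "c' - 1"] by (simp add: m_assoc c'_def add_pow_rdistr_int)
      finally show ?thesis using c by (simp add: int_mult_mult algebra_simps)
    qed
    have "?B \<otimes> P d = X \<otimes> ?wp \<oplus> h \<otimes> x \<otimes> ?wp \<ominus> h \<otimes> (h \<ominus> \<one>) \<otimes> z \<otimes> ?wp"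
    proof -
      have "?B \<otimes> P d = (X \<oplus> h \<otimes> x \<ominus> h \<otimes> (h \<ominus> \<one>) \<otimes> z) \<otimes> ?wp"
        using c e by (simp add: m_assoc V_P)
      then show ?thesis using c by (simp add: a_minus_def[of R _ "_ \<otimes> _"] l_distr l_minus)
    qed
    also have "\<dots> = V \<otimes> X \<otimes> P d"
      unfolding 1 2 A[OF c'_def] using c
      by (simp add: a_minus_def l_distr l_minus m_assoc add_pow_ldistr_int int_mult_neg)
    finally show "V \<otimes> X \<otimes> P d = ?B \<otimes> P d" by simp
  qed (use c in simp_all)
  show "V \<otimes> X = ?C"
  proof (rule eq_P)
    fix d :: int
    \<comment> \<open>Now \<open>V\<close> alone meets \<open>P d\<close>, and the two conditions
      for \<open>h_W_P\<close> read 1 + d = - c' and 2 + d = - (c' - 1).\<close>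
    define c' where "c' = - d - 1"
    let ?wp = "W c' \<otimes> P d"
    have h1: "(h \<oplus> \<one>) \<otimes> ?wp = [(- c')] \<cdot> (W (c' - 1) \<otimes> P d)"
      using h_W_P[of 1 d c'] by (simp add: c'_def)
    have 22: "[(2::int)] \<cdot> \<one> = \<one> \<oplus> \<one>" using int_mult_add[of \<one> 1 1] by simp
    have h2: "(h \<oplus> \<one> \<oplus> \<one>) \<otimes> (W (c' - 1) \<otimes> P d) = [(- (c' - 1))] \<cdot> (W (c' - 2) \<otimes> P d)"
      using h_W_P[of 2 d "c' - 1"] unfolding 22 by (simp add: c'_def a_assoc)
    have comm: "(h \<oplus> \<one>) \<otimes> (h \<oplus> \<one> \<oplus> \<one>) = (h \<oplus> \<one> \<oplus> \<one>) \<otimes> (h \<oplus> \<one>)"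
      by (simp add: l_distr r_distr a_ac)
    have 2: "(h \<oplus> \<one>) \<otimes> (h \<oplus> \<one> \<oplus> \<one>) \<otimes> ?wp = [(c' * (c' - 1))] \<cdot> (W (c' - 2) \<otimes> P d)"
    proof -
      have "(h \<oplus> \<one>) \<otimes> (h \<oplus> \<one> \<oplus> \<one>) \<otimes> ?wp = (h \<oplus> \<one> \<oplus> \<one>) \<otimes> ((h \<oplus> \<one>) \<otimes> ?wp)"
        unfolding comm by (rule m_assoc) simp_all
      also have "\<dots> = [(- c')] \<cdot> ([(- (c' - 1))] \<cdot> (W (c' - 2) \<otimes> P d))"
        unfolding h1 h2[symmetric] by (rule add_pow_rdistr_int) simp_all
      finally show ?thesis by (simp add: int_mult_mult algebra_simps)
    qed
    have "?C \<otimes> P d = W (- b) \<otimes> ((X \<oplus> x \<otimes> (h \<oplus> \<one>) \<ominus> z \<otimes> ((h \<oplus> \<one>) \<otimes> (h \<oplus> \<one> \<oplus> \<one>))) \<otimes> ?wp)"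
      using c by (simp add: m_assoc V_P c'_def)
    also have "(X \<oplus> x \<otimes> (h \<oplus> \<one>) \<ominus> z \<otimes> ((h \<oplus> \<one>) \<otimes> (h \<oplus> \<one> \<oplus> \<one>))) \<otimes> ?wp =
        X \<otimes> ?wp \<oplus> x \<otimes> ((h \<oplus> \<one>) \<otimes> ?wp) \<ominus> z \<otimes> ((h \<oplus> \<one>) \<otimes> (h \<oplus> \<one> \<oplus> \<one>) \<otimes> ?wp)"
    proof -
      define k where "k = h \<oplus> \<one>"
      define l where "l = k \<otimes> (h \<oplus> \<one> \<oplus> \<one>)"
      have kl: "k \<in> carrier R" "l \<in> carrier R" by (simp_all add: k_def l_def)
      show ?thesis unfolding k_def[symmetric] l_def[symmetric] using c kl
        by (simp add: a_minus_def[of R _ "_ \<otimes> _"] l_distr l_minus m_assoc)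
    qed
    also have "\<dots> = W c' \<otimes> X \<otimes> P d"
      unfolding h1 2 W_good_r[OF assms] using c
      by (simp add: a_minus_def l_distr l_minus m_assoc add_pow_ldistr_int add_pow_rdistr_int int_mult_neg r_minus)
    also have "W (- b) \<otimes> (W c' \<otimes> X \<otimes> P d) = W (- b + c') \<otimes> X \<otimes> P d"
      using c by (simp add: m_assoc)
    also have "\<dots> = V \<otimes> X \<otimes> P d"
      unfolding W_good_r[OF assms] by (rule A[symmetric]) (simp add: c'_def)
    finally show "V \<otimes> X \<otimes> P d = ?C \<otimes> P d" by simp
  qed (use c in simp_all)
qed

end

section \<open>Homomorphisms between tensor products\<close>

lemma alg_hom_comp:
  "f \<in> alg_hom R A B \<Longrightarrow> g \<in> alg_hom R B C \<Longrightarrow> (\<lambda>x. g (f x)) \<in> alg_hom R A C"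
  by (rule alg_homI) (simp_all add: alg_homD)

lemma alg_hom_id: "(\<lambda>x. x) \<in> alg_hom R A A"
  by (rule alg_homI) simp_all

lemma tensor_map_hom:
  assumes A: "assoc_algebra R A" and B: "assoc_algebra R B" and C: "assoc_algebra R C" and D: "assoc_algebra R D"
    and f: "f \<in> alg_hom R A C" and g: "g \<in> alg_hom R B D"
  shows "tensor_map R C D f g \<in> alg_hom R (tensor R A B) (tensor R C D)"
    and "a \<in> carrier A \<Longrightarrow> b \<in> carrier B \<Longrightarrow>
      tensor_map R C D f g (pure_tensor R A B a b) = pure_tensor R C D (f a) (g b)"
proof -
  interpret AB: two_algebras R A B by (intro two_algebras.intro A B)
  interpret CD: two_algebras R C D by (intro two_algebras.intro C D)
  note fD = alg_homD[OF f] and gD = alg_homD[OF g]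
  have b: "bilin R A B CD.T (\<lambda>a b. CD.pt (f a) (g b))"
    by (rule bilinI) (simp_all add: fD gD)
  show "tensor_map R C D f g \<in> alg_hom R AB.T CD.T"
    unfolding tensor_map_def
    by (rule AB.lift_alg_hom[OF CD.T_algebra b]) (simp_all add: fD gD CD.pt_one)
  show "tensor_map R C D f g (AB.pt a b) = CD.pt (f a) (g b)" if "a \<in> carrier A" "b \<in> carrier B"
    unfolding tensor_map_def by (rule AB.lift_pt[OF CD.T.module_axioms b that])
qed

text \<open>\<open>tensor_assoc\<close> nests one lift in another. Before the outer lift can be
  evaluated, the value of the inner one must be shown bilinear in \<open>X\<close> and
  \<open>c\<close>; that it respects products is then checked on pure tensors, one factor at a
  time.\<close>

lemma tensor_assoc_hom:
  assumes A: "assoc_algebra R A" and B: "assoc_algebra R B" and C: "assoc_algebra R C"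
  shows "tensor_assoc R A B C \<in> alg_hom R (tensor R (tensor R A B) C) (tensor R A (tensor R B C))"
    and "a \<in> carrier A \<Longrightarrow> b \<in> carrier B \<Longrightarrow> c \<in> carrier C \<Longrightarrow>
      tensor_assoc R A B C (pure_tensor R (tensor R A B) C (pure_tensor R A B a b) c) =
      pure_tensor R A (tensor R B C) a (pure_tensor R B C b c)"
proof -
  interpret AB: two_algebras R A B by (intro two_algebras.intro A B)
  interpret BC: two_algebras R B C by (intro two_algebras.intro B C)
  interpret L: two_algebras R AB.T C by (intro two_algebras.intro AB.T_algebra C)
  interpret T: two_algebras R A BC.T by (intro two_algebras.intro BC.T_algebra A)
  define \<gamma> where "\<gamma> c a b = T.pt a (BC.pt b c)" for c a b
  have \<gamma>: "bilin R A B T.T (\<gamma> c)" if "c \<in> carrier C" for c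
    unfolding \<gamma>_def by (rule bilinI) (use that in simp_all)
  define \<beta> where "\<beta> X c = tensor_lift R T.T (\<gamma> c) X" for X c
  note lift = AB.lift_closed[OF T.T.module_axioms \<gamma>, folded \<beta>_def]
    AB.lift_add[OF T.T.module_axioms \<gamma>, folded \<beta>_def]
    AB.lift_smult[OF T.T.module_axioms \<gamma>, folded \<beta>_def]
  have pt: "\<beta> (AB.pt a b) c = T.pt a (BC.pt b c)" if "a \<in> carrier A" "b \<in> carrier B" "c \<in> carrier C" for a b c
    unfolding \<beta>_def using AB.lift_pt[OF T.T.module_axioms \<gamma>] that by (simp add: \<gamma>_def)
  have add: "\<beta> X (c \<oplus>\<^bsub>C\<^esub> c') = \<beta> X c \<oplus>\<^bsub>T.T\<^esub> \<beta> X c'"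
    if "X \<in> carrier AB.T" "c \<in> carrier C" "c' \<in> carrier C" for X c c'
    using that(1)
  proof (induction rule: AB.T_induct)
    case (add X Y)
    then show ?case using that(2,3) by (simp add: lift T.T.a_ac)
  next
    case (pt a b)
    then show ?case using that(2,3) by (simp add: \<open>\<And>c b a. _ \<Longrightarrow> _ \<Longrightarrow> _ \<Longrightarrow> \<beta> (AB.pt a b) c = _\<close>)
  qed
  have smult: "\<beta> X (r \<odot>\<^bsub>C\<^esub> c) = r \<odot>\<^bsub>T.T\<^esub> \<beta> X c"
    if "X \<in> carrier AB.T" "c \<in> carrier C" "r \<in> carrier R" for X c r
    using that(1)
  proof (induction rule: AB.T_induct)
    case (add X Y)
    then show ?case using that(2,3) by (simp add: lift T.T.smult_r_distr)
  next
    case (pt a b)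
    then show ?case using that(2,3) by (simp add: \<open>\<And>c b a. _ \<Longrightarrow> _ \<Longrightarrow> _ \<Longrightarrow> \<beta> (AB.pt a b) c = _\<close>)
  qed
  have mult1: "\<beta> (AB.pt a b \<otimes>\<^bsub>AB.T\<^esub> Y) (c \<otimes>\<^bsub>C\<^esub> c') = \<beta> (AB.pt a b) c \<otimes>\<^bsub>T.T\<^esub> \<beta> Y c'"
    if "a \<in> carrier A" "b \<in> carrier B" "Y \<in> carrier AB.T" "c \<in> carrier C" "c' \<in> carrier C" for a b Y c c'
    using that(3)
  proof (induction rule: AB.T_induct)
    case (add X Y)
    then show ?case using that(1,2,4,5) by (simp add: lift AB.T.r_distr T.T.r_distr)
  next
    case (pt a' b')
    then show ?case using that(1,2,4,5) by (simp add: \<open>\<And>c b a. _ \<Longrightarrow> _ \<Longrightarrow> _ \<Longrightarrow> \<beta> (AB.pt a b) c = _\<close>)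
  qed
  have mult: "\<beta> (X \<otimes>\<^bsub>AB.T\<^esub> Y) (c \<otimes>\<^bsub>C\<^esub> c') = \<beta> X c \<otimes>\<^bsub>T.T\<^esub> \<beta> Y c'"
    if "X \<in> carrier AB.T" "Y \<in> carrier AB.T" "c \<in> carrier C" "c' \<in> carrier C" for X Y c c'
    using that(1)
  proof (induction rule: AB.T_induct)
    case (add X X')
    then show ?case using that(2-4) by (simp add: lift AB.T.l_distr T.T.l_distr)
  next
    case (pt a b)
    then show ?case using that(2-4) mult1 by simp
  qed
  have \<beta>: "bilin R AB.T C T.T \<beta>"
    by (rule bilinI) (simp_all add: lift add smult)
  have eq: "tensor_assoc R A B C = tensor_lift R T.T \<beta>"
    by (simp add: tensor_assoc_def Let_def \<beta>_def[abs_def] \<gamma>_def[abs_def])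
  show "tensor_assoc R A B C \<in> alg_hom R L.T T.T"
    unfolding eq
    by (rule L.lift_alg_hom[OF T.T_algebra \<beta>]) (simp_all add: mult AB.pt_one BC.pt_one T.pt_one pt)
  show "tensor_assoc R A B C (L.pt (AB.pt a b) c) = T.pt a (BC.pt b c)"
    if "a \<in> carrier A" "b \<in> carrier B" "c \<in> carrier C"
    unfolding eq using that by (simp add: L.lift_pt[OF T.T.module_axioms \<beta>] pt)
qed

text \<open>An antipode reverses products. As a homomorphism into the opposite algebra it is
  supplied by the same universal property as the coproduct.\<close>

definition opp :: "('r, 'a, 'm) module_scheme \<Rightarrow> ('r, 'a) module" where
  "opp A = \<lparr>carrier = carrier A, mult = (\<lambda>x y. y \<otimes>\<^bsub>A\<^esub> x), one = one A, zero = zero A, add = add A,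
    smult = module.smult A\<rparr>"

text \<open>Equips the base ring with the scalar action that makes it a target for the
  counit.\<close>

definition self_alg :: "('r, 'm) ring_scheme \<Rightarrow> ('r, 'r) module" where
  "self_alg R = \<lparr>carrier = carrier R, mult = mult R, one = one R, zero = zero R, add = add R, smult = mult R\<rparr>"

lemma opp_sel [simp]:
  "carrier (opp A) = carrier A" "x \<otimes>\<^bsub>opp A\<^esub> y = y \<otimes>\<^bsub>A\<^esub> x" "one (opp A) = one A" "zero (opp A) = zero A"
  "add (opp A) = add A" "module.smult (opp A) = module.smult A"
  by (simp_all add: opp_def)

lemma self_alg_sel [simp]:
  "carrier (self_alg R) = carrier R" "mult (self_alg R) = mult R" "one (self_alg R) = one R"
  "zero (self_alg R) = zero R" "add (self_alg R) = add R" "module.smult (self_alg R) = mult R"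
  by (simp_all add: self_alg_def)

lemma opp_algebra:
  assumes "assoc_algebra R A"
  shows "assoc_algebra R (opp A)"
proof -
  interpret A: assoc_algebra R A by fact
  have ag: "abelian_group (opp A)"
  proof (rule abelian_groupI)
    fix X assume "X \<in> carrier (opp A)"
    then show "\<exists>Y\<in>carrier (opp A). Y \<oplus>\<^bsub>opp A\<^esub> X = \<zero>\<^bsub>opp A\<^esub>"
      by (intro bexI[of _ "\<ominus>\<^bsub>A\<^esub> X"]) (simp_all add: A.l_neg)
  qed (simp_all add: A.a_ac)
  have "Group.monoid (opp A)"
    by (rule monoidI) (simp_all add: A.m_assoc)
  then have "Ring.ring (opp A)"
    by (rule ringI[OF ag]) (simp_all add: A.l_distr A.r_distr)
  moreover have "Module.module R (opp A)"
    by (rule Module.moduleI[OF A.R.is_cring ag])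
      (simp_all add: A.smult_l_distr A.smult_r_distr A.smult_assoc1)
  ultimately show ?thesis
    by (intro assoc_algebra.intro assoc_algebra_axioms.intro) (simp_all add: A.smult_mult_left A.smult_mult_right)
qed

lemma self_alg_algebra:
  assumes "cring R"
  shows "assoc_algebra R (self_alg R)"
proof -
  interpret R: cring R by fact
  have r: "Ring.ring (self_alg R)" by (rule ring_cong[OF R.ring_axioms]) simp_all
  then interpret S: Ring.ring "self_alg R" .
  have "Module.module R (self_alg R)"
    by (rule Module.moduleI[OF R.is_cring S.is_abelian_group])
      (simp_all add: R.l_distr R.r_distr R.m_assoc)
  then show ?thesis
    by (intro assoc_algebra.intro assoc_algebra_axioms.intro r) (simp_all add: R.m_assoc R.m_lcomm)
qed

section \<open>The twisted coproduct and antipode\<close>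

lemma int_mult_hom:
  assumes "abelian_group A" "abelian_group B"
    and "\<And>x. x \<in> carrier A \<Longrightarrow> f x \<in> carrier B"
    and "\<And>x y. x \<in> carrier A \<Longrightarrow> y \<in> carrier A \<Longrightarrow> f (x \<oplus>\<^bsub>A\<^esub> y) = f x \<oplus>\<^bsub>B\<^esub> f y"
    and "x \<in> carrier A"
  shows "f ([(c::int)] \<cdot>\<^bsub>A\<^esub> x) = [c] \<cdot>\<^bsub>B\<^esub> f x"
  unfolding add_pow_def
  by (rule hom_int_pow) (use assms abelian_group.a_group in \<open>auto simp: hom_def\<close>)

lemma add_pow_smult_one:
  assumes "assoc_algebra R A" "x \<in> carrier A"
  shows "[(k::nat)] \<cdot>\<^bsub>A\<^esub> x = ([k] \<cdot>\<^bsub>R\<^esub> \<one>\<^bsub>R\<^esub>) \<odot>\<^bsub>A\<^esub> x"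
proof -
  interpret assoc_algebra R A by fact
  show ?thesis
    by (induction k) (use assms(2) in \<open>simp_all add: smult_l_distr\<close>)
qed

text \<open>The undeformed maps enter only as algebra homomorphisms, with the antipode landing in
  the opposite algebra. Their values on generators are recorded by \<open>prim\<close>.\<close>

locale jordan_hopf = A: assoc_algebra R A + J: jordan_ring A p h n
  for R (structure) and A and p and h and n +
  fixes D0 S0 e0
  assumes D0: "D0 \<in> alg_hom R A (tensor R A A)"
    and S0: "S0 \<in> alg_hom R A (opp A)"
    and e0: "e0 \<in> alg_hom R A (self_alg R)"
begin

definition prim where
  "prim x \<longleftrightarrow> x \<in> carrier A \<and>
    D0 x = pure_tensor R A A x \<one>\<^bsub>A\<^esub> \<oplus>\<^bsub>tensor R A A\<^esub> pure_tensor R A A \<one>\<^bsub>A\<^esub> x \<and>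
    S0 x = \<ominus>\<^bsub>A\<^esub> x \<and> e0 x = \<zero>\<^bsub>R\<^esub>"

sublocale T2: two_algebras R A A
  by (intro two_algebras.intro A.assoc_algebra_axioms)

sublocale T3: two_algebras R A T2.T
  by (intro two_algebras.intro A.assoc_algebra_axioms T2.T_algebra)

abbreviation "T \<equiv> tensor R A A"
abbreviation "pt \<equiv> pure_tensor R A A"
abbreviation "W \<equiv> J.W"
abbreviation "w \<equiv> J.w"
abbreviation "P \<equiv> J.P"

lemma pt_int_l: "a \<in> carrier A \<Longrightarrow> b \<in> carrier A \<Longrightarrow> pt ([(c::int)] \<cdot>\<^bsub>A\<^esub> a) b = [c] \<cdot>\<^bsub>T\<^esub> pt a b"
  by (rule int_mult_hom[of A T "\<lambda>a. pt a b"]) (simp_all add: A.is_abelian_group T2.T.is_abelian_group)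

lemma pt_int_r: "a \<in> carrier A \<Longrightarrow> b \<in> carrier A \<Longrightarrow> pt a ([(c::int)] \<cdot>\<^bsub>A\<^esub> b) = [c] \<cdot>\<^bsub>T\<^esub> pt a b"
  by (rule int_mult_hom[of A T "\<lambda>b. pt a b"]) (simp_all add: A.is_abelian_group T2.T.is_abelian_group)

lemma pt_hom_l: "(\<lambda>a. pt a \<one>\<^bsub>A\<^esub>) \<in> alg_hom R A T"
  by (rule alg_homI) (simp_all add: T2.pt_one)

lemmas pt_pow_l = alg_hom_pow[OF A.ring_axioms T2.T.ring_axioms pt_hom_l]

lemma T_char:
  assumes "X \<in> carrier T"
  shows "[p] \<cdot>\<^bsub>T\<^esub> X = \<zero>\<^bsub>T\<^esub>"
proof -
  have i: "[int p] \<cdot>\<^bsub>T\<^esub> X = [p] \<cdot>\<^bsub>T\<^esub> X" for X by (simp add: add_pow_def int_pow_int)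
  have "[int p] \<cdot>\<^bsub>T\<^esub> X = \<zero>\<^bsub>T\<^esub>"
    using assms
  proof (induction rule: T2.T_induct)
    case (add X Y)
    then show ?case by (simp add: T2.T.add.int_pow_distrib)
  next
    case (pt a b)
    then show ?case by (simp add: pt_int_l[symmetric] J.int_mult_dvd)
  qed
  then show ?thesis unfolding i .
qed

text \<open>The element \<open>h \<otimes> 1\<close> satisfies the same equation as
  \<open>h\<close>, so the comparison along idempotents also works in the tensor square, with the
  idempotents \<open>P c \<otimes> 1\<close>.\<close>

sublocale TT: twist_ring T p "pt h \<one>\<^bsub>A\<^esub>"
  by unfold_locales (simp_all add: J.prime T_char J.hp flip: pt_pow_l)

lemma P_pt: "TT.P c = pt (P c) \<one>\<^bsub>A\<^esub>"
proof -
  note m = alg_hom_minus[OF A.ring_axioms T2.T.ring_axioms pt_hom_l]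
  have "pt (J.hc c) \<one>\<^bsub>A\<^esub> = TT.hc c"
    by (simp add: a_minus_def pt_int_l T2.pt_one)
  then have "pt (J.hc c [^]\<^bsub>A\<^esub> (p - 1)) \<one>\<^bsub>A\<^esub> = TT.hc c [^]\<^bsub>T\<^esub> (p - 1)"
    by (simp add: pt_pow_l)
  then show ?thesis unfolding idem_def a_minus_def[of _ "\<one>\<^bsub>_\<^esub>"]
    by (simp add: T2.pt_one)
qed

lemma T_eq_P:
  assumes "X \<in> carrier T" "Y \<in> carrier T" and "\<And>d. X \<otimes>\<^bsub>T\<^esub> pt (P d) \<one>\<^bsub>A\<^esub> = Y \<otimes>\<^bsub>T\<^esub> pt (P d) \<one>\<^bsub>A\<^esub>"
  shows "X = Y"
  by (rule TT.eq_P) (use assms in \<open>simp_all add: P_pt\<close>)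

definition "F = (\<Oplus>\<^bsub>T\<^esub>d\<in>{..<p}. pt \<one>\<^bsub>A\<^esub> (W (int d)) \<otimes>\<^bsub>T\<^esub> TT.P (int d))"
definition "F' = (\<Oplus>\<^bsub>T\<^esub>d\<in>{..<p}. pt \<one>\<^bsub>A\<^esub> (W (- int d)) \<otimes>\<^bsub>T\<^esub> TT.P (int d))"

lemma F_closed [simp]: "F \<in> carrier T" and F'_closed [simp]: "F' \<in> carrier T"
  unfolding F_def F'_def by (intro T2.T.finsum_closed; simp)+

lemma F_P: "F \<otimes>\<^bsub>T\<^esub> pt (P d) \<one>\<^bsub>A\<^esub> = pt (P d) (W d)"
proof -
  have "F \<otimes>\<^bsub>T\<^esub> TT.P d = pt \<one>\<^bsub>A\<^esub> (W d) \<otimes>\<^bsub>T\<^esub> TT.P d"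
    unfolding F_def by (rule TT.finsum_P_r) (simp_all add: J.W_cong[of _ d] cong: J.W_cong)
  then show ?thesis by (simp add: P_pt)
qed

lemma F'_P: "F' \<otimes>\<^bsub>T\<^esub> pt (P d) \<one>\<^bsub>A\<^esub> = pt (P d) (W (- d))"
proof -
  have "F' \<otimes>\<^bsub>T\<^esub> TT.P d = pt \<one>\<^bsub>A\<^esub> (W (- d)) \<otimes>\<^bsub>T\<^esub> TT.P d"
    unfolding F'_def
  proof (rule TT.finsum_P_r)
    fix c d assume "int p dvd c - d"
    then have "W (- c) = W (- d)" by (intro J.W_cong) (simp add: dvd_diff_commute)
    then show "pt \<one>\<^bsub>A\<^esub> (W (- c)) = pt \<one>\<^bsub>A\<^esub> (W (- d))" by simp
  qed simp
  then show ?thesis by (simp add: P_pt)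
qed

lemma F_P_b: "b \<in> carrier A \<Longrightarrow> F \<otimes>\<^bsub>T\<^esub> pt (P d) b = pt (P d) (W d \<otimes>\<^bsub>A\<^esub> b)"
  using arg_cong[OF F_P[of d], of "\<lambda>X. X \<otimes>\<^bsub>T\<^esub> pt \<one>\<^bsub>A\<^esub> b"] by (simp add: T2.T.m_assoc)

lemma F'_P_b: "b \<in> carrier A \<Longrightarrow> F' \<otimes>\<^bsub>T\<^esub> pt (P d) b = pt (P d) (W (- d) \<otimes>\<^bsub>A\<^esub> b)"
  using arg_cong[OF F'_P[of d], of "\<lambda>X. X \<otimes>\<^bsub>T\<^esub> pt \<one>\<^bsub>A\<^esub> b"] by (simp add: T2.T.m_assoc)

lemma F_F': "F \<otimes>\<^bsub>T\<^esub> F' = \<one>\<^bsub>T\<^esub>"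
  by (rule T_eq_P) (simp_all add: T2.T.m_assoc F'_P F_P_b)

lemma F'_F: "F' \<otimes>\<^bsub>T\<^esub> F = \<one>\<^bsub>T\<^esub>"
  by (rule T_eq_P) (simp_all add: T2.T.m_assoc F_P F'_P_b)

definition "\<Delta> x = F \<otimes>\<^bsub>T\<^esub> D0 x \<otimes>\<^bsub>T\<^esub> F'"
definition "S x = J.V \<otimes>\<^bsub>A\<^esub> S0 x \<otimes>\<^bsub>A\<^esub> J.V'"

lemma \<Delta>_hom: "\<Delta> \<in> alg_hom R A T"
proof (rule alg_homI)
  note D = alg_homD[OF D0]
  fix x y assume x: "x \<in> carrier A" and y: "y \<in> carrier A"
  have "F' \<otimes>\<^bsub>T\<^esub> (F \<otimes>\<^bsub>T\<^esub> z) = z" if "z \<in> carrier T" for z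
    using that F'_F by (simp flip: T2.T.m_assoc)
  then show "\<Delta> (x \<otimes>\<^bsub>A\<^esub> y) = \<Delta> x \<otimes>\<^bsub>T\<^esub> \<Delta> y"
    using x y D by (simp add: \<Delta>_def T2.T.m_assoc)
next
  show "\<Delta> \<one>\<^bsub>A\<^esub> = \<one>\<^bsub>T\<^esub>" using F_F' by (simp add: \<Delta>_def alg_homD(4)[OF D0])
qed (simp_all add: \<Delta>_def alg_homD[OF D0] T2.T.l_distr T2.T.r_distr T2.T.smult_mult_left T2.T.smult_mult_right)

lemma S_hom: "S \<in> alg_hom R A (opp A)"
proof (rule alg_homI)
  note D = alg_homD[OF S0, simplified]
  fix x y assume x: "x \<in> carrier A" and y: "y \<in> carrier A"
  have "J.V' \<otimes>\<^bsub>A\<^esub> (J.V \<otimes>\<^bsub>A\<^esub> z) = z" if "z \<in> carrier A" for z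
    using that J.V'_V by (simp flip: A.m_assoc)
  then show "S (x \<otimes>\<^bsub>A\<^esub> y) = S x \<otimes>\<^bsub>opp A\<^esub> S y"
    using x y D by (simp add: S_def A.m_assoc)
next
  show "S \<one>\<^bsub>A\<^esub> = \<one>\<^bsub>opp A\<^esub>" using J.V_V' alg_homD(4)[OF S0] by (simp add: S_def)
qed (use alg_homD[OF S0, simplified] in \<open>simp_all add: S_def A.l_distr A.r_distr A.smult_mult_left A.smult_mult_right\<close>)

lemmas \<Delta>D [simp] = alg_homD[OF \<Delta>_hom]
lemmas SD [simp] = alg_homD[OF S_hom, simplified]
lemmas eD [simp] = alg_homD[OF e0, simplified]

lemma \<Delta>_minus [simp]: "x \<in> carrier A \<Longrightarrow> \<Delta> (\<ominus>\<^bsub>A\<^esub> x) = \<ominus>\<^bsub>T\<^esub> \<Delta> x"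
  by (rule alg_hom_minus[OF A.ring_axioms T2.T.ring_axioms \<Delta>_hom])

lemma \<Delta>_zero [simp]: "\<Delta> \<zero>\<^bsub>A\<^esub> = \<zero>\<^bsub>T\<^esub>"
  by (rule alg_hom_zero[OF A.ring_axioms T2.T.ring_axioms \<Delta>_hom])

definition good where
  "good b X x z \<longleftrightarrow> J.good b X x z \<and> prim X \<and> prim x \<and> prim z"

lemma good_closed: "good b X x z \<Longrightarrow> X \<in> carrier A \<and> x \<in> carrier A \<and> z \<in> carrier A"
  by (simp add: good_def prim_def)

abbreviation "h2 \<equiv> h \<otimes>\<^bsub>A\<^esub> (h \<oplus>\<^bsub>A\<^esub> \<one>\<^bsub>A\<^esub>)"

lemma h2_P: "h2 \<otimes>\<^bsub>A\<^esub> P d = [(d * (d + 1))] \<cdot>\<^bsub>A\<^esub> P d"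
proof -
  have "(h \<oplus>\<^bsub>A\<^esub> \<one>\<^bsub>A\<^esub>) \<otimes>\<^bsub>A\<^esub> P d = [(d + 1)] \<cdot>\<^bsub>A\<^esub> P d"
    by (simp add: A.l_distr J.h_P J.int_mult_add)
  then show ?thesis
    by (simp add: A.m_assoc J.h_P A.add_pow_rdistr_int J.int_mult_mult mult.commute)
qed

text \<open>On \<open>P d \<otimes> 1\<close> the twist is \<open>w^d\<close> in the second factor.
  For \<open>X \<otimes> 1\<close> the weight of \<open>X\<close> raises \<open>d\<close> to
  \<open>d + b\<close>, hence the factor \<open>W b\<close>. For \<open>1 \<otimes> X\<close>,
  moving \<open>w^d\<close> past \<open>X\<close> by \<open>W_good_l\<close> produces the
  coefficients \<open>d\<close> and \<open>d (d + 1)\<close>, and these are the eigenvalues of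
  \<open>h\<close> and \<open>h2\<close> on \<open>P d\<close>.\<close>

lemma \<Delta>_good:
  assumes g: "good b X x z"
  shows "\<Delta> X = pt X (W b) \<oplus>\<^bsub>T\<^esub> pt \<one>\<^bsub>A\<^esub> X \<ominus>\<^bsub>T\<^esub> pt h (W (- 1) \<otimes>\<^bsub>A\<^esub> x) \<ominus>\<^bsub>T\<^esub> pt h2 (W (- 2) \<otimes>\<^bsub>A\<^esub> z)"
    (is "_ = ?B")
proof -
  have c: "X \<in> carrier A" "x \<in> carrier A" "z \<in> carrier A" using good_closed[OF g] by simp_all
  have D: "D0 X = pt X \<one>\<^bsub>A\<^esub> \<oplus>\<^bsub>T\<^esub> pt \<one>\<^bsub>A\<^esub> X" using g by (simp add: good_def prim_def)
  have wt: "J.wt b X" using g by (simp add: good_def J.good_def)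
  have "F \<otimes>\<^bsub>T\<^esub> D0 X = ?B \<otimes>\<^bsub>T\<^esub> F"
  proof (rule T_eq_P)
    fix d
    define q1 where "q1 = pt (P d) (W (- 1) \<otimes>\<^bsub>A\<^esub> x \<otimes>\<^bsub>A\<^esub> W d)"
    define q2 where "q2 = pt (P d) (W (- 2) \<otimes>\<^bsub>A\<^esub> z \<otimes>\<^bsub>A\<^esub> W d)"
    have q: "q1 \<in> carrier T" "q2 \<in> carrier T" using c by (simp_all add: q1_def q2_def)
    have 1: "F \<otimes>\<^bsub>T\<^esub> pt X \<one>\<^bsub>A\<^esub> \<otimes>\<^bsub>T\<^esub> pt (P d) \<one>\<^bsub>A\<^esub> = pt (X \<otimes>\<^bsub>A\<^esub> P d) (W (b + d))"
    proof -
      have "F \<otimes>\<^bsub>T\<^esub> pt X \<one>\<^bsub>A\<^esub> \<otimes>\<^bsub>T\<^esub> pt (P d) \<one>\<^bsub>A\<^esub> = F \<otimes>\<^bsub>T\<^esub> pt (P (d + b) \<otimes>\<^bsub>A\<^esub> X) \<one>\<^bsub>A\<^esub>"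
        using c by (simp add: T2.T.m_assoc J.wt_P[OF wt])
      also have "\<dots> = F \<otimes>\<^bsub>T\<^esub> pt (P (d + b)) \<one>\<^bsub>A\<^esub> \<otimes>\<^bsub>T\<^esub> pt X \<one>\<^bsub>A\<^esub>"
        using c by (simp add: T2.T.m_assoc)
      also have "\<dots> = pt (P (d + b) \<otimes>\<^bsub>A\<^esub> X) (W (b + d))"
        unfolding F_P using c by (simp add: add.commute)
      finally show ?thesis by (simp add: J.wt_P[OF wt])
    qed
    have 2: "F \<otimes>\<^bsub>T\<^esub> pt \<one>\<^bsub>A\<^esub> X \<otimes>\<^bsub>T\<^esub> pt (P d) \<one>\<^bsub>A\<^esub> =
        pt (P d) (X \<otimes>\<^bsub>A\<^esub> W d) \<ominus>\<^bsub>T\<^esub> [d] \<cdot>\<^bsub>T\<^esub> q1 \<ominus>\<^bsub>T\<^esub> [(d * (d + 1))] \<cdot>\<^bsub>T\<^esub> q2"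
    proof -
      have Jg: "J.good b X x z" using g by (simp add: good_def)
      have "F \<otimes>\<^bsub>T\<^esub> pt \<one>\<^bsub>A\<^esub> X \<otimes>\<^bsub>T\<^esub> pt (P d) \<one>\<^bsub>A\<^esub> = pt (P d) (W d \<otimes>\<^bsub>A\<^esub> X)"
        using c by (simp add: T2.T.m_assoc F_P_b)
      then show ?thesis unfolding J.W_good_l[OF Jg] q1_def q2_def using c
        by (simp add: a_minus_def A.l_distr A.l_minus A.add_pow_ldistr_int pt_int_r[symmetric])
    qed
    have "?B \<otimes>\<^bsub>T\<^esub> F \<otimes>\<^bsub>T\<^esub> pt (P d) \<one>\<^bsub>A\<^esub> = ?B \<otimes>\<^bsub>T\<^esub> pt (P d) (W d)"
      using c by (simp add: T2.T.m_assoc F_P)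
    also have "\<dots> = pt (X \<otimes>\<^bsub>A\<^esub> P d) (W (b + d)) \<oplus>\<^bsub>T\<^esub> pt (P d) (X \<otimes>\<^bsub>A\<^esub> W d) \<ominus>\<^bsub>T\<^esub>
        pt (h \<otimes>\<^bsub>A\<^esub> P d) (W (- 1) \<otimes>\<^bsub>A\<^esub> x \<otimes>\<^bsub>A\<^esub> W d) \<ominus>\<^bsub>T\<^esub> pt (h2 \<otimes>\<^bsub>A\<^esub> P d) (W (- 2) \<otimes>\<^bsub>A\<^esub> z \<otimes>\<^bsub>A\<^esub> W d)"
      using c by (simp add: a_minus_def T2.T.l_distr T2.T.l_minus)
    also have "\<dots> = pt (X \<otimes>\<^bsub>A\<^esub> P d) (W (b + d)) \<oplus>\<^bsub>T\<^esub> pt (P d) (X \<otimes>\<^bsub>A\<^esub> W d) \<ominus>\<^bsub>T\<^esub>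
        [d] \<cdot>\<^bsub>T\<^esub> q1 \<ominus>\<^bsub>T\<^esub> [(d * (d + 1))] \<cdot>\<^bsub>T\<^esub> q2"
      unfolding h2_P J.h_P q1_def q2_def using c by (simp add: pt_int_l)
    also have "\<dots> = F \<otimes>\<^bsub>T\<^esub> D0 X \<otimes>\<^bsub>T\<^esub> pt (P d) \<one>\<^bsub>A\<^esub>"
      unfolding D using c q by (simp add: T2.T.r_distr T2.T.l_distr 1 2) (simp add: a_minus_def T2.T.a_assoc)
    finally show "F \<otimes>\<^bsub>T\<^esub> D0 X \<otimes>\<^bsub>T\<^esub> pt (P d) \<one>\<^bsub>A\<^esub> = ?B \<otimes>\<^bsub>T\<^esub> F \<otimes>\<^bsub>T\<^esub> pt (P d) \<one>\<^bsub>A\<^esub>" by simp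
  qed (use c D in simp_all)
  then show ?thesis
    unfolding \<Delta>_def using c by (simp add: T2.T.m_assoc F_F')
qed

lemma S_good:
  assumes g: "good b X x z"
  shows "S X = \<ominus>\<^bsub>A\<^esub> ((X \<oplus>\<^bsub>A\<^esub> h \<otimes>\<^bsub>A\<^esub> x \<ominus>\<^bsub>A\<^esub> h \<otimes>\<^bsub>A\<^esub> (h \<ominus>\<^bsub>A\<^esub> \<one>\<^bsub>A\<^esub>) \<otimes>\<^bsub>A\<^esub> z) \<otimes>\<^bsub>A\<^esub> W (- b))"
    and "S X = \<ominus>\<^bsub>A\<^esub> (W (- b) \<otimes>\<^bsub>A\<^esub> (X \<oplus>\<^bsub>A\<^esub> x \<otimes>\<^bsub>A\<^esub> (h \<oplus>\<^bsub>A\<^esub> \<one>\<^bsub>A\<^esub>) \<ominus>\<^bsub>A\<^esub>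
      z \<otimes>\<^bsub>A\<^esub> ((h \<oplus>\<^bsub>A\<^esub> \<one>\<^bsub>A\<^esub>) \<otimes>\<^bsub>A\<^esub> (h \<oplus>\<^bsub>A\<^esub> \<one>\<^bsub>A\<^esub> \<oplus>\<^bsub>A\<^esub> \<one>\<^bsub>A\<^esub>))))"
proof -
  have c: "X \<in> carrier A" "x \<in> carrier A" "z \<in> carrier A" using good_closed[OF g] by simp_all
  have Jg: "J.good b X x z" using g by (simp add: good_def)
  have S: "S X = \<ominus>\<^bsub>A\<^esub> (J.V \<otimes>\<^bsub>A\<^esub> X \<otimes>\<^bsub>A\<^esub> J.V')"
    using g c by (simp add: S_def good_def prim_def A.l_minus A.r_minus)
  have VV: "Y \<otimes>\<^bsub>A\<^esub> J.V \<otimes>\<^bsub>A\<^esub> J.V' = Y" if "Y \<in> carrier A" for Y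
    using that J.V_V' by (simp add: A.m_assoc)
  show "S X = \<ominus>\<^bsub>A\<^esub> ((X \<oplus>\<^bsub>A\<^esub> h \<otimes>\<^bsub>A\<^esub> x \<ominus>\<^bsub>A\<^esub> h \<otimes>\<^bsub>A\<^esub> (h \<ominus>\<^bsub>A\<^esub> \<one>\<^bsub>A\<^esub>) \<otimes>\<^bsub>A\<^esub> z) \<otimes>\<^bsub>A\<^esub> W (- b))"
    unfolding S J.V_good(1)[OF Jg] by (subst VV) (use c in simp_all)
  show "S X = \<ominus>\<^bsub>A\<^esub> (W (- b) \<otimes>\<^bsub>A\<^esub> (X \<oplus>\<^bsub>A\<^esub> x \<otimes>\<^bsub>A\<^esub> (h \<oplus>\<^bsub>A\<^esub> \<one>\<^bsub>A\<^esub>) \<ominus>\<^bsub>A\<^esub>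
      z \<otimes>\<^bsub>A\<^esub> ((h \<oplus>\<^bsub>A\<^esub> \<one>\<^bsub>A\<^esub>) \<otimes>\<^bsub>A\<^esub> (h \<oplus>\<^bsub>A\<^esub> \<one>\<^bsub>A\<^esub> \<oplus>\<^bsub>A\<^esub> \<one>\<^bsub>A\<^esub>))))"
    unfolding S J.V_good(2)[OF Jg] by (subst VV) (use c in simp_all)
qed

end

section \<open>The Hopf axioms\<close>

lemma (in abelian_group) add_lcancel:
  assumes "x \<in> carrier G" "y \<in> carrier G" "z \<in> carrier G"
  shows "x \<oplus> (y \<oplus> (\<ominus> x \<oplus> z)) = y \<oplus> z"
  using assms by (simp add: a_lcomm[of y "\<ominus> x" z] r_neg2)

text \<open>\<open>gen_induct\<close> expresses that the elements \<open>X\<close> of the triples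
  generate \<open>A\<close> over \<open>R\<close>.\<close>

locale jordan_hopf_gen = jordan_hopf +
  assumes prim_h: "prim h" and prim_n: "prim n"
    and gen_induct: "\<And>Q x. \<lbrakk>x \<in> carrier A; Q \<one>\<^bsub>A\<^esub>; \<And>b X x z. good b X x z \<Longrightarrow> Q X;
      \<And>x y. \<lbrakk>x \<in> carrier A; y \<in> carrier A; Q x; Q y\<rbrakk> \<Longrightarrow> Q (x \<oplus>\<^bsub>A\<^esub> y);
      \<And>x y. \<lbrakk>x \<in> carrier A; y \<in> carrier A; Q x; Q y\<rbrakk> \<Longrightarrow> Q (x \<otimes>\<^bsub>A\<^esub> y);
      \<And>r x. \<lbrakk>r \<in> carrier R; x \<in> carrier A; Q x\<rbrakk> \<Longrightarrow> Q (r \<odot>\<^bsub>A\<^esub> x)\<rbrakk> \<Longrightarrow> Q x"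
begin

lemma prim_zero: "prim \<zero>\<^bsub>A\<^esub>"
proof -
  interpret O: assoc_algebra R "opp A" by (rule opp_algebra[OF A.assoc_algebra_axioms])
  interpret E: assoc_algebra R "self_alg R" by (rule self_alg_algebra[OF A.R.is_cring])
  show ?thesis
    using alg_hom_zero[OF A.ring_axioms T2.T.ring_axioms D0] alg_hom_zero[OF A.ring_axioms O.ring_axioms S0]
      alg_hom_zero[OF A.ring_axioms E.ring_axioms e0]
    by (simp add: prim_def)
qed

lemma prim_minus:
  assumes "prim x"
  shows "prim (\<ominus>\<^bsub>A\<^esub> x)"
proof -
  interpret O: assoc_algebra R "opp A" by (rule opp_algebra[OF A.assoc_algebra_axioms])
  interpret E: assoc_algebra R "self_alg R" by (rule self_alg_algebra[OF A.R.is_cring])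
  have x: "x \<in> carrier A" using assms by (simp add: prim_def)
  have "\<ominus>\<^bsub>opp A\<^esub> y = \<ominus>\<^bsub>A\<^esub> y" if "y \<in> carrier A" for y
    by (rule O.minus_equality) (use that in \<open>simp_all add: A.l_neg\<close>)
  moreover have "\<ominus>\<^bsub>self_alg R\<^esub> \<zero>\<^bsub>R\<^esub> = \<zero>\<^bsub>R\<^esub>"
    by (rule E.minus_equality) simp_all
  ultimately show ?thesis using assms x
      alg_hom_minus[OF A.ring_axioms T2.T.ring_axioms D0 x] alg_hom_minus[OF A.ring_axioms O.ring_axioms S0 x]
      alg_hom_minus[OF A.ring_axioms E.ring_axioms e0 x]
    by (simp add: prim_def T2.T.minus_add)
qed

lemma prim_add: "prim x \<Longrightarrow> prim y \<Longrightarrow> prim (x \<oplus>\<^bsub>A\<^esub> y)"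
  using alg_homD(3)[OF D0] alg_homD(3)[OF S0] alg_homD(3)[OF e0]
  by (simp add: prim_def T2.T.a_ac A.minus_add)

lemma int_m2: "z \<in> carrier A \<Longrightarrow> [(-2::int)] \<cdot>\<^bsub>A\<^esub> z = \<ominus>\<^bsub>A\<^esub> (z \<oplus>\<^bsub>A\<^esub> z)"
  using J.int_mult_neg[of z 2] J.int_mult_2[of z 1] by simp

lemma prim_m2: "prim z \<Longrightarrow> prim ([(-2::int)] \<cdot>\<^bsub>A\<^esub> z)"
  using int_m2[of z] prim_minus[OF prim_add[of z z]] by (simp add: prim_def)

lemma good_h: "good 0 h (\<ominus>\<^bsub>A\<^esub> n) \<zero>\<^bsub>A\<^esub>"
  unfolding good_def by (simp add: J.good_h prim_h prim_minus prim_n prim_zero)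

lemma good_n: "good 1 n \<zero>\<^bsub>A\<^esub> \<zero>\<^bsub>A\<^esub>"
  unfolding good_def by (simp add: J.good_n prim_n prim_zero)

lemma good_x: "good b X x z \<Longrightarrow> good (b + 1) x ([(-2::int)] \<cdot>\<^bsub>A\<^esub> z) \<zero>\<^bsub>A\<^esub>"
  unfolding good_def by (auto simp: prim_zero prim_m2 intro: J.good_x)

lemma good_z: "good b X x z \<Longrightarrow> good (b + 2) z \<zero>\<^bsub>A\<^esub> \<zero>\<^bsub>A\<^esub>"
  unfolding good_def by (auto simp: prim_zero intro: J.good_z)

section \<open>Coproducts of the ingredients of the coproduct formula\<close>

lemma W1_n: "W (- 1) \<otimes>\<^bsub>A\<^esub> n = W (- 1) \<ominus>\<^bsub>A\<^esub> \<one>\<^bsub>A\<^esub>"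
proof -
  have "W (- 1) = W (- 1) \<otimes>\<^bsub>A\<^esub> (w \<oplus>\<^bsub>A\<^esub> n)" by (simp add: J.w_plus_n)
  also have "\<dots> = \<one>\<^bsub>A\<^esub> \<oplus>\<^bsub>A\<^esub> W (- 1) \<otimes>\<^bsub>A\<^esub> n" by (simp add: A.r_distr J.W_w)
  finally have "W (- 1) \<ominus>\<^bsub>A\<^esub> \<one>\<^bsub>A\<^esub> = \<one>\<^bsub>A\<^esub> \<oplus>\<^bsub>A\<^esub> W (- 1) \<otimes>\<^bsub>A\<^esub> n \<ominus>\<^bsub>A\<^esub> \<one>\<^bsub>A\<^esub>" by simp
  then show ?thesis by (simp add: a_minus_def A.a_ac A.r_neg1 A.r_neg2 A.r_neg)
qed

lemma h_W1: "h \<otimes>\<^bsub>A\<^esub> W (- 1) = W (- 1) \<otimes>\<^bsub>A\<^esub> h \<oplus>\<^bsub>A\<^esub> (W (- 2) \<ominus>\<^bsub>A\<^esub> W (- 1))"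
proof -
  have "W (- 1) \<otimes>\<^bsub>A\<^esub> h = h \<otimes>\<^bsub>A\<^esub> W (- 1) \<ominus>\<^bsub>A\<^esub> n \<otimes>\<^bsub>A\<^esub> W (- 2)"
    using J.W_good_r[OF J.good_h, of "- 1"] by (simp add: a_minus_def A.l_minus J.int_mult_neg)
  moreover have "n \<otimes>\<^bsub>A\<^esub> W (- 2) = W (- 2) \<ominus>\<^bsub>A\<^esub> W (- 1)"
  proof -
    have "W (- 2) = (w \<oplus>\<^bsub>A\<^esub> n) \<otimes>\<^bsub>A\<^esub> W (- 2)" by (simp add: J.w_plus_n)
    also have "\<dots> = W (- 1) \<oplus>\<^bsub>A\<^esub> n \<otimes>\<^bsub>A\<^esub> W (- 2)" by (simp add: A.l_distr J.w_W)
    finally have "W (- 2) \<ominus>\<^bsub>A\<^esub> W (- 1) = W (- 1) \<oplus>\<^bsub>A\<^esub> n \<otimes>\<^bsub>A\<^esub> W (- 2) \<ominus>\<^bsub>A\<^esub> W (- 1)" by simp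
    then show ?thesis by (simp add: a_minus_def A.a_ac A.r_neg1 A.r_neg2 A.r_neg)
  qed
  ultimately show ?thesis by (simp add: a_minus_def A.a_assoc A.l_neg)
qed

text \<open>In the general formula the term \<open>h \<otimes> w^(-1) n\<close> equals
  \<open>h \<otimes> w^(-1) - h \<otimes> 1\<close> and cancels
  \<open>h \<otimes> 1\<close>.\<close>

lemma \<Delta>_h: "\<Delta> h = pt h (W (- 1)) \<oplus>\<^bsub>T\<^esub> pt \<one>\<^bsub>A\<^esub> h"
proof -
  have "\<Delta> h = pt h \<one>\<^bsub>A\<^esub> \<oplus>\<^bsub>T\<^esub> pt \<one>\<^bsub>A\<^esub> h \<oplus>\<^bsub>T\<^esub> pt h (W (- 1) \<otimes>\<^bsub>A\<^esub> n)"
    using \<Delta>_good[OF good_h] by (simp add: a_minus_def A.r_minus)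
  then show ?thesis unfolding W1_n
    by (simp add: a_minus_def T2.T.a_ac T2.T.add_lcancel)
qed

text \<open>Grouplikeness of \<open>w\<close> passes to all its powers and gives the coproducts of
  the factors \<open>W b\<close>, \<open>W (- 1)\<close> and \<open>W (- 2)\<close> needed for
  coassociativity.\<close>

lemma \<Delta>_w: "\<Delta> w = pt w w"
proof -
  have "\<Delta> n = pt n w \<oplus>\<^bsub>T\<^esub> pt \<one>\<^bsub>A\<^esub> n"
    using \<Delta>_good[OF good_n] by (simp add: a_minus_def J.W_1)
  then have "\<Delta> w = pt \<one>\<^bsub>A\<^esub> \<one>\<^bsub>A\<^esub> \<ominus>\<^bsub>T\<^esub> (pt n w \<oplus>\<^bsub>T\<^esub> pt \<one>\<^bsub>A\<^esub> n)"
    by (simp add: J.w_def a_minus_def T2.pt_one)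
  also have "\<dots> = pt \<one>\<^bsub>A\<^esub> w \<ominus>\<^bsub>T\<^esub> pt n w"
    by (simp add: J.w_def a_minus_def T2.T.minus_add T2.T.a_ac)
  also have "\<dots> = pt w w" by (subst (3) J.w_def) (simp add: a_minus_def)
  finally show ?thesis .
qed

lemma \<Delta>_W: "\<Delta> (W c) = pt (W c) (W c)"
proof -
  obtain k :: nat where k: "W c = w [^]\<^bsub>A\<^esub> k" using J.W_nat_ex[of c] by blast
  have "\<Delta> (w [^]\<^bsub>A\<^esub> (k::nat)) = pt (w [^]\<^bsub>A\<^esub> k) (w [^]\<^bsub>A\<^esub> k)" for k
    by (induction k) (simp_all add: \<Delta>_w T2.pt_one)
  then show ?thesis by (simp add: k)
qed

text \<open>Reordering \<open>h W (- 1)\<close> by \<open>h_W1\<close> replaces the term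
  \<open>h \<otimes> W (- 1)\<close>, which stems from the summand 1 in \<open>h + 1\<close>, by
  \<open>h \<otimes> W (- 2)\<close>. This completes the square of \<open>h\<close> in the first leg
  to \<open>h2\<close>.\<close>

lemma \<Delta>_h2: "\<Delta> h2 = pt h2 (W (- 2)) \<oplus>\<^bsub>T\<^esub> (pt h (W (- 1) \<otimes>\<^bsub>A\<^esub> h) \<oplus>\<^bsub>T\<^esub> pt h (W (- 1) \<otimes>\<^bsub>A\<^esub> h)) \<oplus>\<^bsub>T\<^esub> pt \<one>\<^bsub>A\<^esub> h2"
proof -
  have "\<Delta> h2 = (pt h (W (- 1)) \<oplus>\<^bsub>T\<^esub> pt \<one>\<^bsub>A\<^esub> h) \<otimes>\<^bsub>T\<^esub> (pt h (W (- 1)) \<oplus>\<^bsub>T\<^esub> pt \<one>\<^bsub>A\<^esub> h \<oplus>\<^bsub>T\<^esub> pt \<one>\<^bsub>A\<^esub> \<one>\<^bsub>A\<^esub>)"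
    by (simp add: \<Delta>_h T2.pt_one)
  also have "\<dots> = pt h2 (W (- 2)) \<oplus>\<^bsub>T\<^esub> (pt h (W (- 1) \<otimes>\<^bsub>A\<^esub> h) \<oplus>\<^bsub>T\<^esub> pt h (W (- 1) \<otimes>\<^bsub>A\<^esub> h)) \<oplus>\<^bsub>T\<^esub> pt \<one>\<^bsub>A\<^esub> h2"
    by (simp add: T2.T.l_distr T2.T.r_distr A.r_distr A.l_distr h_W1 a_minus_def
        T2.T.a_ac T2.T.r_neg1 T2.T.r_neg2 T2.T.r_neg T2.T.l_neg)
  finally show ?thesis .
qed

text \<open>The members \<open>x\<close> and \<open>z\<close> start triples themselves, which yields
  their coproducts; the factor in front of them is grouplike.\<close>

lemma \<Delta>_Wx:
  assumes g: "good b X x z"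
  shows "\<Delta> (W (- 1) \<otimes>\<^bsub>A\<^esub> x) = pt (W (- 1) \<otimes>\<^bsub>A\<^esub> x) (W b) \<oplus>\<^bsub>T\<^esub> pt (W (- 1)) (W (- 1) \<otimes>\<^bsub>A\<^esub> x) \<oplus>\<^bsub>T\<^esub>
      (pt (W (- 1) \<otimes>\<^bsub>A\<^esub> h) (W (- 2) \<otimes>\<^bsub>A\<^esub> z) \<oplus>\<^bsub>T\<^esub> pt (W (- 1) \<otimes>\<^bsub>A\<^esub> h) (W (- 2) \<otimes>\<^bsub>A\<^esub> z))"
    and "\<Delta> (W (- 2) \<otimes>\<^bsub>A\<^esub> z) = pt (W (- 2) \<otimes>\<^bsub>A\<^esub> z) (W b) \<oplus>\<^bsub>T\<^esub> pt (W (- 2)) (W (- 2) \<otimes>\<^bsub>A\<^esub> z)"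
proof -
  have c: "X \<in> carrier A" "x \<in> carrier A" "z \<in> carrier A" using good_closed[OF g] by simp_all
  have 1: "\<Delta> x = pt x (W (b + 1)) \<oplus>\<^bsub>T\<^esub> pt \<one>\<^bsub>A\<^esub> x \<oplus>\<^bsub>T\<^esub> (pt h (W (- 1) \<otimes>\<^bsub>A\<^esub> z) \<oplus>\<^bsub>T\<^esub> pt h (W (- 1) \<otimes>\<^bsub>A\<^esub> z))"
    using \<Delta>_good[OF good_x[OF g]] c by (simp add: int_m2 a_minus_def A.r_minus A.r_distr T2.T.minus_add)
  have 2: "\<Delta> z = pt z (W (b + 2)) \<oplus>\<^bsub>T\<^esub> pt \<one>\<^bsub>A\<^esub> z"
    using \<Delta>_good[OF good_z[OF g]] c by (simp add: a_minus_def)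
  show "\<Delta> (W (- 1) \<otimes>\<^bsub>A\<^esub> x) = pt (W (- 1) \<otimes>\<^bsub>A\<^esub> x) (W b) \<oplus>\<^bsub>T\<^esub> pt (W (- 1)) (W (- 1) \<otimes>\<^bsub>A\<^esub> x) \<oplus>\<^bsub>T\<^esub>
      (pt (W (- 1) \<otimes>\<^bsub>A\<^esub> h) (W (- 2) \<otimes>\<^bsub>A\<^esub> z) \<oplus>\<^bsub>T\<^esub> pt (W (- 1) \<otimes>\<^bsub>A\<^esub> h) (W (- 2) \<otimes>\<^bsub>A\<^esub> z))"
    using c by (simp add: \<Delta>_W 1 T2.T.r_distr)
  show "\<Delta> (W (- 2) \<otimes>\<^bsub>A\<^esub> z) = pt (W (- 2) \<otimes>\<^bsub>A\<^esub> z) (W b) \<oplus>\<^bsub>T\<^esub> pt (W (- 2)) (W (- 2) \<otimes>\<^bsub>A\<^esub> z)"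
    using c by (simp add: \<Delta>_W 2 T2.T.r_distr)
qed

sublocale L3: two_algebras R T A
  by (intro two_algebras.intro A.assoc_algebra_axioms T2.T_algebra)

lemma hom_eqI:
  assumes B: "Ring.ring B" and f: "f \<in> alg_hom R A B" and g: "g \<in> alg_hom R A B"
    and eq: "\<And>b X x z. good b X x z \<Longrightarrow> f X = g X" and x: "x \<in> carrier A"
  shows "f x = g x"
  using x
proof (rule gen_induct)
  show "f \<one>\<^bsub>A\<^esub> = g \<one>\<^bsub>A\<^esub>" using alg_homD(4)[OF f] alg_homD(4)[OF g] by simp
qed (use eq in \<open>auto simp: alg_homD[OF f] alg_homD[OF g]\<close>)

lemma coassoc:
  assumes "x \<in> carrier A"
  shows "tensor_assoc R A A A (tensor_map R T A \<Delta> (\<lambda>a. a) (\<Delta> x)) = tensor_map R A T (\<lambda>a. a) \<Delta> (\<Delta> x)"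
proof -
  note al = A.assoc_algebra_axioms
  define as where "as = tensor_assoc R A A A"
  define ml where "ml = tensor_map R T A \<Delta> (\<lambda>a. a)"
  define mr where "mr = tensor_map R A T (\<lambda>a. a) \<Delta>"
  have as: "as \<in> alg_hom R L3.T T3.T" "\<And>a b c. a \<in> carrier A \<Longrightarrow> b \<in> carrier A \<Longrightarrow> c \<in> carrier A \<Longrightarrow>
      as (L3.pt (pt a b) c) = T3.pt a (pt b c)"
    unfolding as_def using tensor_assoc_hom[OF al al al] by simp_all
  have ml: "ml \<in> alg_hom R T L3.T" "\<And>a b. a \<in> carrier A \<Longrightarrow> b \<in> carrier A \<Longrightarrow> ml (pt a b) = L3.pt (\<Delta> a) b"
    unfolding ml_def using tensor_map_hom[OF al al T2.T_algebra al \<Delta>_hom alg_hom_id] by simp_all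
  have mr: "mr \<in> alg_hom R T T3.T" "\<And>a b. a \<in> carrier A \<Longrightarrow> b \<in> carrier A \<Longrightarrow> mr (pt a b) = T3.pt a (\<Delta> b)"
    unfolding mr_def using tensor_map_hom[OF al al al T2.T_algebra alg_hom_id \<Delta>_hom] by simp_all
  note asD = alg_homD[OF as(1)] and mlD = alg_homD[OF ml(1)] and mrD = alg_homD[OF mr(1)]
  note asm = alg_hom_minus[OF L3.T.ring_axioms T3.T.ring_axioms as(1)]
    alg_hom_minus[OF T2.T.ring_axioms L3.T.ring_axioms ml(1)]
    alg_hom_minus[OF T2.T.ring_axioms T3.T.ring_axioms mr(1)]
  have "(\<lambda>x. as (ml (\<Delta> x))) x = (\<lambda>x. mr (\<Delta> x)) x"
  proof (rule hom_eqI[OF T3.T.ring_axioms _ _ _ assms])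
    show "(\<lambda>x. as (ml (\<Delta> x))) \<in> alg_hom R A T3.T"
      by (rule alg_hom_comp[OF alg_hom_comp[OF \<Delta>_hom ml(1)] as(1)])
    show "(\<lambda>x. mr (\<Delta> x)) \<in> alg_hom R A T3.T"
      by (rule alg_hom_comp[OF \<Delta>_hom mr(1)])
    fix b X x z assume g: "good b X x z"
    have c: "X \<in> carrier A" "x \<in> carrier A" "z \<in> carrier A" using good_closed[OF g] by simp_all
    \<comment> \<open>With these names both sides become sums of the same pure tensors. The doubled
      term with \<open>wh\<close> and \<open>y2\<close> arises on one side from the coproduct of
      \<open>k\<close> and on the other from that of \<open>y1\<close>.\<close>
    define y1 where "y1 = W (- 1) \<otimes>\<^bsub>A\<^esub> x"
    define y2 where "y2 = W (- 2) \<otimes>\<^bsub>A\<^esub> z"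
    define k where "k = h2"
    define wh where "wh = W (- 1) \<otimes>\<^bsub>A\<^esub> h"
    have y: "y1 \<in> carrier A" "y2 \<in> carrier A" "k \<in> carrier A" "wh \<in> carrier A"
      using c by (simp_all add: y1_def y2_def k_def wh_def)
    have DX: "\<Delta> X = pt X (W b) \<oplus>\<^bsub>T\<^esub> pt \<one>\<^bsub>A\<^esub> X \<ominus>\<^bsub>T\<^esub> pt h y1 \<ominus>\<^bsub>T\<^esub> pt k y2"
      using \<Delta>_good[OF g] by (simp only: y1_def y2_def k_def)
    have D1: "\<Delta> y1 = pt y1 (W b) \<oplus>\<^bsub>T\<^esub> pt (W (- 1)) y1 \<oplus>\<^bsub>T\<^esub> (pt wh y2 \<oplus>\<^bsub>T\<^esub> pt wh y2)"
      using \<Delta>_Wx(1)[OF g] by (simp only: y1_def y2_def wh_def)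
    have D2: "\<Delta> y2 = pt y2 (W b) \<oplus>\<^bsub>T\<^esub> pt (W (- 2)) y2"
      using \<Delta>_Wx(2)[OF g] by (simp only: y2_def)
    have Dk: "\<Delta> k = pt k (W (- 2)) \<oplus>\<^bsub>T\<^esub> (pt h wh \<oplus>\<^bsub>T\<^esub> pt h wh) \<oplus>\<^bsub>T\<^esub> pt \<one>\<^bsub>A\<^esub> k"
      using \<Delta>_h2 by (simp only: k_def wh_def)
    have L: "as (ml (\<Delta> X)) =
        (T3.pt X (pt (W b) (W b)) \<oplus>\<^bsub>T3.T\<^esub> T3.pt \<one>\<^bsub>A\<^esub> (pt X (W b)) \<ominus>\<^bsub>T3.T\<^esub> T3.pt h (pt y1 (W b)) \<ominus>\<^bsub>T3.T\<^esub> T3.pt k (pt y2 (W b)))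
        \<oplus>\<^bsub>T3.T\<^esub> T3.pt \<one>\<^bsub>A\<^esub> (pt \<one>\<^bsub>A\<^esub> X)
        \<ominus>\<^bsub>T3.T\<^esub> (T3.pt h (pt (W (- 1)) y1) \<oplus>\<^bsub>T3.T\<^esub> T3.pt \<one>\<^bsub>A\<^esub> (pt h y1))
        \<ominus>\<^bsub>T3.T\<^esub> (T3.pt k (pt (W (- 2)) y2) \<oplus>\<^bsub>T3.T\<^esub> (T3.pt h (pt wh y2) \<oplus>\<^bsub>T3.T\<^esub> T3.pt h (pt wh y2))
          \<oplus>\<^bsub>T3.T\<^esub> T3.pt \<one>\<^bsub>A\<^esub> (pt k y2))"
    proof -
      have "ml (\<Delta> X) = L3.pt (\<Delta> X) (W b) \<oplus>\<^bsub>L3.T\<^esub> L3.pt (pt \<one>\<^bsub>A\<^esub> \<one>\<^bsub>A\<^esub>) X \<ominus>\<^bsub>L3.T\<^esub> L3.pt (\<Delta> h) y1 \<ominus>\<^bsub>L3.T\<^esub> L3.pt (\<Delta> k) y2"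
        by (subst DX) (use c y in \<open>simp add: a_minus_def mlD asm ml T2.pt_one\<close>)
      then show ?thesis unfolding DX \<Delta>_h Dk using c y
        by (simp add: a_minus_def asD asm as)
    qed
    have R: "mr (\<Delta> X) = T3.pt X (pt (W b) (W b)) \<oplus>\<^bsub>T3.T\<^esub>
        (T3.pt \<one>\<^bsub>A\<^esub> (pt X (W b)) \<oplus>\<^bsub>T3.T\<^esub> T3.pt \<one>\<^bsub>A\<^esub> (pt \<one>\<^bsub>A\<^esub> X) \<ominus>\<^bsub>T3.T\<^esub> T3.pt \<one>\<^bsub>A\<^esub> (pt h y1) \<ominus>\<^bsub>T3.T\<^esub> T3.pt \<one>\<^bsub>A\<^esub> (pt k y2))
        \<ominus>\<^bsub>T3.T\<^esub> (T3.pt h (pt y1 (W b)) \<oplus>\<^bsub>T3.T\<^esub> T3.pt h (pt (W (- 1)) y1) \<oplus>\<^bsub>T3.T\<^esub> (T3.pt h (pt wh y2) \<oplus>\<^bsub>T3.T\<^esub> T3.pt h (pt wh y2)))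
        \<ominus>\<^bsub>T3.T\<^esub> (T3.pt k (pt y2 (W b)) \<oplus>\<^bsub>T3.T\<^esub> T3.pt k (pt (W (- 2)) y2))"
    proof -
      have "mr (\<Delta> X) = T3.pt X (pt (W b) (W b)) \<oplus>\<^bsub>T3.T\<^esub> T3.pt \<one>\<^bsub>A\<^esub> (\<Delta> X) \<ominus>\<^bsub>T3.T\<^esub> T3.pt h (\<Delta> y1) \<ominus>\<^bsub>T3.T\<^esub> T3.pt k (\<Delta> y2)"
        by (subst DX) (use c y in \<open>simp add: a_minus_def mrD asm mr \<Delta>_W\<close>)
      then show ?thesis unfolding DX D1 D2 using c y by (simp add: a_minus_def)
    qed
    show "as (ml (\<Delta> X)) = mr (\<Delta> X)"
      unfolding L R using c y by (simp add: a_minus_def T3.T.minus_add T3.T.a_ac)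
  qed
  then show ?thesis by (simp add: as_def ml_def mr_def)
qed

section \<open>The counit axioms\<close>

lemma e_prim: "prim x \<Longrightarrow> e0 x = \<zero>\<^bsub>R\<^esub>"
  by (simp add: prim_def)

lemma e_minus: "x \<in> carrier A \<Longrightarrow> e0 (\<ominus>\<^bsub>A\<^esub> x) = \<ominus>\<^bsub>R\<^esub> e0 x"
  by (rule A.R.minus_equality[symmetric])
    (simp_all flip: eD(3) add: A.l_neg e_prim[OF prim_zero])

lemma e_W: "e0 (W c) = \<one>\<^bsub>R\<^esub>"
proof -
  obtain k :: nat where k: "W c = w [^]\<^bsub>A\<^esub> k" using J.W_nat_ex[of c] by blast
  have "e0 w = \<one>\<^bsub>R\<^esub>" by (simp add: J.w_def a_minus_def e_minus e_prim[OF prim_n])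
  then have "e0 (w [^]\<^bsub>A\<^esub> (k::nat)) = \<one>\<^bsub>R\<^esub>" for k
    by (induction k) simp_all
  then show ?thesis by (simp add: k)
qed

lemma e_good:
  assumes "good b X x z"
  shows "e0 X = \<zero>\<^bsub>R\<^esub>" "e0 x = \<zero>\<^bsub>R\<^esub>" "e0 z = \<zero>\<^bsub>R\<^esub>" "e0 h = \<zero>\<^bsub>R\<^esub>"
  using assms prim_h by (simp_all add: good_def prim_def)

lemma counit_hom:
  "tensor_lift R A (\<lambda>a b. e0 a \<odot>\<^bsub>A\<^esub> b) \<in> alg_hom R T A" (is "?l \<in> _")
  "tensor_lift R A (\<lambda>a b. e0 b \<odot>\<^bsub>A\<^esub> a) \<in> alg_hom R T A" (is "?r \<in> _")
  "a \<in> carrier A \<Longrightarrow> b \<in> carrier A \<Longrightarrow> tensor_lift R A (\<lambda>a b. e0 a \<odot>\<^bsub>A\<^esub> b) (pt a b) = e0 a \<odot>\<^bsub>A\<^esub> b"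
  "a \<in> carrier A \<Longrightarrow> b \<in> carrier A \<Longrightarrow> tensor_lift R A (\<lambda>a b. e0 b \<odot>\<^bsub>A\<^esub> a) (pt a b) = e0 b \<odot>\<^bsub>A\<^esub> a"
proof -
  have comm: "r \<odot>\<^bsub>A\<^esub> (s \<odot>\<^bsub>A\<^esub> y) = s \<odot>\<^bsub>A\<^esub> (r \<odot>\<^bsub>A\<^esub> y)" if "r \<in> carrier R" "s \<in> carrier R" "y \<in> carrier A" for r s y
    using that by (simp add: A.R.m_comm flip: A.smult_assoc1)
  have l: "bilin R A A A (\<lambda>a b. e0 a \<odot>\<^bsub>A\<^esub> b)"
    by (rule bilinI) (simp_all add: A.smult_l_distr A.smult_r_distr A.smult_assoc1 comm)
  have r: "bilin R A A A (\<lambda>a b. e0 b \<odot>\<^bsub>A\<^esub> a)"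
    by (rule bilinI) (simp_all add: A.smult_l_distr A.smult_r_distr A.smult_assoc1 comm)
  show "?l \<in> alg_hom R T A"
    by (rule T2.lift_alg_hom[OF A.assoc_algebra_axioms l])
      (simp_all add: A.smult_mult_left A.smult_mult_right A.smult_assoc1 comm)
  show "?r \<in> alg_hom R T A"
    by (rule T2.lift_alg_hom[OF A.assoc_algebra_axioms r])
      (simp_all add: A.smult_mult_left A.smult_mult_right A.smult_assoc1 comm)
  show "?l (pt a b) = e0 a \<odot>\<^bsub>A\<^esub> b" "?r (pt a b) = e0 b \<odot>\<^bsub>A\<^esub> a" if "a \<in> carrier A" "b \<in> carrier A"
    using T2.lift_pt[OF A.module_axioms l that] T2.lift_pt[OF A.module_axioms r that] by simp_all
qed

lemma counit:
  assumes "x \<in> carrier A"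
  shows "tensor_lift R A (\<lambda>a b. e0 a \<odot>\<^bsub>A\<^esub> b) (\<Delta> x) = x" "tensor_lift R A (\<lambda>a b. e0 b \<odot>\<^bsub>A\<^esub> a) (\<Delta> x) = x"
proof -
  define l where "l = tensor_lift R A (\<lambda>a b. e0 a \<odot>\<^bsub>A\<^esub> b)"
  define r where "r = tensor_lift R A (\<lambda>a b. e0 b \<odot>\<^bsub>A\<^esub> a)"
  have l: "l \<in> alg_hom R T A" "\<And>a b. a \<in> carrier A \<Longrightarrow> b \<in> carrier A \<Longrightarrow> l (pt a b) = e0 a \<odot>\<^bsub>A\<^esub> b"
    and r: "r \<in> alg_hom R T A" "\<And>a b. a \<in> carrier A \<Longrightarrow> b \<in> carrier A \<Longrightarrow> r (pt a b) = e0 b \<odot>\<^bsub>A\<^esub> a"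
    unfolding l_def r_def using counit_hom by simp_all
  note m = alg_hom_minus[OF T2.T.ring_axioms A.ring_axioms l(1)] alg_hom_minus[OF T2.T.ring_axioms A.ring_axioms r(1)]
  have *: "l (\<Delta> X) = X" "r (\<Delta> X) = X" if g: "good b X x z" for b X x z
    unfolding \<Delta>_good[OF g] using good_closed[OF g] e_good[OF g]
    by (simp_all add: a_minus_def alg_homD[OF l(1)] alg_homD[OF r(1)] l(2) r(2) m e_W)
  show "tensor_lift R A (\<lambda>a b. e0 a \<odot>\<^bsub>A\<^esub> b) (\<Delta> x) = x"
    using hom_eqI[OF A.ring_axioms alg_hom_comp[OF \<Delta>_hom l(1)] alg_hom_id *(1) assms] by (simp add: l_def)
  show "tensor_lift R A (\<lambda>a b. e0 b \<odot>\<^bsub>A\<^esub> a) (\<Delta> x) = x"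
    using hom_eqI[OF A.ring_axioms alg_hom_comp[OF \<Delta>_hom r(1)] alg_hom_id *(2) assms] by (simp add: r_def)
qed

section \<open>The antipode axioms\<close>

lemma S_minus [simp]:
  assumes "x \<in> carrier A"
  shows "S (\<ominus>\<^bsub>A\<^esub> x) = \<ominus>\<^bsub>A\<^esub> S x"
proof -
  interpret O: assoc_algebra R "opp A" by (rule opp_algebra[OF A.assoc_algebra_axioms])
  have "\<ominus>\<^bsub>opp A\<^esub> y = \<ominus>\<^bsub>A\<^esub> y" if "y \<in> carrier A" for y
    by (rule O.minus_equality) (use that in \<open>simp_all add: A.l_neg\<close>)
  then show ?thesis using alg_hom_minus[OF A.ring_axioms O.ring_axioms S_hom assms] assms by simp
qed

lemma S_h: "S h = \<ominus>\<^bsub>A\<^esub> (h \<otimes>\<^bsub>A\<^esub> w)"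
proof -
  have "h \<otimes>\<^bsub>A\<^esub> w = h \<ominus>\<^bsub>A\<^esub> h \<otimes>\<^bsub>A\<^esub> n" by (simp add: J.w_def a_minus_def A.r_distr A.r_minus)
  then show ?thesis using S_good(1)[OF good_h] by (simp add: a_minus_def A.r_minus)
qed

lemma S_w: "S w = W (- 1)"
proof -
  have "S n = \<ominus>\<^bsub>A\<^esub> (n \<otimes>\<^bsub>A\<^esub> W (- 1))"
    using S_good(1)[OF good_n] by (simp add: a_minus_def)
  moreover have "S w = \<one>\<^bsub>A\<^esub> \<ominus>\<^bsub>A\<^esub> S n"
    by (simp add: J.w_def a_minus_def)
  ultimately have "S w = \<one>\<^bsub>A\<^esub> \<oplus>\<^bsub>A\<^esub> n \<otimes>\<^bsub>A\<^esub> W (- 1)"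
    by (simp add: a_minus_def)
  also have "\<one>\<^bsub>A\<^esub> = w \<otimes>\<^bsub>A\<^esub> W (- 1)" by (simp add: J.w_W)
  also have "w \<otimes>\<^bsub>A\<^esub> W (- 1) \<oplus>\<^bsub>A\<^esub> n \<otimes>\<^bsub>A\<^esub> W (- 1) = (w \<oplus>\<^bsub>A\<^esub> n) \<otimes>\<^bsub>A\<^esub> W (- 1)"
    by (rule A.l_distr[symmetric]) simp_all
  finally show ?thesis by (simp add: J.w_plus_n)
qed

lemma S_W: "S (W c) = W (- c)"
proof -
  obtain k where k: "int p dvd c - int k" "W c = w [^]\<^bsub>A\<^esub> k" using J.W_nat_ex[of c] by blast
  have "S (w [^]\<^bsub>A\<^esub> (k::nat)) = W (- int k)" for k
    by (induction k) (simp_all add: S_w algebra_simps)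
  moreover have "W (- int k) = W (- c)" using k by (intro J.W_cong) (simp add: dvd_diff_commute)
  ultimately show ?thesis by (simp add: k(2))
qed

text \<open>The value is \<open>(S h + 1) S h\<close> with \<open>S h = - h w\<close>. Moving
  \<open>w\<close> past \<open>h\<close> adds \<open>1 - w\<close>: the resulting \<open>h w\<close>
  cancels the linear term, and what remains is \<open>h h w w - h w w\<close>.\<close>

lemma S_h2: "S h2 = h \<otimes>\<^bsub>A\<^esub> (h \<ominus>\<^bsub>A\<^esub> \<one>\<^bsub>A\<^esub>) \<otimes>\<^bsub>A\<^esub> W 2"
proof -
  have wh: "w \<otimes>\<^bsub>A\<^esub> h = h \<otimes>\<^bsub>A\<^esub> w \<oplus>\<^bsub>A\<^esub> (\<one>\<^bsub>A\<^esub> \<ominus>\<^bsub>A\<^esub> w)"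
  proof -
    have "w \<otimes>\<^bsub>A\<^esub> h = h \<otimes>\<^bsub>A\<^esub> w \<ominus>\<^bsub>A\<^esub> (\<ominus>\<^bsub>A\<^esub> n)" by (rule J.good_w(1)[OF J.good_h])
    moreover have "\<one>\<^bsub>A\<^esub> \<ominus>\<^bsub>A\<^esub> w = n" by (simp add: J.w_def a_minus_def A.minus_add A.r_neg2)
    ultimately show ?thesis by (simp add: a_minus_def)
  qed
  have "S h2 = (\<ominus>\<^bsub>A\<^esub> (h \<otimes>\<^bsub>A\<^esub> w) \<oplus>\<^bsub>A\<^esub> \<one>\<^bsub>A\<^esub>) \<otimes>\<^bsub>A\<^esub> (\<ominus>\<^bsub>A\<^esub> (h \<otimes>\<^bsub>A\<^esub> w))"
    by (simp add: S_h)
  also have "\<dots> = h \<otimes>\<^bsub>A\<^esub> (w \<otimes>\<^bsub>A\<^esub> h) \<otimes>\<^bsub>A\<^esub> w \<ominus>\<^bsub>A\<^esub> h \<otimes>\<^bsub>A\<^esub> w"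
    by (simp add: A.l_distr A.l_minus A.r_minus a_minus_def A.m_assoc A.minus_add)
  also have "\<dots> = h \<otimes>\<^bsub>A\<^esub> h \<otimes>\<^bsub>A\<^esub> (w \<otimes>\<^bsub>A\<^esub> w) \<ominus>\<^bsub>A\<^esub> h \<otimes>\<^bsub>A\<^esub> (w \<otimes>\<^bsub>A\<^esub> w)"
    unfolding wh by (simp add: a_minus_def A.l_distr A.r_distr A.l_minus A.r_minus A.m_assoc A.a_assoc A.add_lcancel A.r_neg2 A.l_neg A.r_neg)
      (simp add: A.a_ac A.add_lcancel A.r_neg2 A.r_neg1 A.l_neg A.r_neg)
  also have "w \<otimes>\<^bsub>A\<^esub> w = W 2" using J.W_w[of 1] by (simp add: J.W_1)
  finally show ?thesis by (simp add: a_minus_def A.l_distr A.r_distr A.r_minus A.l_minus)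
qed

lemma S_Wx:
  assumes g: "good b X x z"
  shows "S (W (- 1) \<otimes>\<^bsub>A\<^esub> x) = \<ominus>\<^bsub>A\<^esub> ((x \<ominus>\<^bsub>A\<^esub> (h \<otimes>\<^bsub>A\<^esub> z \<oplus>\<^bsub>A\<^esub> h \<otimes>\<^bsub>A\<^esub> z)) \<otimes>\<^bsub>A\<^esub> W (- b))"
    and "S (W (- 2) \<otimes>\<^bsub>A\<^esub> z) = \<ominus>\<^bsub>A\<^esub> (z \<otimes>\<^bsub>A\<^esub> W (- b))"
proof -
  have c: "X \<in> carrier A" "x \<in> carrier A" "z \<in> carrier A" using good_closed[OF g] by simp_all
  have 1: "S x = \<ominus>\<^bsub>A\<^esub> ((x \<ominus>\<^bsub>A\<^esub> (h \<otimes>\<^bsub>A\<^esub> z \<oplus>\<^bsub>A\<^esub> h \<otimes>\<^bsub>A\<^esub> z)) \<otimes>\<^bsub>A\<^esub> W (- (b + 1)))"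
    using S_good(1)[OF good_x[OF g]] c by (simp add: int_m2 a_minus_def A.r_minus A.r_distr)
  have 2: "S z = \<ominus>\<^bsub>A\<^esub> (z \<otimes>\<^bsub>A\<^esub> W (- (b + 2)))"
    using S_good(1)[OF good_z[OF g]] c by (simp add: a_minus_def)
  show "S (W (- 1) \<otimes>\<^bsub>A\<^esub> x) = \<ominus>\<^bsub>A\<^esub> ((x \<ominus>\<^bsub>A\<^esub> (h \<otimes>\<^bsub>A\<^esub> z \<oplus>\<^bsub>A\<^esub> h \<otimes>\<^bsub>A\<^esub> z)) \<otimes>\<^bsub>A\<^esub> W (- b))"
    using c by (simp add: S_W 1 A.l_minus A.m_assoc)
  show "S (W (- 2) \<otimes>\<^bsub>A\<^esub> z) = \<ominus>\<^bsub>A\<^esub> (z \<otimes>\<^bsub>A\<^esub> W (- b))"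
    using c by (simp add: S_W 2 A.l_minus A.m_assoc)
qed

lemma S_bilin:
  assumes c: "c \<in> carrier A"
  shows "bilin R A A A (\<lambda>a b. S a \<otimes>\<^bsub>A\<^esub> c \<otimes>\<^bsub>A\<^esub> b)" "bilin R A A A (\<lambda>a b. a \<otimes>\<^bsub>A\<^esub> c \<otimes>\<^bsub>A\<^esub> S b)"
  by (rule bilinI; use c in \<open>simp add: A.l_distr A.r_distr A.smult_mult_left A.smult_mult_right\<close>)+

text \<open>These are the contractions of the antipode axiom with a parameter \<open>c\<close>
  placed between the two legs; the axiom itself is the case of the unit. With the parameter they
  obey a rule for products.\<close>

definition "\<mu>l c = tensor_lift R A (\<lambda>a b. S a \<otimes>\<^bsub>A\<^esub> c \<otimes>\<^bsub>A\<^esub> b)"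
definition "\<mu>r c = tensor_lift R A (\<lambda>a b. a \<otimes>\<^bsub>A\<^esub> c \<otimes>\<^bsub>A\<^esub> S b)"

lemmas \<mu>l_closed [simp] = T2.lift_closed[OF A.module_axioms S_bilin(1), folded \<mu>l_def]
lemmas \<mu>r_closed [simp] = T2.lift_closed[OF A.module_axioms S_bilin(2), folded \<mu>r_def]
lemmas \<mu>l_add = T2.lift_add[OF A.module_axioms S_bilin(1), folded \<mu>l_def]
lemmas \<mu>r_add = T2.lift_add[OF A.module_axioms S_bilin(2), folded \<mu>r_def]
lemmas \<mu>l_smult = T2.lift_smult[OF A.module_axioms S_bilin(1), folded \<mu>l_def]
lemmas \<mu>r_smult = T2.lift_smult[OF A.module_axioms S_bilin(2), folded \<mu>r_def]
lemmas \<mu>l_pt = T2.lift_pt[OF A.module_axioms S_bilin(1), folded \<mu>l_def]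
lemmas \<mu>r_pt = T2.lift_pt[OF A.module_axioms S_bilin(2), folded \<mu>r_def]

lemma \<mu>_minus:
  assumes c: "c \<in> carrier A" and X: "X \<in> carrier T"
  shows "\<mu>l c (\<ominus>\<^bsub>T\<^esub> X) = \<ominus>\<^bsub>A\<^esub> \<mu>l c X" "\<mu>r c (\<ominus>\<^bsub>T\<^esub> X) = \<ominus>\<^bsub>A\<^esub> \<mu>r c X"
proof -
  have z: "\<mu>l c \<zero>\<^bsub>T\<^esub> = \<zero>\<^bsub>A\<^esub>" "\<mu>r c \<zero>\<^bsub>T\<^esub> = \<zero>\<^bsub>A\<^esub>"
    using \<mu>l_smult[OF c, of "\<zero>\<^bsub>R\<^esub>" "\<zero>\<^bsub>T\<^esub>"] \<mu>r_smult[OF c, of "\<zero>\<^bsub>R\<^esub>" "\<zero>\<^bsub>T\<^esub>"] c by simp_all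
  show "\<mu>l c (\<ominus>\<^bsub>T\<^esub> X) = \<ominus>\<^bsub>A\<^esub> \<mu>l c X"
    by (rule A.minus_equality[symmetric]) (use c X in \<open>simp_all flip: \<mu>l_add[OF c] add: T2.T.l_neg z\<close>)
  show "\<mu>r c (\<ominus>\<^bsub>T\<^esub> X) = \<ominus>\<^bsub>A\<^esub> \<mu>r c X"
    by (rule A.minus_equality[symmetric]) (use c X in \<open>simp_all flip: \<mu>r_add[OF c] add: T2.T.l_neg z\<close>)
qed

lemma \<mu>_add_param:
  assumes X: "X \<in> carrier T" and c: "c \<in> carrier A" "c' \<in> carrier A"
  shows "\<mu>l (c \<oplus>\<^bsub>A\<^esub> c') X = \<mu>l c X \<oplus>\<^bsub>A\<^esub> \<mu>l c' X" "\<mu>r (c \<oplus>\<^bsub>A\<^esub> c') X = \<mu>r c X \<oplus>\<^bsub>A\<^esub> \<mu>r c' X"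
  using X by (induction rule: T2.T_induct)
    (use c in \<open>simp_all add: \<mu>l_add \<mu>r_add \<mu>l_pt \<mu>r_pt A.l_distr A.r_distr A.a_ac\<close>)

lemma \<mu>_smult_param:
  assumes X: "X \<in> carrier T" and c: "c \<in> carrier A" "r \<in> carrier R"
  shows "\<mu>l (r \<odot>\<^bsub>A\<^esub> c) X = r \<odot>\<^bsub>A\<^esub> \<mu>l c X" "\<mu>r (r \<odot>\<^bsub>A\<^esub> c) X = r \<odot>\<^bsub>A\<^esub> \<mu>r c X"
  using X by (induction rule: T2.T_induct)
    (use c in \<open>simp_all add: \<mu>l_add \<mu>r_add \<mu>l_pt \<mu>r_pt A.smult_mult_left A.smult_mult_right A.smult_r_distr\<close>)

text \<open>On pure tensors this is \<open>S (a a') c b b' = S a' (S a c b) b'\<close>: since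
  \<open>S\<close> reverses products, the legs of the left factor close up around \<open>c\<close>
  and become the new parameter.\<close>

lemma \<mu>l_mult:
  assumes X: "X \<in> carrier T" and Y: "Y \<in> carrier T" and c: "c \<in> carrier A"
  shows "\<mu>l c (X \<otimes>\<^bsub>T\<^esub> Y) = \<mu>l (\<mu>l c X) Y"
  using X
proof (induction rule: T2.T_induct)
  case (add X X')
  then show ?case using Y c by (simp add: T2.T.l_distr \<mu>l_add \<mu>_add_param)
next
  case (pt a b)
  show ?case using Y
  proof (induction rule: T2.T_induct)
    case (add Y Y')
    then show ?case using pt c by (simp add: T2.T.r_distr \<mu>l_add)
  next
    case (pt a' b')
    then show ?case using \<open>a \<in> carrier A\<close> \<open>b \<in> carrier A\<close> c by (simp add: \<mu>l_pt A.m_assoc)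
  qed
qed

text \<open>Here \<open>S\<close> stands on the second leg, so it is the right factor
  \<open>Y\<close> that closes up around the parameter.\<close>

lemma \<mu>r_mult:
  assumes X: "X \<in> carrier T" and Y: "Y \<in> carrier T" and c: "c \<in> carrier A"
  shows "\<mu>r c (X \<otimes>\<^bsub>T\<^esub> Y) = \<mu>r (\<mu>r c Y) X"
  using Y
proof (induction rule: T2.T_induct)
  case (add Y Y')
  then show ?case using X c by (simp add: T2.T.r_distr \<mu>r_add \<mu>_add_param)
next
  case (pt a b)
  show ?case using X
  proof (induction rule: T2.T_induct)
    case (add X X')
    then show ?case using pt c by (simp add: T2.T.l_distr \<mu>r_add)
  next
    case (pt a' b')
    then show ?case using \<open>a \<in> carrier A\<close> \<open>b \<in> carrier A\<close> c by (simp add: \<mu>r_pt A.m_assoc)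
  qed
qed

lemma antipode:
  assumes "x \<in> carrier A"
  shows "\<mu>l \<one>\<^bsub>A\<^esub> (\<Delta> x) = e0 x \<odot>\<^bsub>A\<^esub> \<one>\<^bsub>A\<^esub> \<and> \<mu>r \<one>\<^bsub>A\<^esub> (\<Delta> x) = e0 x \<odot>\<^bsub>A\<^esub> \<one>\<^bsub>A\<^esub>"
  using assms
proof (rule gen_induct)
  show "\<mu>l \<one>\<^bsub>A\<^esub> (\<Delta> \<one>\<^bsub>A\<^esub>) = e0 \<one>\<^bsub>A\<^esub> \<odot>\<^bsub>A\<^esub> \<one>\<^bsub>A\<^esub> \<and> \<mu>r \<one>\<^bsub>A\<^esub> (\<Delta> \<one>\<^bsub>A\<^esub>) = e0 \<one>\<^bsub>A\<^esub> \<odot>\<^bsub>A\<^esub> \<one>\<^bsub>A\<^esub>"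
    by (simp add: \<mu>l_pt \<mu>r_pt T2.pt_one)
next
  fix x y assume "x \<in> carrier A" "y \<in> carrier A"
    "\<mu>l \<one>\<^bsub>A\<^esub> (\<Delta> x) = e0 x \<odot>\<^bsub>A\<^esub> \<one>\<^bsub>A\<^esub> \<and> \<mu>r \<one>\<^bsub>A\<^esub> (\<Delta> x) = e0 x \<odot>\<^bsub>A\<^esub> \<one>\<^bsub>A\<^esub>"
    "\<mu>l \<one>\<^bsub>A\<^esub> (\<Delta> y) = e0 y \<odot>\<^bsub>A\<^esub> \<one>\<^bsub>A\<^esub> \<and> \<mu>r \<one>\<^bsub>A\<^esub> (\<Delta> y) = e0 y \<odot>\<^bsub>A\<^esub> \<one>\<^bsub>A\<^esub>"
  \<comment> \<open>For products, the contraction performed first is a scalar multiple of the unit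
    by hypothesis. The scalar can be pulled out of the parameter, and the second contraction is
    again one with the unit.\<close>
  then show "\<mu>l \<one>\<^bsub>A\<^esub> (\<Delta> (x \<oplus>\<^bsub>A\<^esub> y)) = e0 (x \<oplus>\<^bsub>A\<^esub> y) \<odot>\<^bsub>A\<^esub> \<one>\<^bsub>A\<^esub> \<and>
      \<mu>r \<one>\<^bsub>A\<^esub> (\<Delta> (x \<oplus>\<^bsub>A\<^esub> y)) = e0 (x \<oplus>\<^bsub>A\<^esub> y) \<odot>\<^bsub>A\<^esub> \<one>\<^bsub>A\<^esub>"
    and "\<mu>l \<one>\<^bsub>A\<^esub> (\<Delta> (x \<otimes>\<^bsub>A\<^esub> y)) = e0 (x \<otimes>\<^bsub>A\<^esub> y) \<odot>\<^bsub>A\<^esub> \<one>\<^bsub>A\<^esub> \<and>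
      \<mu>r \<one>\<^bsub>A\<^esub> (\<Delta> (x \<otimes>\<^bsub>A\<^esub> y)) = e0 (x \<otimes>\<^bsub>A\<^esub> y) \<odot>\<^bsub>A\<^esub> \<one>\<^bsub>A\<^esub>"
    by (simp_all add: \<mu>l_add \<mu>r_add \<mu>l_mult \<mu>r_mult \<mu>_smult_param A.smult_l_distr A.smult_assoc1
      A.R.m_comm[of "e0 x" "e0 y"]) (simp_all add: A.R.m_comm[of "e0 x" "e0 y"] flip: A.smult_assoc1)
next
  fix r x assume "r \<in> carrier R" "x \<in> carrier A"
    "\<mu>l \<one>\<^bsub>A\<^esub> (\<Delta> x) = e0 x \<odot>\<^bsub>A\<^esub> \<one>\<^bsub>A\<^esub> \<and> \<mu>r \<one>\<^bsub>A\<^esub> (\<Delta> x) = e0 x \<odot>\<^bsub>A\<^esub> \<one>\<^bsub>A\<^esub>"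
  then show "\<mu>l \<one>\<^bsub>A\<^esub> (\<Delta> (r \<odot>\<^bsub>A\<^esub> x)) = e0 (r \<odot>\<^bsub>A\<^esub> x) \<odot>\<^bsub>A\<^esub> \<one>\<^bsub>A\<^esub> \<and>
      \<mu>r \<one>\<^bsub>A\<^esub> (\<Delta> (r \<odot>\<^bsub>A\<^esub> x)) = e0 (r \<odot>\<^bsub>A\<^esub> x) \<odot>\<^bsub>A\<^esub> \<one>\<^bsub>A\<^esub>"
    by (simp add: \<mu>l_smult \<mu>r_smult A.smult_assoc1)
next
  fix b X x z assume g: "good b X x z"
  have c: "X \<in> carrier A" "x \<in> carrier A" "z \<in> carrier A" using good_closed[OF g] by simp_all
  \<comment> \<open>This is both the \<open>z\<close> term of the antipode of \<open>X\<close> and,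
    up to sign, the contribution of \<open>h2\<close> to the left contraction, because
    \<open>S h2\<close> contains the factor \<open>W 2\<close>.\<close>
  define q where "q = h \<otimes>\<^bsub>A\<^esub> (h \<ominus>\<^bsub>A\<^esub> \<one>\<^bsub>A\<^esub>) \<otimes>\<^bsub>A\<^esub> z"
  have q: "q \<in> carrier A" using c by (simp add: q_def)
  have SX: "S X = \<ominus>\<^bsub>A\<^esub> ((X \<oplus>\<^bsub>A\<^esub> h \<otimes>\<^bsub>A\<^esub> x \<ominus>\<^bsub>A\<^esub> q) \<otimes>\<^bsub>A\<^esub> W (- b))"
    unfolding q_def by (rule S_good(1)[OF g])
  have "\<mu>l \<one>\<^bsub>A\<^esub> (\<Delta> X) = S X \<otimes>\<^bsub>A\<^esub> W b \<oplus>\<^bsub>A\<^esub> X \<ominus>\<^bsub>A\<^esub> S h \<otimes>\<^bsub>A\<^esub> (W (- 1) \<otimes>\<^bsub>A\<^esub> x) \<ominus>\<^bsub>A\<^esub> S h2 \<otimes>\<^bsub>A\<^esub> (W (- 2) \<otimes>\<^bsub>A\<^esub> z)"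
    unfolding \<Delta>_good[OF g] using c by (simp add: a_minus_def \<mu>l_add \<mu>_minus \<mu>l_pt)
  also have "S X \<otimes>\<^bsub>A\<^esub> W b = \<ominus>\<^bsub>A\<^esub> (X \<oplus>\<^bsub>A\<^esub> h \<otimes>\<^bsub>A\<^esub> x \<ominus>\<^bsub>A\<^esub> q)"
    unfolding SX using c q by (simp add: A.l_minus A.m_assoc)
  also have "S h \<otimes>\<^bsub>A\<^esub> (W (- 1) \<otimes>\<^bsub>A\<^esub> x) = \<ominus>\<^bsub>A\<^esub> (h \<otimes>\<^bsub>A\<^esub> x)"
    using c by (simp add: S_h A.l_minus A.m_assoc J.w_W_assoc)
  also have "S h2 \<otimes>\<^bsub>A\<^esub> (W (- 2) \<otimes>\<^bsub>A\<^esub> z) = q"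
    unfolding S_h2 q_def using c by (simp add: A.m_assoc)
  also have "\<ominus>\<^bsub>A\<^esub> (X \<oplus>\<^bsub>A\<^esub> h \<otimes>\<^bsub>A\<^esub> x \<ominus>\<^bsub>A\<^esub> q) \<oplus>\<^bsub>A\<^esub> X \<ominus>\<^bsub>A\<^esub> \<ominus>\<^bsub>A\<^esub> (h \<otimes>\<^bsub>A\<^esub> x) \<ominus>\<^bsub>A\<^esub> q = \<zero>\<^bsub>A\<^esub>"
  proof -
    define y where "y = h \<otimes>\<^bsub>A\<^esub> x"
    have y: "y \<in> carrier A" using c by (simp add: y_def)
    have "X \<oplus>\<^bsub>A\<^esub> (y \<oplus>\<^bsub>A\<^esub> \<ominus>\<^bsub>A\<^esub> q) \<in> carrier A" using c y q by simp
    then show ?thesis unfolding y_def[symmetric] using c y q A.l_neg[of "X \<oplus>\<^bsub>A\<^esub> (y \<oplus>\<^bsub>A\<^esub> \<ominus>\<^bsub>A\<^esub> q)"]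
      by (simp add: a_minus_def A.a_assoc)
  qed
  finally have l: "\<mu>l \<one>\<^bsub>A\<^esub> (\<Delta> X) = \<zero>\<^bsub>A\<^esub>" .
  have "\<mu>r \<one>\<^bsub>A\<^esub> (\<Delta> X) = X \<otimes>\<^bsub>A\<^esub> W (- b) \<oplus>\<^bsub>A\<^esub> S X \<ominus>\<^bsub>A\<^esub> h \<otimes>\<^bsub>A\<^esub> S (W (- 1) \<otimes>\<^bsub>A\<^esub> x) \<ominus>\<^bsub>A\<^esub> h2 \<otimes>\<^bsub>A\<^esub> S (W (- 2) \<otimes>\<^bsub>A\<^esub> z)"
    unfolding \<Delta>_good[OF g] using c by (simp add: a_minus_def \<mu>r_add \<mu>_minus \<mu>r_pt S_W del: SD(2))
  also have "\<dots> = (X \<ominus>\<^bsub>A\<^esub> (X \<oplus>\<^bsub>A\<^esub> h \<otimes>\<^bsub>A\<^esub> x \<ominus>\<^bsub>A\<^esub> q) \<oplus>\<^bsub>A\<^esub>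
      h \<otimes>\<^bsub>A\<^esub> (x \<ominus>\<^bsub>A\<^esub> (h \<otimes>\<^bsub>A\<^esub> z \<oplus>\<^bsub>A\<^esub> h \<otimes>\<^bsub>A\<^esub> z)) \<oplus>\<^bsub>A\<^esub> h2 \<otimes>\<^bsub>A\<^esub> z) \<otimes>\<^bsub>A\<^esub> W (- b)"
    unfolding S_Wx[OF g] SX using c q by (simp add: a_minus_def A.l_distr A.l_minus A.r_minus A.m_assoc)
  also have "X \<ominus>\<^bsub>A\<^esub> (X \<oplus>\<^bsub>A\<^esub> h \<otimes>\<^bsub>A\<^esub> x \<ominus>\<^bsub>A\<^esub> q) \<oplus>\<^bsub>A\<^esub>
      h \<otimes>\<^bsub>A\<^esub> (x \<ominus>\<^bsub>A\<^esub> (h \<otimes>\<^bsub>A\<^esub> z \<oplus>\<^bsub>A\<^esub> h \<otimes>\<^bsub>A\<^esub> z)) \<oplus>\<^bsub>A\<^esub> h2 \<otimes>\<^bsub>A\<^esub> z = \<zero>\<^bsub>A\<^esub>"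
  \<comment> \<open>In these names the terms with \<open>z\<close> are
    \<open>(a - a') - (a + a) + (a + a')\<close>, and those with \<open>y\<close> are
    \<open>- y + y\<close>.\<close>
  proof -
    define y where "y = h \<otimes>\<^bsub>A\<^esub> x"
    define a where "a = h \<otimes>\<^bsub>A\<^esub> (h \<otimes>\<^bsub>A\<^esub> z)"
    define a' where "a' = h \<otimes>\<^bsub>A\<^esub> z"
    have y: "y \<in> carrier A" "a \<in> carrier A" "a' \<in> carrier A" using c by (simp_all add: y_def a_def a'_def)
    have "q = a \<ominus>\<^bsub>A\<^esub> a'" "h2 \<otimes>\<^bsub>A\<^esub> z = a \<oplus>\<^bsub>A\<^esub> a'"
      using c by (simp_all add: q_def a_def a'_def a_minus_def A.l_distr A.r_distr A.l_minus A.r_minus A.m_assoc)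
    moreover have "h \<otimes>\<^bsub>A\<^esub> (x \<ominus>\<^bsub>A\<^esub> (a' \<oplus>\<^bsub>A\<^esub> a')) = y \<ominus>\<^bsub>A\<^esub> (a \<oplus>\<^bsub>A\<^esub> a)"
      using c by (simp add: y_def a_def a'_def a_minus_def A.r_distr A.r_minus)
    ultimately show ?thesis unfolding a'_def[symmetric] y_def[symmetric] using c y
      by (simp add: a_minus_def A.minus_add A.a_assoc A.r_neg1 A.r_neg2 A.l_neg A.r_neg A.add_lcancel)
        (simp add: A.a_ac A.r_neg1 A.r_neg2 A.l_neg A.r_neg A.add_lcancel)
  qed
  finally have "\<mu>r \<one>\<^bsub>A\<^esub> (\<Delta> X) = \<zero>\<^bsub>A\<^esub>" by simp
  with l show "\<mu>l \<one>\<^bsub>A\<^esub> (\<Delta> X) = e0 X \<odot>\<^bsub>A\<^esub> \<one>\<^bsub>A\<^esub> \<and> \<mu>r \<one>\<^bsub>A\<^esub> (\<Delta> X) = e0 X \<odot>\<^bsub>A\<^esub> \<one>\<^bsub>A\<^esub>"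
    using e_good[OF g] by simp
qed

text \<open>Inserting the unit between two factors changes a map outside the carrier, so the maps in
  the Hopf axioms and the contractions with parameter are not equal as functions. Their lifts still
  agree on the tensor product.\<close>

lemma tensor_lift_cong:
  assumes "\<And>a b. a \<in> carrier A \<Longrightarrow> b \<in> carrier A \<Longrightarrow> \<beta> a b = \<beta>' a b"
    and "bilin R A A A \<beta>" and "bilin R A A A \<beta>'" and X: "X \<in> carrier T"
  shows "tensor_lift R A \<beta> X = tensor_lift R A \<beta>' X"
  using X
  by (induction rule: T2.T_induct)
    (simp_all add: T2.lift_add[OF A.module_axioms assms(2)] T2.lift_add[OF A.module_axioms assms(3)]
      T2.lift_pt[OF A.module_axioms assms(2)] T2.lift_pt[OF A.module_axioms assms(3)] assms(1))

lemma \<mu>_one: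
  assumes "X \<in> carrier T"
  shows "tensor_lift R A (\<lambda>a b. S a \<otimes>\<^bsub>A\<^esub> b) X = \<mu>l \<one>\<^bsub>A\<^esub> X" "tensor_lift R A (\<lambda>a b. a \<otimes>\<^bsub>A\<^esub> S b) X = \<mu>r \<one>\<^bsub>A\<^esub> X"
  unfolding \<mu>l_def \<mu>r_def
  by (rule tensor_lift_cong[OF _ _ S_bilin(1)[OF A.one_closed] assms], simp,
      rule bilinI; simp add: A.l_distr A.r_distr A.smult_mult_left A.smult_mult_right)
    (rule tensor_lift_cong[OF _ _ S_bilin(2)[OF A.one_closed] assms], simp,
      rule bilinI; simp add: A.l_distr A.r_distr A.smult_mult_left A.smult_mult_right)

theorem hopf: "hopf_algebra R A \<Delta> e0 S"
proof (intro hopf_algebra.intro hopf_algebra_axioms.intro A.assoc_algebra_axioms)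
  show "\<Delta> \<in> ring_hom A T" using \<Delta>_hom by (simp add: alg_hom_def)
  show "e0 \<in> ring_hom A R" by (rule ring_hom_memI) simp_all
qed (simp_all add: coassoc counit antipode \<mu>_one)

end

section \<open>Generators and primitive maps\<close>

lemma (in jordan_hopf) prim_smult:
  "r \<in> carrier R \<Longrightarrow> prim x \<Longrightarrow> prim (r \<odot>\<^bsub>A\<^esub> x)"
  using alg_homD(5)[OF D0, of r x] alg_homD(5)[OF S0, of r x] alg_homD(5)[OF e0, of r x]
  by (simp add: prim_def T2.T.smult_r_distr A.smult_r_minus)

lemma (in twist_ring) wt_mult:
  assumes "wt a X" "wt b Y"
  shows "wt (a + b) (X \<otimes> Y)"
proof -
  have c: "X \<in> carrier R" "Y \<in> carrier R" and e: "h \<otimes> X = X \<otimes> h \<oplus> [a] \<cdot> X" "h \<otimes> Y = Y \<otimes> h \<oplus> [b] \<cdot> Y"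
    using assms by (simp_all add: wt_def)
  have "h \<otimes> (X \<otimes> Y) = h \<otimes> X \<otimes> Y" using c by (simp add: m_assoc)
  also have "\<dots> = X \<otimes> (h \<otimes> Y) \<oplus> [a] \<cdot> (X \<otimes> Y)"
    unfolding e(1) using c by (simp add: l_distr m_assoc add_pow_ldistr_int)
  also have "\<dots> = X \<otimes> Y \<otimes> h \<oplus> [(a + b)] \<cdot> (X \<otimes> Y)"
    unfolding e(2) using c by (simp add: r_distr m_assoc add_pow_rdistr_int int_mult_add a_ac)
  finally show ?thesis using c by (simp add: wt_def)
qed

lemma (in twist_ring) wt_add: "wt a X \<Longrightarrow> wt a Y \<Longrightarrow> wt a (X \<oplus> Y)"
  by (simp add: wt_def r_distr l_distr int_mult_r_add a_ac)

section \<open>Matrix units and a spanning set of sl\<close>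

lemma matrix_unit_mult:
  "matrix_unit i j ** matrix_unit a b = (if j = a then matrix_unit i b else (0 :: 'k::field^'n^'n))"
proof -
  have "(\<Sum>c\<in>UNIV. (if x = i \<and> c = j then 1 else 0) * (if c = a \<and> y = b then 1 else 0)) =
      (if j = a \<and> x = i \<and> y = b then 1 else (0::'k))" for x y
  proof -
    have "(\<Sum>c\<in>UNIV. (if x = i \<and> c = j then 1 else 0) * (if c = a \<and> y = b then 1 else 0)) =
      (\<Sum>c\<in>UNIV. if c = j then (if x = i \<and> j = a \<and> y = b then 1 else 0) else (0::'k))"
      by (rule sum.cong) auto
    then show ?thesis by auto
  qed
  then show ?thesis by (simp add: vec_eq_iff matrix_matrix_mult_def matrix_unit_def)
qed

lemma matrix_mult_diff:
  "(X - Y) ** Z = X ** Z - Y ** (Z :: 'k::field^'n^'n)" "Z ** (X - Y) = Z ** X - Z ** (Y :: 'k::field^'n^'n)"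
  by (simp_all add: vec_eq_iff matrix_matrix_mult_def algebra_simps sum_subtractf)

lemma matrix_mult_zero: "0 ** Z = (0 :: 'k::field^'n^'n)" "Z ** 0 = (0 :: 'k::field^'n^'n)"
  by (simp_all add: vec_eq_iff matrix_matrix_mult_def)

lemma trace_matrix_unit: "trace (matrix_unit i j :: 'k::field^'n^'n) = (if i = j then 1 else 0)"
proof -
  have "trace (matrix_unit i j :: 'k^'n^'n) = (\<Sum>a\<in>UNIV. if a = i then (if i = j then 1 else 0) else 0)"
    unfolding trace_def by (rule sum.cong) (auto simp: matrix_unit_def)
  then show ?thesis by simp
qed

lemma matrix_unit_sl: "i \<noteq> j \<Longrightarrow> matrix_unit i j \<in> sl"
  by (simp add: sl_def trace_matrix_unit)

lemma matrix_unit_diff_sl: "matrix_unit i i - matrix_unit j j \<in> sl"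
  by (simp add: sl_def trace_matrix_unit trace_sub)

context sl_char
begin

lemma zero_sl: "0 \<in> SL"
  using matrix_unit_diff_sl[of undefined undefined] by simp

lemma sum_sl: "finite I \<Longrightarrow> (\<And>i. i \<in> I \<Longrightarrow> f i \<in> SL) \<Longrightarrow> sum f I \<in> SL"
  by (induction I rule: finite_induct) (simp_all add: zero_sl sl_add)

text \<open>A matrix of trace zero is the sum of its off-diagonal parts and of the multiples
  \<open>X_ii (E_ii - E_k0k0)\<close>: the corrections at the fixed position \<open>k0\<close> add
  up to the trace.\<close>

lemma sl_induct [consumes 1, case_names unit diff add scale zero]:
  assumes X: "X \<in> SL"
    and unit: "\<And>i j. i \<noteq> j \<Longrightarrow> Q (matrix_unit i j)"
    and diff: "\<And>i j. i \<noteq> j \<Longrightarrow> Q (matrix_unit i i - matrix_unit j j)"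
    and add: "\<And>X Y. X \<in> SL \<Longrightarrow> Y \<in> SL \<Longrightarrow> Q X \<Longrightarrow> Q Y \<Longrightarrow> Q (X + Y)"
    and scale: "\<And>c X. X \<in> SL \<Longrightarrow> Q X \<Longrightarrow> Q (map_matrix (\<lambda>x. c * x) X)"
    and zero: "Q 0"
  shows "Q X"
proof -
  \<comment> \<open>Any index can serve; it absorbs the trace. For \<open>i = k0\<close> the
    difference of units is zero, which is where the case \<open>zero\<close> is used.\<close>
  define k0 :: 'n where "k0 = undefined"
  define g where "g ij = map_matrix (\<lambda>x. X $ fst ij $ snd ij * x)
    (if fst ij = snd ij then matrix_unit (fst ij) (fst ij) - matrix_unit k0 k0 else matrix_unit (fst ij) (snd ij))"
    for ij :: "'n \<times> 'n"
  have g: "g ij \<in> SL \<and> Q (g ij)" for ij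
  proof -
    obtain i j where ij: "ij = (i, j)" by (cases ij)
    show ?thesis
    proof (cases "i = j")
      case True
      then show ?thesis unfolding ij g_def using diff[of i k0] zero
        by (cases "i = k0") (auto intro!: sl_scale scale matrix_unit_diff_sl simp: zero_sl)
    next
      case False
      then show ?thesis unfolding ij g_def using unit[of i j]
        by (auto intro!: sl_scale scale matrix_unit_sl)
    qed
  qed
  have "Q (sum g I)" if "finite I" for I
    using that by (induction I rule: finite_induct) (simp_all add: zero add g sum_sl)
  then have "Q (sum g UNIV)" by simp
  moreover have "sum g UNIV = X"
  proof -
    have "sum g UNIV $ a $ b = X $ a $ b" for a b
    proof -
      have "sum g UNIV $ a $ b = (\<Sum>ij\<in>UNIV. (if ij = (a, b) then X $ a $ b else 0) -
          (if fst ij = snd ij \<and> a = k0 \<and> b = k0 then X $ fst ij $ fst ij else 0))"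
        unfolding sum_component by (rule sum.cong) (auto simp: g_def map_matrix_def matrix_unit_def)
      also have "\<dots> = X $ a $ b - (\<Sum>ij\<in>UNIV. (if fst ij = snd ij \<and> a = k0 \<and> b = k0 then X $ fst ij $ fst ij else 0))"
        by (simp add: sum_subtractf)
      also have "(\<Sum>ij\<in>UNIV. (if fst ij = snd ij \<and> a = k0 \<and> b = k0 then X $ fst ij $ fst ij else 0)) = 0"
      proof (cases "a = k0 \<and> b = k0")
        case True
        have "(\<Sum>ij\<in>UNIV. (if fst ij = snd ij then X $ fst ij $ fst ij else 0)) =
            (\<Sum>i\<in>UNIV. \<Sum>j\<in>UNIV. if i = j then X $ i $ i else 0)"
          using sum.cartesian_product[of "\<lambda>i j. if i = j then X $ i $ i else 0" UNIV UNIV]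
          by (simp only: UNIV_Times_UNIV split_def)
        also have "\<dots> = trace X" by (simp add: trace_def)
        finally show ?thesis using True X by (simp add: sl_def)
      qed auto
      finally show ?thesis by simp
    qed
    then show ?thesis by (simp add: vec_eq_iff)
  qed
  ultimately show ?thesis by simp
qed

lemma G_zero: "G 0 = \<zero>\<^bsub>A\<^esub>"
proof -
  interpret AA: assoc_algebra R A by (rule A_algebra)
  have "G 0 \<oplus>\<^bsub>A\<^esub> G 0 = G 0" using G_add[OF zero_sl zero_sl] by simp
  then show ?thesis using G_closed[OF zero_sl] by simp
qed

lemma G_uminus:
  assumes "X \<in> SL"
  shows "- X \<in> SL" "G (- X) = \<ominus>\<^bsub>A\<^esub> G X"
proof -
  interpret AA: assoc_algebra R A by (rule A_algebra)
  have "- X = map_matrix (\<lambda>x. - 1 * x) X" by (simp add: vec_eq_iff map_matrix_def)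
  then show m: "- X \<in> SL" using sl_scale[OF assms] by metis
  have "G (- X) \<oplus>\<^bsub>A\<^esub> G X = \<zero>\<^bsub>A\<^esub>" using G_add[OF m assms] G_zero by simp
  then show "G (- X) = \<ominus>\<^bsub>A\<^esub> G X" using AA.minus_equality m assms by simp
qed

lemma G_int:
  assumes "X \<in> SL"
  shows "G (map_matrix (\<lambda>x. of_int c * x) X) = [c] \<cdot>\<^bsub>A\<^esub> G X"
proof -
  interpret AA: assoc_algebra R A by (rule A_algebra)
  have n: "map_matrix (\<lambda>x. of_nat k * x) X \<in> SL \<and> G (map_matrix (\<lambda>x. of_nat k * x) X) = [k] \<cdot>\<^bsub>A\<^esub> G X" for k :: nat
  proof (induction k)
    case 0
    have "map_matrix (\<lambda>x. of_nat 0 * x) X = 0" by (simp add: vec_eq_iff map_matrix_def)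
    then show ?case by (simp add: zero_sl G_zero)
  next
    case (Suc k)
    have "map_matrix (\<lambda>x. of_nat (Suc k) * x) X = map_matrix (\<lambda>x. of_nat k * x) X + X"
      by (simp add: vec_eq_iff map_matrix_def algebra_simps)
    then show ?case using Suc assms by (simp add: G_add sl_add)
  qed
  show ?thesis
  proof (cases "c \<ge> 0")
    case True
    then show ?thesis using n[of "nat c"] by (simp add: add_pow_int_ge)
  next
    case False
    have "map_matrix (\<lambda>x. of_int c * x) X = - map_matrix (\<lambda>x. of_nat (nat (- c)) * x) X"
      using False by (simp add: vec_eq_iff map_matrix_def)
    then show ?thesis using n[of "nat (- c)"] False by (simp add: add_pow_int_lt G_uminus)
  qed
qed

text \<open>All three assignments respect the presentation. The p-th power relation holds for the
  coproduct because \<open>X \<otimes> 1\<close> and \<open>1 \<otimes> X\<close> commute and the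
  Frobenius identity applies, and for the antipode because \<open>(- X)^p = - X^p\<close> in
  characteristic \<open>p\<close>.\<close>

lemma primitive_maps:
  shows "\<exists>D0 \<in> alg_hom R A (tensor R A A). \<forall>X \<in> SL. D0 (G X) =
      pure_tensor R A A (G X) \<one>\<^bsub>A\<^esub> \<oplus>\<^bsub>tensor R A A\<^esub> pure_tensor R A A \<one>\<^bsub>A\<^esub> (G X)"
    and "\<exists>S0 \<in> alg_hom R A (opp A). \<forall>X \<in> SL. S0 (G X) = \<ominus>\<^bsub>A\<^esub> G X"
    and "\<exists>e0 \<in> alg_hom R A (self_alg R). \<forall>X \<in> SL. e0 (G X) = \<zero>\<^bsub>R\<^esub>"
proof -
  interpret AA: assoc_algebra R A by (rule A_algebra)
  interpret T: two_algebras R A A by (intro two_algebras.intro A_algebra)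
  interpret C: char_p_ring A p by unfold_locales (simp_all add: prime A_char)
  let ?f = "\<lambda>X. T.pt (G X) \<one>\<^bsub>A\<^esub> \<oplus>\<^bsub>T.T\<^esub> T.pt \<one>\<^bsub>A\<^esub> (G X)"
  have ch: "[p] \<cdot>\<^bsub>T.T\<^esub> z = \<zero>\<^bsub>T.T\<^esub>" if "z \<in> carrier T.T" for z
    using add_pow_smult_one[OF T.T_algebra that, of p] R_char that by simp
  have l: "(\<lambda>a. T.pt a \<one>\<^bsub>A\<^esub>) \<in> alg_hom R A T.T" "(\<lambda>a. T.pt \<one>\<^bsub>A\<^esub> a) \<in> alg_hom R A T.T"
    by (rule alg_homI; simp add: T.pt_one)+
  show "\<exists>D0 \<in> alg_hom R A T.T. \<forall>X \<in> SL. D0 (G X) = ?f X"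
  proof (rule A_universal[OF T.T_algebra])
    fix X Y assume XY: "X \<in> SL" "Y \<in> SL"
    show "?f (X + Y) = ?f X \<oplus>\<^bsub>T.T\<^esub> ?f Y" using XY by (simp add: G_add T.T.a_ac)
    show "?f (X ** Y - Y ** X) = ?f X \<otimes>\<^bsub>T.T\<^esub> ?f Y \<ominus>\<^bsub>T.T\<^esub> ?f Y \<otimes>\<^bsub>T.T\<^esub> ?f X"
    proof -
      \<comment> \<open>Here \<open>u\<close> and \<open>v\<close> stand for the mixed terms, which
        occur in both products of the commutator and cancel.\<close>
      have *: "a \<oplus>\<^bsub>T.T\<^esub> \<ominus>\<^bsub>T.T\<^esub> b \<oplus>\<^bsub>T.T\<^esub> (c \<oplus>\<^bsub>T.T\<^esub> \<ominus>\<^bsub>T.T\<^esub> d) =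
          a \<oplus>\<^bsub>T.T\<^esub> u \<oplus>\<^bsub>T.T\<^esub> (v \<oplus>\<^bsub>T.T\<^esub> c) \<oplus>\<^bsub>T.T\<^esub> \<ominus>\<^bsub>T.T\<^esub> (b \<oplus>\<^bsub>T.T\<^esub> v \<oplus>\<^bsub>T.T\<^esub> (u \<oplus>\<^bsub>T.T\<^esub> d))"
        if "a \<in> carrier T.T" "b \<in> carrier T.T" "c \<in> carrier T.T" "d \<in> carrier T.T" "u \<in> carrier T.T" "v \<in> carrier T.T"
        for a b c d u v
      proof -
        have **: "x \<oplus>\<^bsub>T.T\<^esub> y \<oplus>\<^bsub>T.T\<^esub> \<ominus>\<^bsub>T.T\<^esub> (z \<oplus>\<^bsub>T.T\<^esub> y) = x \<oplus>\<^bsub>T.T\<^esub> \<ominus>\<^bsub>T.T\<^esub> z"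
          if "x \<in> carrier T.T" "y \<in> carrier T.T" "z \<in> carrier T.T" for x y z
          using that T.T.a_comm[of "\<ominus>\<^bsub>T.T\<^esub> z" "\<ominus>\<^bsub>T.T\<^esub> y"]
          by (simp add: T.T.minus_add T.T.a_assoc T.T.r_neg2)
        have "a \<oplus>\<^bsub>T.T\<^esub> \<ominus>\<^bsub>T.T\<^esub> b \<oplus>\<^bsub>T.T\<^esub> (c \<oplus>\<^bsub>T.T\<^esub> \<ominus>\<^bsub>T.T\<^esub> d) = (a \<oplus>\<^bsub>T.T\<^esub> c) \<oplus>\<^bsub>T.T\<^esub> \<ominus>\<^bsub>T.T\<^esub> (b \<oplus>\<^bsub>T.T\<^esub> d)"
          using that by (simp add: T.T.minus_add T.T.a_ac)
        also have "\<dots> = (a \<oplus>\<^bsub>T.T\<^esub> c) \<oplus>\<^bsub>T.T\<^esub> (u \<oplus>\<^bsub>T.T\<^esub> v) \<oplus>\<^bsub>T.T\<^esub> \<ominus>\<^bsub>T.T\<^esub> ((b \<oplus>\<^bsub>T.T\<^esub> d) \<oplus>\<^bsub>T.T\<^esub> (u \<oplus>\<^bsub>T.T\<^esub> v))"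
          using that by (simp add: **)
        finally show ?thesis using that by (simp add: T.T.a_ac)
      qed
      show ?thesis using XY
        by (simp add: G_comm a_minus_def T.T.l_distr T.T.r_distr)
          (subst *[of _ _ _ _ "T.pt (G X) (G Y)" "T.pt (G Y) (G X)"], simp_all add: T.T.a_ac)
    qed
    show "?f (map_matrix (\<lambda>x. c * x) X) = (c \<odot>\<^bsub>R\<^esub> \<one>\<^bsub>R\<^esub>) \<odot>\<^bsub>T.T\<^esub> ?f X" for c
    proof -
      interpret RR: assoc_algebra K R by (rule tpoly_assoc)
      show ?thesis using XY by (simp add: G_scale T.T.smult_r_distr)
    qed
    show "?f (matrix_power X p) = ?f X [^]\<^bsub>T.T\<^esub> p"
    proof -
      have "?f X [^]\<^bsub>T.T\<^esub> p = T.pt (G X) \<one>\<^bsub>A\<^esub> [^]\<^bsub>T.T\<^esub> p \<oplus>\<^bsub>T.T\<^esub> T.pt \<one>\<^bsub>A\<^esub> (G X) [^]\<^bsub>T.T\<^esub> p"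
        by (rule frobenius_add[OF T.T.ring_axioms _ _ _ prime ch]) (use XY in simp_all)
      then show ?thesis using XY
          alg_hom_pow[OF AA.ring_axioms T.T.ring_axioms l(1), of "G X" p]
          alg_hom_pow[OF AA.ring_axioms T.T.ring_axioms l(2), of "G X" p]
        by (simp add: G_pow)
    qed
  qed simp
  show "\<exists>S0 \<in> alg_hom R A (opp A). \<forall>X \<in> SL. S0 (G X) = \<ominus>\<^bsub>A\<^esub> G X"
  proof (rule A_universal[OF opp_algebra[OF A_algebra]])
    interpret O: assoc_algebra R "opp A" by (rule opp_algebra[OF A_algebra])
    fix X Y assume XY: "X \<in> SL" "Y \<in> SL"
    have om: "\<ominus>\<^bsub>opp A\<^esub> y = \<ominus>\<^bsub>A\<^esub> y" if "y \<in> carrier A" for y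
      by (rule O.minus_equality) (use that in \<open>simp_all add: AA.l_neg\<close>)
    have op: "y [^]\<^bsub>opp A\<^esub> i = y [^]\<^bsub>A\<^esub> i" if "y \<in> carrier A" for y and i :: nat
    proof (induction i)
      case (Suc i)
      then show ?case using that AA.nat_pow_Suc2[of y i] by simp
    qed (simp add: nat_pow_def)
    show "\<ominus>\<^bsub>A\<^esub> G (X + Y) = \<ominus>\<^bsub>A\<^esub> G X \<oplus>\<^bsub>opp A\<^esub> \<ominus>\<^bsub>A\<^esub> G Y"
      using XY by (simp add: G_add AA.minus_add)
    show "\<ominus>\<^bsub>A\<^esub> G (X ** Y - Y ** X) = \<ominus>\<^bsub>A\<^esub> G X \<otimes>\<^bsub>opp A\<^esub> \<ominus>\<^bsub>A\<^esub> G Y \<ominus>\<^bsub>opp A\<^esub> \<ominus>\<^bsub>A\<^esub> G Y \<otimes>\<^bsub>opp A\<^esub> \<ominus>\<^bsub>A\<^esub> G X"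
      using XY by (simp add: G_comm a_minus_def om AA.l_minus AA.r_minus AA.minus_add AA.a_ac)
    show "\<ominus>\<^bsub>A\<^esub> G (map_matrix (\<lambda>x. c * x) X) = (c \<odot>\<^bsub>R\<^esub> \<one>\<^bsub>R\<^esub>) \<odot>\<^bsub>opp A\<^esub> \<ominus>\<^bsub>A\<^esub> G X" for c
    proof -
      interpret RR: assoc_algebra K R by (rule tpoly_assoc)
      show ?thesis using XY by (simp add: G_scale AA.smult_r_minus)
    qed
    show "\<ominus>\<^bsub>A\<^esub> G (matrix_power X p) = (\<ominus>\<^bsub>A\<^esub> G X) [^]\<^bsub>opp A\<^esub> p"
      using XY by (simp add: op G_pow C.minus_pow_p)
  qed simp
  show "\<exists>e0 \<in> alg_hom R A (self_alg R). \<forall>X \<in> SL. e0 (G X) = \<zero>\<^bsub>R\<^esub>"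
  proof (rule A_universal[OF self_alg_algebra[OF tpoly_cring]])
    interpret RR: cring R by (rule tpoly_cring)
    interpret E: assoc_algebra R "self_alg R" by (rule self_alg_algebra[OF tpoly_cring])
    fix X Y :: "'k^'n^'n"
    show "\<zero>\<^bsub>R\<^esub> = (c \<odot>\<^bsub>R\<^esub> \<one>\<^bsub>R\<^esub>) \<odot>\<^bsub>self_alg R\<^esub> \<zero>\<^bsub>R\<^esub>" for c
    proof -
      interpret RK: assoc_algebra K R by (rule tpoly_assoc)
      show ?thesis by simp
    qed
    show "\<zero>\<^bsub>R\<^esub> = \<zero>\<^bsub>R\<^esub> \<otimes>\<^bsub>self_alg R\<^esub> \<zero>\<^bsub>R\<^esub> \<ominus>\<^bsub>self_alg R\<^esub> \<zero>\<^bsub>R\<^esub> \<otimes>\<^bsub>self_alg R\<^esub> \<zero>\<^bsub>R\<^esub>"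
      using E.r_neg[of "\<zero>\<^bsub>R\<^esub>"] by (simp add: a_minus_def)
    show "\<zero>\<^bsub>R\<^esub> = \<zero>\<^bsub>R\<^esub> [^]\<^bsub>self_alg R\<^esub> p"
      using E.nat_pow_zero[of p] prime_gt_0_nat[OF prime] by simp
  qed simp_all
qed

end

section \<open>The Jordanian quantization\<close>

locale jordanian_sl = sl_char p q n_type
  for p and q :: "'k::field" and n_type :: "'n::finite itself" +
  fixes k k' m :: 'n
  assumes kk': "k \<noteq> k'" and km: "k \<noteq> m" and k'm: "k' \<noteq> m"
begin

abbreviation E where "E i j \<equiv> G (matrix_unit i j)"
abbreviation H where "H i j \<equiv> G (matrix_unit i i - matrix_unit j j)"
text \<open>This is the bracket of \<open>E_km\<close> with \<open>E_ji\<close>, as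
  \<open>Dm_eq\<close> shows; for j = m and i = k it is the diagonal matrix
  \<open>E_kk - E_mm\<close>.\<close>

abbreviation Dm :: "'n \<Rightarrow> 'n \<Rightarrow> 'k^'n^'n" where
  "Dm j i \<equiv> (if j = m then matrix_unit k i else 0) - (if i = k then matrix_unit j m else 0)"
abbreviation e where "e \<equiv> E k m"
abbreviation h where "h \<equiv> H k k'"
abbreviation t where "t \<equiv> tvar p q \<odot>\<^bsub>A\<^esub> \<one>\<^bsub>A\<^esub>"
abbreviation n where "n \<equiv> e \<otimes>\<^bsub>A\<^esub> t"

sublocale A: assoc_algebra R A
  by (rule A_algebra)

lemma E_closed [simp]: "i \<noteq> j \<Longrightarrow> E i j \<in> carrier A"
  by (simp add: matrix_unit_sl)

lemma H_closed [simp]: "H i j \<in> carrier A"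
  by (simp add: matrix_unit_diff_sl)

lemma e_closed [simp]: "e \<in> carrier A"
  using km by simp

lemma t_closed [simp]: "t \<in> carrier A"
  by (simp add: tvar_closed)

lemma mult_t: "y \<in> carrier A \<Longrightarrow> y \<otimes>\<^bsub>A\<^esub> t = tvar p q \<odot>\<^bsub>A\<^esub> y"
  by (simp add: tvar_closed A.smult_mult_right)

lemma t_mult: "y \<in> carrier A \<Longrightarrow> t \<otimes>\<^bsub>A\<^esub> y = y \<otimes>\<^bsub>A\<^esub> t"
  by (simp add: tvar_closed A.smult_mult_right A.smult_mult_left)

lemma commutator_G:
  assumes "X \<in> SL" "Y \<in> SL"
  shows "G X \<otimes>\<^bsub>A\<^esub> G Y = G Y \<otimes>\<^bsub>A\<^esub> G X \<oplus>\<^bsub>A\<^esub> G (X ** Y - Y ** X)"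
  using assms by (simp add: G_comm a_minus_def A.a_ac A.r_neg2 A.l_neg A.r_neg)

lemma commutator_n:
  assumes "X \<in> SL"
  shows "n \<otimes>\<^bsub>A\<^esub> G X = G X \<otimes>\<^bsub>A\<^esub> n \<oplus>\<^bsub>A\<^esub> G (matrix_unit k m ** X - X ** matrix_unit k m) \<otimes>\<^bsub>A\<^esub> t"
proof -
  have "n \<otimes>\<^bsub>A\<^esub> G X = e \<otimes>\<^bsub>A\<^esub> G X \<otimes>\<^bsub>A\<^esub> t" using assms by (simp add: A.m_assoc t_mult)
  also have "e \<otimes>\<^bsub>A\<^esub> G X = G X \<otimes>\<^bsub>A\<^esub> e \<oplus>\<^bsub>A\<^esub> G (matrix_unit k m ** X - X ** matrix_unit k m)"
    by (rule commutator_G[OF matrix_unit_sl[OF km] assms])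
  finally show ?thesis using assms sl_comm[of "matrix_unit k m" X] by (simp add: A.l_distr A.m_assoc)
qed

text \<open>The powers of \<open>E_kk - E_k'k'\<close> with positive exponent alternate in the sign
  of the second unit. At exponent \<open>p\<close> the sign is -1 by the Frobenius identity, also
  for p = 2.\<close>

lemma H_power: "matrix_power (matrix_unit k k - matrix_unit k' k') p = matrix_unit k k - (matrix_unit k' k' :: 'k^'n^'n)"
proof -
  let ?M = "matrix_unit k k - matrix_unit k' k' :: 'k^'n^'n"
  have "matrix_power ?M (Suc r) = matrix_unit k k + (\<chi> i j. (- 1) ^ Suc r * matrix_unit k' k' $ i $ j)" for r
  proof (induction r)
    case 0
    then show ?case by (simp add: matrix_power_def vec_eq_iff)
  next
    case (Suc r)
    have step: "?M ** (matrix_unit k k + (\<chi> i j. c * matrix_unit k' k' $ i $ j)) =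
        matrix_unit k k + (\<chi> i j. - c * matrix_unit k' k' $ i $ j)" for c
    proof -
      have scale: "M ** (\<chi> i j. c * Z $ i $ j) = (\<chi> i j. c * (M ** Z) $ i $ j)" for M Z :: "'k^'n^'n"
        by (simp add: vec_eq_iff matrix_matrix_mult_def sum_distrib_left mult_ac)
      have add: "M ** (X + Y) = M ** X + M ** Y" for M X Y :: "'k^'n^'n"
        by (simp add: vec_eq_iff matrix_matrix_mult_def algebra_simps sum.distrib)
      have "?M ** matrix_unit k k = matrix_unit k k" "?M ** matrix_unit k' k' = - matrix_unit k' k'"
        using kk' by (simp_all add: matrix_mult_diff matrix_unit_mult)
      then show ?thesis unfolding add scale by (simp add: vec_eq_iff)
    qed
    show ?case unfolding matrix_power_Suc[of _ "Suc r"] Suc step by simp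
  qed
  from this[of "p - 1"] have "matrix_power ?M p = matrix_unit k k + (\<chi> i j. (- 1) ^ p * matrix_unit k' k' $ i $ j)"
    using prime_gt_0_nat[OF prime] by simp
  moreover have "(- 1 :: 'k) ^ p = - 1"
  proof -
    have "(1 + (- 1) :: 'k) ^ p = 1 ^ p + (- 1) ^ p" using char prime by (intro freshmans_dream) auto
    then show ?thesis using prime_gt_0_nat[OF prime] by (simp add: zero_power add_eq_0_iff)
  qed
  ultimately show ?thesis by (simp add: vec_eq_iff)
qed

lemma e_power: "matrix_power (matrix_unit k m) p = (0 :: 'k^'n^'n)"
proof -
  obtain r where r: "p = Suc (Suc r)" using less_imp_Suc_add[OF prime_gt_1_nat[OF prime]] by auto
  have "matrix_unit k m ** (matrix_unit k m ** Z) = (0 :: 'k^'n^'n)" for Z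
    using km by (simp add: matrix_mul_assoc matrix_unit_mult matrix_mult_zero)
  then show ?thesis unfolding r matrix_power_Suc by simp
qed

lemma smult_pow: "r \<in> carrier R \<Longrightarrow> y \<in> carrier A \<Longrightarrow> (r \<odot>\<^bsub>A\<^esub> y) [^]\<^bsub>A\<^esub> (i::nat) = (r [^]\<^bsub>R\<^esub> i) \<odot>\<^bsub>A\<^esub> (y [^]\<^bsub>A\<^esub> i)"
  by (induction i)
    (simp_all add: A.smult_mult_left A.smult_mult_right A.R.m_comm flip: A.smult_assoc1)

lemma h_matrix: "matrix_unit k k - matrix_unit k' k' \<in> SL"
  by (rule matrix_unit_diff_sl)

lemma bracket_h_unit:
  "(matrix_unit k k - matrix_unit k' k') ** matrix_unit j i - matrix_unit j i ** (matrix_unit k k - matrix_unit k' k') =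
    map_matrix (\<lambda>x. of_int (kdelta j k - kdelta i k - kdelta j k' + kdelta i k') * x) (matrix_unit j i :: 'k^'n^'n)"
  using kk' by (auto simp: matrix_mult_diff matrix_unit_mult kdelta_def vec_eq_iff map_matrix_def)

lemma h_G_unit:
  assumes "j \<noteq> i"
  shows "h \<otimes>\<^bsub>A\<^esub> E j i = E j i \<otimes>\<^bsub>A\<^esub> h \<oplus>\<^bsub>A\<^esub> [(kdelta j k - kdelta i k - kdelta j k' + kdelta i k')] \<cdot>\<^bsub>A\<^esub> E j i"
  unfolding commutator_G[OF h_matrix matrix_unit_sl[OF assms]] bracket_h_unit
    G_int[OF matrix_unit_sl[OF assms]] by (rule refl)

sublocale J: jordan_ring A p h n
proof unfold_locales
  show "h [^]\<^bsub>A\<^esub> p = h" using G_pow[OF h_matrix] by (simp add: H_power)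
  have "e [^]\<^bsub>A\<^esub> p = \<zero>\<^bsub>A\<^esub>" using G_pow[OF matrix_unit_sl[OF km]] by (simp add: e_power G_zero)
  then show "n [^]\<^bsub>A\<^esub> p = \<zero>\<^bsub>A\<^esub>" by (simp add: mult_t smult_pow tvar_closed)
  have "h \<otimes>\<^bsub>A\<^esub> e = e \<otimes>\<^bsub>A\<^esub> h \<oplus>\<^bsub>A\<^esub> [(1::int)] \<cdot>\<^bsub>A\<^esub> e"
    using h_G_unit[OF km] kk' km k'm by (simp add: kdelta_def)
  then have he: "h \<otimes>\<^bsub>A\<^esub> e = e \<otimes>\<^bsub>A\<^esub> h \<oplus>\<^bsub>A\<^esub> e" by (simp add: A.add.int_pow_1)
  have "h \<otimes>\<^bsub>A\<^esub> n = (h \<otimes>\<^bsub>A\<^esub> e) \<otimes>\<^bsub>A\<^esub> t" by (simp add: A.m_assoc)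
  then show "h \<otimes>\<^bsub>A\<^esub> n = n \<otimes>\<^bsub>A\<^esub> h \<oplus>\<^bsub>A\<^esub> n"
    unfolding he by (simp add: A.l_distr A.m_assoc t_mult)
qed (simp_all add: prime A_char)

lemma wt_t: "J.wt b y \<Longrightarrow> J.wt b (y \<otimes>\<^bsub>A\<^esub> t)"
  using J.wt_mult[of b y 0 t] t_mult[of h] by (simp add: J.wt_def)

lemma wt_e: "J.wt 1 e"
  using h_G_unit[OF km] kk' km k'm by (simp add: J.wt_def kdelta_def)

text \<open>Weights add under multiplication and \<open>n\<close> has weight 1, so a commutator with
  \<open>n\<close> has weight one more than \<open>X\<close>.\<close>

lemma wt_commutator:
  assumes "J.wt b X" "n \<otimes>\<^bsub>A\<^esub> X = X \<otimes>\<^bsub>A\<^esub> n \<oplus>\<^bsub>A\<^esub> x" "x \<in> carrier A"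
  shows "J.wt (b + 1) x"
proof -
  have X: "X \<in> carrier A" using assms(1) by (simp add: J.wt_def)
  have "x = n \<otimes>\<^bsub>A\<^esub> X \<oplus>\<^bsub>A\<^esub> \<ominus>\<^bsub>A\<^esub> (X \<otimes>\<^bsub>A\<^esub> n)"
    unfolding assms(2) using X assms(3) A.a_comm[of "X \<otimes>\<^bsub>A\<^esub> n" x] by (simp add: A.a_assoc A.r_neg)
  moreover have "J.wt (b + 1) (n \<otimes>\<^bsub>A\<^esub> X \<oplus>\<^bsub>A\<^esub> \<ominus>\<^bsub>A\<^esub> (X \<otimes>\<^bsub>A\<^esub> n))"
    using J.wt_mult[OF J.wt_n assms(1)] J.wt_mult[OF assms(1) J.wt_n]
    by (intro J.wt_add J.wt_minus) (simp_all add: add.commute)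
  ultimately show ?thesis by simp
qed

lemma Dm_eq: "matrix_unit k m ** matrix_unit j i - matrix_unit j i ** matrix_unit k m = (Dm j i :: 'k^'n^'n)"
  by (auto simp: matrix_unit_mult)

lemma Dm_sl: "Dm j i \<in> SL"
  unfolding Dm_eq[symmetric] by (rule sl_comm)

text \<open>The double bracket with \<open>E_km\<close> vanishes on all off-diagonal units except
  \<open>E_mk\<close>, where it is the bracket of \<open>E_km\<close> with
  \<open>E_kk - E_mm\<close>, that is -2 times \<open>E_km\<close>. The Kronecker factors single out
  this unit.\<close>

lemma bracket_Dm:
  "matrix_unit k m ** Dm j i - Dm j i ** matrix_unit k m =
    map_matrix (\<lambda>x. of_int (- 2 * (kdelta j m * kdelta i k)) * x) (matrix_unit k m :: 'k^'n^'n)"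
  using km by (auto simp: matrix_mult_diff matrix_mult_zero matrix_unit_mult kdelta_def vec_eq_iff map_matrix_def)

lemma bracket_diff:
  "matrix_unit k m ** (matrix_unit i i - matrix_unit j j) - (matrix_unit i i - matrix_unit j j) ** matrix_unit k m =
    map_matrix (\<lambda>x. of_int (- (kdelta i k - kdelta j k - kdelta i m + kdelta j m)) * x) (matrix_unit k m :: 'k^'n^'n)"
  using km by (auto simp: matrix_mult_diff matrix_mult_zero matrix_unit_mult kdelta_def vec_eq_iff map_matrix_def)

lemma bracket_h_diff:
  "(matrix_unit k k - matrix_unit k' k') ** (matrix_unit i i - matrix_unit j j) -
    (matrix_unit i i - matrix_unit j j) ** (matrix_unit k k - matrix_unit k' k') = (0 :: 'k^'n^'n)"
  by (auto simp: matrix_mult_diff matrix_unit_mult)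

lemma e_n: "n \<otimes>\<^bsub>A\<^esub> e = e \<otimes>\<^bsub>A\<^esub> n"
  by (simp add: A.m_assoc t_mult)

text \<open>The middle member is the bracket with \<open>e\<close>, multiplied by \<open>t\<close>;
  the last one is present for \<open>E_mk\<close> only, and its integer coefficient joins both cases
  in one formula.\<close>

lemma good_E:
  assumes ji: "j \<noteq> i"
  shows "J.good (kdelta j k - kdelta i k - kdelta j k' + kdelta i k') (E j i) (G (Dm j i) \<otimes>\<^bsub>A\<^esub> t)
    ([(kdelta j m * kdelta i k)] \<cdot>\<^bsub>A\<^esub> (e \<otimes>\<^bsub>A\<^esub> t [^]\<^bsub>A\<^esub> (2::nat)))"
    (is "J.good ?b ?X ?x ?z")
proof -
  have D: "G (Dm j i) \<in> carrier A" by (rule G_closed[OF Dm_sl])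
  have X: "J.wt ?b ?X" using h_G_unit[OF ji] ji by (simp add: J.wt_def)
  have nX: "n \<otimes>\<^bsub>A\<^esub> ?X = ?X \<otimes>\<^bsub>A\<^esub> n \<oplus>\<^bsub>A\<^esub> ?x"
    using commutator_n[OF matrix_unit_sl[OF ji]] unfolding Dm_eq .
  have t2: "t [^]\<^bsub>A\<^esub> (2::nat) = t \<otimes>\<^bsub>A\<^esub> t" by (simp add: numeral_2_eq_2)
  have z: "J.wt (?b + 2) ?z"
  proof (cases "j = m \<and> i = k")
    case True
    \<comment> \<open>\<open>E_mk\<close> has weight -1, since of the four Kronecker terms only the
      one comparing \<open>i\<close> with \<open>k\<close> survives. The value required of the last
      member is therefore the weight of \<open>e\<close>.\<close>
    then have b: "?b + 2 = 1" using kk' km k'm by (simp add: kdelta_def)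
    have "J.wt 1 (e \<otimes>\<^bsub>A\<^esub> t [^]\<^bsub>A\<^esub> (2::nat))"
      using wt_t[OF wt_t[OF wt_e]] by (simp add: t2 A.m_assoc)
    then show ?thesis unfolding b by (rule J.wt_int_mult)
  next
    case False
    then have d: "kdelta j m * kdelta i k = 0" by (auto simp: kdelta_def)
    show ?thesis unfolding d by simp
  qed
  have "n \<otimes>\<^bsub>A\<^esub> ?x = (n \<otimes>\<^bsub>A\<^esub> G (Dm j i)) \<otimes>\<^bsub>A\<^esub> t" using D by (simp add: A.m_assoc)
  also have "n \<otimes>\<^bsub>A\<^esub> G (Dm j i) = G (Dm j i) \<otimes>\<^bsub>A\<^esub> n \<oplus>\<^bsub>A\<^esub> ([(- 2 * (kdelta j m * kdelta i k))] \<cdot>\<^bsub>A\<^esub> e) \<otimes>\<^bsub>A\<^esub> t"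
    unfolding commutator_n[OF Dm_sl] bracket_Dm G_int[OF matrix_unit_sl[OF km]] by (rule refl)
  also have "(G (Dm j i) \<otimes>\<^bsub>A\<^esub> n \<oplus>\<^bsub>A\<^esub> ([(- 2 * (kdelta j m * kdelta i k))] \<cdot>\<^bsub>A\<^esub> e) \<otimes>\<^bsub>A\<^esub> t) \<otimes>\<^bsub>A\<^esub> t = ?x \<otimes>\<^bsub>A\<^esub> n \<oplus>\<^bsub>A\<^esub> [(-2::int)] \<cdot>\<^bsub>A\<^esub> ?z"
  proof -
    have "G (Dm j i) \<otimes>\<^bsub>A\<^esub> n \<otimes>\<^bsub>A\<^esub> t = ?x \<otimes>\<^bsub>A\<^esub> n"
      using D t_mult[of "e \<otimes>\<^bsub>A\<^esub> t"] by (simp add: A.m_assoc)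
    moreover have "([(- 2 * (kdelta j m * kdelta i k))] \<cdot>\<^bsub>A\<^esub> e) \<otimes>\<^bsub>A\<^esub> t \<otimes>\<^bsub>A\<^esub> t = [(-2::int)] \<cdot>\<^bsub>A\<^esub> ?z"
      unfolding t2 by (simp add: A.add_pow_ldistr_int A.m_assoc J.int_mult_mult)
    ultimately show ?thesis using D by (simp add: A.l_distr)
  qed
  finally have nx: "n \<otimes>\<^bsub>A\<^esub> ?x = ?x \<otimes>\<^bsub>A\<^esub> n \<oplus>\<^bsub>A\<^esub> [(-2::int)] \<cdot>\<^bsub>A\<^esub> ?z" .
  have nz: "n \<otimes>\<^bsub>A\<^esub> ?z = ?z \<otimes>\<^bsub>A\<^esub> n"
  proof -
    have "n \<otimes>\<^bsub>A\<^esub> (e \<otimes>\<^bsub>A\<^esub> (t \<otimes>\<^bsub>A\<^esub> t)) = e \<otimes>\<^bsub>A\<^esub> n \<otimes>\<^bsub>A\<^esub> (t \<otimes>\<^bsub>A\<^esub> t)" using e_n by (simp flip: A.m_assoc)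
    also have "\<dots> = e \<otimes>\<^bsub>A\<^esub> (t \<otimes>\<^bsub>A\<^esub> t) \<otimes>\<^bsub>A\<^esub> n"
    proof -
      have "t \<otimes>\<^bsub>A\<^esub> (e \<otimes>\<^bsub>A\<^esub> y) = e \<otimes>\<^bsub>A\<^esub> (t \<otimes>\<^bsub>A\<^esub> y)" if "y \<in> carrier A" for y
        using t_mult[of e] that by (simp flip: A.m_assoc)
      then show ?thesis by (simp add: A.m_assoc)
    qed
    finally show ?thesis unfolding t2 by (simp add: A.add_pow_ldistr_int A.add_pow_rdistr_int)
  qed
  show ?thesis
    unfolding J.good_def using X wt_commutator[OF X nX] z nX nx nz D by simp
qed

lemma good_H:
  "J.good 0 (H i j) ([(- (kdelta i k - kdelta j k - kdelta i m + kdelta j m))] \<cdot>\<^bsub>A\<^esub> n) \<zero>\<^bsub>A\<^esub>"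
  (is "J.good 0 ?X ?x _")
proof -
  have X: "J.wt 0 ?X"
    using commutator_G[OF h_matrix matrix_unit_diff_sl[of i j]] unfolding bracket_h_diff
    by (simp add: J.wt_def G_zero)
  have nX: "n \<otimes>\<^bsub>A\<^esub> ?X = ?X \<otimes>\<^bsub>A\<^esub> n \<oplus>\<^bsub>A\<^esub> ?x"
    unfolding commutator_n[OF matrix_unit_diff_sl] bracket_diff G_int[OF matrix_unit_sl[OF km]]
    by (simp add: A.add_pow_ldistr_int)
  have "J.wt 1 ?x" by (rule J.wt_int_mult[OF J.wt_n])
  then show ?thesis
    unfolding J.good_def using X nX by (simp add: A.add_pow_ldistr_int A.add_pow_rdistr_int)
qed

end

text \<open>An integer is congruent modulo \<open>p\<close> to a natural number, and a natural
  multiple is a scalar multiple by an element of \<open>R\<close>.\<close>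

lemma (in jordan_hopf) prim_int_mult:
  assumes "prim x"
  shows "prim ([(c::int)] \<cdot>\<^bsub>A\<^esub> x)"
proof -
  have x: "x \<in> carrier A" using assms by (simp add: prim_def)
  obtain i where i: "int p dvd c - int i"
    using J.W_nat_ex[of c] by blast
  have "[c] \<cdot>\<^bsub>A\<^esub> x = [int i] \<cdot>\<^bsub>A\<^esub> x" by (rule J.int_mult_cong[OF i x])
  also have "\<dots> = ([i] \<cdot>\<^bsub>R\<^esub> \<one>\<^bsub>R\<^esub>) \<odot>\<^bsub>A\<^esub> x"
    unfolding J.int_mult_of_nat by (rule add_pow_smult_one[OF A.assoc_algebra_axioms x])
  finally show ?thesis using assms by (simp add: prim_smult)
qed

theorem corollary5p8:
  fixes p :: nat and q :: "'k::field" and k k' m :: "'n::finite"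
  assumes "CHAR('k) = p" and "p > 0"
    and "CARD('n) \<ge> 3"
    and "k \<noteq> k'" and "k \<noteq> m" and "k' \<noteq> m"
  shows
    "let R = tpoly p q;
         A = utq_sl p q;
         T = tensor R A A;
         tns = pure_tensor R A A;
         E = (\<lambda>i j. utq_gen p q (matrix_unit i j));
         H = (\<lambda>i j. utq_gen p q (matrix_unit i i - matrix_unit j j));
         t = tvar p q \<odot>\<^bsub>A\<^esub> \<one>\<^bsub>A\<^esub>;
         h = H k k';
         e = E k m;
         h1 = h \<oplus>\<^bsub>A\<^esub> \<one>\<^bsub>A\<^esub>;
         h_2 = h \<otimes>\<^bsub>A\<^esub> (h \<oplus>\<^bsub>A\<^esub> \<one>\<^bsub>A\<^esub>);
         h1_2 = (h \<oplus>\<^bsub>A\<^esub> \<one>\<^bsub>A\<^esub>) \<otimes>\<^bsub>A\<^esub> (h \<oplus>\<^bsub>A\<^esub> \<one>\<^bsub>A\<^esub> \<oplus>\<^bsub>A\<^esub> \<one>\<^bsub>A\<^esub>);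
         w = \<one>\<^bsub>A\<^esub> \<ominus>\<^bsub>A\<^esub> e \<otimes>\<^bsub>A\<^esub> t;
         D = (\<lambda>j i. utq_gen p q
               ((if j = m then matrix_unit k i else 0) - (if i = k then matrix_unit j m else 0)));
         a = (\<lambda>i j. kdelta i k - kdelta j k - kdelta i m + kdelta j m);
         b = (\<lambda>j i. kdelta j k - kdelta i k - kdelta j k' + kdelta i k')
     in \<exists>\<Delta> \<epsilon> S. hopf_algebra R A \<Delta> \<epsilon> S \<and>
       (\<forall>i j. i \<noteq> j \<longrightarrow>
         \<Delta> (H i j) =
           tns (H i j) \<one>\<^bsub>A\<^esub> \<oplus>\<^bsub>T\<^esub> tns \<one>\<^bsub>A\<^esub> (H i j)
             \<oplus>\<^bsub>T\<^esub> [a i j] \<cdot>\<^bsub>T\<^esub> tns h (w [^]\<^bsub>A\<^esub> (-1 :: int) \<otimes>\<^bsub>A\<^esub> e \<otimes>\<^bsub>A\<^esub> t) \<and>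
         \<Delta> (E j i) =
           tns (E j i) (w [^]\<^bsub>A\<^esub> b j i) \<oplus>\<^bsub>T\<^esub> tns \<one>\<^bsub>A\<^esub> (E j i)
             \<ominus>\<^bsub>T\<^esub> tns h (w [^]\<^bsub>A\<^esub> (-1 :: int) \<otimes>\<^bsub>A\<^esub> D j i \<otimes>\<^bsub>A\<^esub> t)
             \<ominus>\<^bsub>T\<^esub> [(kdelta j m * kdelta i k)] \<cdot>\<^bsub>T\<^esub>
                  tns h_2 (w [^]\<^bsub>A\<^esub> (-2 :: int) \<otimes>\<^bsub>A\<^esub> e \<otimes>\<^bsub>A\<^esub> t [^]\<^bsub>A\<^esub> (2 :: nat)) \<and>
         S (H i j) =
           \<ominus>\<^bsub>A\<^esub> H i j \<oplus>\<^bsub>A\<^esub> [a i j] \<cdot>\<^bsub>A\<^esub> (e \<otimes>\<^bsub>A\<^esub> h1 \<otimes>\<^bsub>A\<^esub> t) \<and>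
         S (E j i) =
           \<ominus>\<^bsub>A\<^esub> (w [^]\<^bsub>A\<^esub> (- b j i) \<otimes>\<^bsub>A\<^esub>
             (E j i \<oplus>\<^bsub>A\<^esub> D j i \<otimes>\<^bsub>A\<^esub> h1 \<otimes>\<^bsub>A\<^esub> t
               \<ominus>\<^bsub>A\<^esub> [(kdelta j m * kdelta i k)] \<cdot>\<^bsub>A\<^esub> (e \<otimes>\<^bsub>A\<^esub> h1_2 \<otimes>\<^bsub>A\<^esub> t [^]\<^bsub>A\<^esub> (2 :: nat)))) \<and>
         \<epsilon> (H i j) = \<zero>\<^bsub>R\<^esub> \<and> \<epsilon> (E j i) = \<zero>\<^bsub>R\<^esub>)"
proof -
  have p: "prime p" using assms(1,2) prime_CHAR_semidom[where 'a='k] by simp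
  interpret jordanian_sl p q "TYPE('n)" k k' m
    by unfold_locales (use assms p in simp_all)
  let ?T = "tensor R A A"
  obtain D0 where D0: "D0 \<in> alg_hom R A ?T"
    "\<And>X. X \<in> SL \<Longrightarrow> D0 (G X) = pure_tensor R A A (G X) \<one>\<^bsub>A\<^esub> \<oplus>\<^bsub>?T\<^esub> pure_tensor R A A \<one>\<^bsub>A\<^esub> (G X)"
    using primitive_maps(1) by blast
  obtain S0 where S0: "S0 \<in> alg_hom R A (opp A)" "\<And>X. X \<in> SL \<Longrightarrow> S0 (G X) = \<ominus>\<^bsub>A\<^esub> G X"
    using primitive_maps(2) by blast
  obtain e0 where e0: "e0 \<in> alg_hom R A (self_alg R)" "\<And>X. X \<in> SL \<Longrightarrow> e0 (G X) = \<zero>\<^bsub>R\<^esub>"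
    using primitive_maps(3) by blast
  interpret Y: jordan_hopf R A p h n D0 S0 e0
    by unfold_locales (rule D0(1) S0(1) e0(1))+
  have prim: "Y.prim (G X)" if "X \<in> SL" for X
    using that D0(2) S0(2) e0(2) by (simp add: Y.prim_def)
  have primt: "Y.prim (y \<otimes>\<^bsub>A\<^esub> t)" if "Y.prim y" for y
    using that Y.prim_smult[OF tvar_closed that] by (simp add: mult_t Y.prim_def)
  have pn: "Y.prim n" by (rule primt[OF prim[OF matrix_unit_sl[OF km]]])
  have prim0: "Y.prim \<zero>\<^bsub>A\<^esub>" using prim[OF zero_sl] by (simp add: G_zero)
  have t2: "t [^]\<^bsub>A\<^esub> (2::nat) = t \<otimes>\<^bsub>A\<^esub> t" by (simp add: numeral_2_eq_2)
  have gE: "Y.good (kdelta j k - kdelta i k - kdelta j k' + kdelta i k') (E j i) (G (Dm j i) \<otimes>\<^bsub>A\<^esub> t)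
      ([(kdelta j m * kdelta i k)] \<cdot>\<^bsub>A\<^esub> (e \<otimes>\<^bsub>A\<^esub> t [^]\<^bsub>A\<^esub> (2::nat)))" if "j \<noteq> i" for i j
    unfolding Y.good_def
    using good_E[OF that] prim[OF matrix_unit_sl[OF that]] primt[OF prim[OF Dm_sl]] Y.prim_int_mult[OF primt[OF pn]]
    by (simp add: t2 A.m_assoc)
  have gH: "Y.good 0 (H i j) ([(- (kdelta i k - kdelta j k - kdelta i m + kdelta j m))] \<cdot>\<^bsub>A\<^esub> n) \<zero>\<^bsub>A\<^esub>" for i j
    unfolding Y.good_def
    using good_H[of i j] prim[OF matrix_unit_diff_sl] Y.prim_int_mult[OF pn] prim0 by simp
  interpret Y: jordan_hopf_gen R A p h n D0 S0 e0
  proof unfold_locales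
    show "Y.prim h" by (rule prim[OF h_matrix])
    show "Y.prim n" by (rule pn)
    fix Q x
    assume x: "x \<in> carrier A" and one: "Q \<one>\<^bsub>A\<^esub>"
      and good: "\<And>b X x z. Y.good b X x z \<Longrightarrow> Q X"
      and add: "\<And>x y. x \<in> carrier A \<Longrightarrow> y \<in> carrier A \<Longrightarrow> Q x \<Longrightarrow> Q y \<Longrightarrow> Q (x \<oplus>\<^bsub>A\<^esub> y)"
      and mult: "\<And>x y. x \<in> carrier A \<Longrightarrow> y \<in> carrier A \<Longrightarrow> Q x \<Longrightarrow> Q y \<Longrightarrow> Q (x \<otimes>\<^bsub>A\<^esub> y)"
      and smult: "\<And>r x. r \<in> carrier R \<Longrightarrow> x \<in> carrier A \<Longrightarrow> Q x \<Longrightarrow> Q (r \<odot>\<^bsub>A\<^esub> x)"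
    \<comment> \<open>The formulas of the triples are known for matrix units and differences of
      diagonal ones only, so the property is first spread over \<open>sl\<close> by linearity and
      then over \<open>A\<close>.\<close>
    have "Q (G X)" if "X \<in> SL" for X
      using that
    proof (induction rule: sl_induct)
      case (unit i j)
      then show ?case using good[OF gE] by blast
    next
      case (diff i j)
      then show ?case using good[OF gH] by blast
    next
      case (add X Y)
      then show ?case using assms by (simp add: G_add \<open>\<And>x y. _ \<Longrightarrow> _ \<Longrightarrow> _ \<Longrightarrow> _ \<Longrightarrow> Q (x \<oplus>\<^bsub>A\<^esub> y)\<close>)
    next
      case (scale c X)
      interpret RK: assoc_algebra K R by (rule tpoly_assoc)
      show ?case using scale by (simp add: G_scale smult)
    next
      case zero
      have "Q (\<zero>\<^bsub>R\<^esub> \<odot>\<^bsub>A\<^esub> \<one>\<^bsub>A\<^esub>)" by (rule smult) (simp_all add: one)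
      then show ?case by (simp add: G_zero)
    qed
    note QG = this
    show "Q x" by (rule A_induct[OF x, of Q]) (simp_all add: one QG add mult smult)
  qed
  have w: "\<one>\<^bsub>A\<^esub> \<ominus>\<^bsub>A\<^esub> n = Y.w" by (simp add: J.w_def)
  have Wp: "Y.w [^]\<^bsub>A\<^esub> (c::int) = Y.W c" for c
    by (rule J.zpow_int_pow[OF J.w_closed J.wp])
  let ?a = "\<lambda>i j. kdelta i k - kdelta j k - kdelta i m + kdelta j m"
  let ?b = "\<lambda>j i. kdelta j k - kdelta i k - kdelta j k' + kdelta i k'"
  let ?d = "\<lambda>j i. kdelta j m * kdelta i k"
  have WHe: "Y.W (-1) \<otimes>\<^bsub>A\<^esub> e \<otimes>\<^bsub>A\<^esub> t = Y.W (-1) \<otimes>\<^bsub>A\<^esub> n" by (simp add: A.m_assoc)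
  \<comment> \<open>The middle member of the triple of \<open>H i j\<close> carries the opposite
    sign of the coefficient in the theorem, so the minus sign of \<open>\<Delta>_good\<close> turns
    into a plus.\<close>
  have DH: "Y.\<Delta> (H i j) = Y.pt (H i j) \<one>\<^bsub>A\<^esub> \<oplus>\<^bsub>?T\<^esub> Y.pt \<one>\<^bsub>A\<^esub> (H i j) \<oplus>\<^bsub>?T\<^esub>
      [(?a i j)] \<cdot>\<^bsub>?T\<^esub> Y.pt h (Y.W (-1) \<otimes>\<^bsub>A\<^esub> e \<otimes>\<^bsub>A\<^esub> t)" for i j
    unfolding Y.\<Delta>_good[OF gH] WHe
    by (simp add: A.add_pow_rdistr_int Y.pt_int_r Y.TT.int_mult_neg a_minus_def del: minus_diff_eq minus_add_distrib)
  have DE: "Y.\<Delta> (E j i) = Y.pt (E j i) (Y.W (?b j i)) \<oplus>\<^bsub>?T\<^esub> Y.pt \<one>\<^bsub>A\<^esub> (E j i) \<ominus>\<^bsub>?T\<^esub>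
      Y.pt h (Y.W (-1) \<otimes>\<^bsub>A\<^esub> G (Dm j i) \<otimes>\<^bsub>A\<^esub> t) \<ominus>\<^bsub>?T\<^esub>
      [(?d j i)] \<cdot>\<^bsub>?T\<^esub> Y.pt (h \<otimes>\<^bsub>A\<^esub> (h \<oplus>\<^bsub>A\<^esub> \<one>\<^bsub>A\<^esub>)) (Y.W (-2) \<otimes>\<^bsub>A\<^esub> e \<otimes>\<^bsub>A\<^esub> t [^]\<^bsub>A\<^esub> (2::nat))" if "j \<noteq> i" for i j
    unfolding Y.\<Delta>_good[OF gE[OF that]] using G_closed[OF Dm_sl, of j i]
    by (simp add: A.add_pow_rdistr_int Y.pt_int_r A.m_assoc)
  have SH: "Y.S (H i j) = \<ominus>\<^bsub>A\<^esub> H i j \<oplus>\<^bsub>A\<^esub> [(?a i j)] \<cdot>\<^bsub>A\<^esub> (e \<otimes>\<^bsub>A\<^esub> (h \<oplus>\<^bsub>A\<^esub> \<one>\<^bsub>A\<^esub>) \<otimes>\<^bsub>A\<^esub> t)" for i j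
  proof -
    \<comment> \<open>The central element \<open>t\<close> is moved to the right end, where the
      theorem has it.\<close>
    have "n \<otimes>\<^bsub>A\<^esub> (h \<oplus>\<^bsub>A\<^esub> \<one>\<^bsub>A\<^esub>) = e \<otimes>\<^bsub>A\<^esub> (h \<oplus>\<^bsub>A\<^esub> \<one>\<^bsub>A\<^esub>) \<otimes>\<^bsub>A\<^esub> t"
      using t_mult[of "h \<oplus>\<^bsub>A\<^esub> \<one>\<^bsub>A\<^esub>"] by (simp add: A.m_assoc)
    then show ?thesis unfolding Y.S_good(2)[OF gH] J.int_mult_neg[OF J.n]
      by (simp add: a_minus_def A.minus_add A.l_minus A.add_pow_ldistr_int)
  qed
  have SE: "Y.S (E j i) = \<ominus>\<^bsub>A\<^esub> (Y.W (- ?b j i) \<otimes>\<^bsub>A\<^esub> (E j i \<oplus>\<^bsub>A\<^esub> G (Dm j i) \<otimes>\<^bsub>A\<^esub> (h \<oplus>\<^bsub>A\<^esub> \<one>\<^bsub>A\<^esub>) \<otimes>\<^bsub>A\<^esub> t \<ominus>\<^bsub>A\<^esub>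
      [(?d j i)] \<cdot>\<^bsub>A\<^esub> (e \<otimes>\<^bsub>A\<^esub> ((h \<oplus>\<^bsub>A\<^esub> \<one>\<^bsub>A\<^esub>) \<otimes>\<^bsub>A\<^esub> (h \<oplus>\<^bsub>A\<^esub> \<one>\<^bsub>A\<^esub> \<oplus>\<^bsub>A\<^esub> \<one>\<^bsub>A\<^esub>)) \<otimes>\<^bsub>A\<^esub> t [^]\<^bsub>A\<^esub> (2::nat))))" if "j \<noteq> i" for i j
  proof -
    define h1 where "h1 = h \<oplus>\<^bsub>A\<^esub> \<one>\<^bsub>A\<^esub>"
    define h12 where "h12 = h1 \<otimes>\<^bsub>A\<^esub> (h1 \<oplus>\<^bsub>A\<^esub> \<one>\<^bsub>A\<^esub>)"
    have c: "h1 \<in> carrier A" "h12 \<in> carrier A" by (simp_all add: h1_def h12_def)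
    have D: "G (Dm j i) \<in> carrier A" by (rule G_closed[OF Dm_sl])
    have "G (Dm j i) \<otimes>\<^bsub>A\<^esub> t \<otimes>\<^bsub>A\<^esub> h1 = G (Dm j i) \<otimes>\<^bsub>A\<^esub> h1 \<otimes>\<^bsub>A\<^esub> t"
      using c D t_mult[OF c(1)] by (simp add: A.m_assoc)
    moreover have "e \<otimes>\<^bsub>A\<^esub> (t \<otimes>\<^bsub>A\<^esub> t) \<otimes>\<^bsub>A\<^esub> h12 = e \<otimes>\<^bsub>A\<^esub> h12 \<otimes>\<^bsub>A\<^esub> (t \<otimes>\<^bsub>A\<^esub> t)"
    proof -
      have "t \<otimes>\<^bsub>A\<^esub> (t \<otimes>\<^bsub>A\<^esub> h12) = h12 \<otimes>\<^bsub>A\<^esub> t \<otimes>\<^bsub>A\<^esub> t"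
        using c t_mult[OF c(2)] t_mult[of "h12 \<otimes>\<^bsub>A\<^esub> t"] by (simp add: A.m_assoc)
      then show ?thesis using c by (simp add: A.m_assoc)
    qed
    ultimately show ?thesis
      unfolding Y.S_good(2)[OF gE[OF that]] h1_def[symmetric] h12_def[symmetric] t2
      using c by (simp add: A.add_pow_ldistr_int)
  qed
  have "hopf_algebra R A Y.\<Delta> e0 Y.S" by (rule Y.hopf)
  moreover have "e0 (H i j) = \<zero>\<^bsub>R\<^esub>" for i j using e0(2)[OF matrix_unit_diff_sl] .
  moreover have "e0 (E j i) = \<zero>\<^bsub>R\<^esub>" if "j \<noteq> i" for i j using e0(2)[OF matrix_unit_sl[OF that]] .
  ultimately show ?thesis
    unfolding Let_def w Wp using DH DE SH SE
    by (intro exI[of _ Y.\<Delta>] exI[of _ e0] exI[of _ Y.S]) auto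
qed

end
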